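(* Let $\varphi:\mathcal M\to\mathbb R$ be measurable, write $\varphi_\omega:=\varphi(\omega,\cdot)$, and suppose that $\int_{M_\omega}\varphi_\omega\,d\mu_\omega=0$ for $\mathbb P$-a.e. $\omega$, that $\varphi_\omega$ is Lipschitz for $\mathbb P$-a.e. $\omega$, and that $\omega\mapsto\|\varphi_\omega\|_{\mathrm{Lip}}$ belongs to $L^r(\Omega,\mathcal F,\mathbb P)$ for some $0<r\le\infty$. Let $p>0$ be such that $\frac1p+\frac1r<\frac14$. Suppose that the decay condition holds with exponent $p$ and $\mathcal I=\{2,2\tilde s\}$, where $2>\tilde s>\frac1{1-\frac2p-\frac2r}$, that $a_{2,n}=O(n^{-b})$ with $b>1$ satisfying $\frac{2/p+4/r}{b-1}<1-\frac4r-\frac2p$, and that $\sum_{n=1}^\infty a_{2\tilde s,n}<+\infty$. Then for $\mathbb P$-a.e. $\omega\in\Omega$ and all $\delta>0$, $$\Big\|\sum_{j=0}^{n-1}(H_{\omega,j}\circ T_\omega^j)^2-\sum_{j=0}^{n-1}\mathbb E_{\sigma^j\omega}[(H_{\omega,j})^2]\Big\|_{L^{\tilde s}(\mu_\omega)}=O\Big(n^{\frac12+\frac2p+\frac2r+\delta}+n^{-1+\frac2{\tilde s}+\frac2p+\frac2r+2\delta}+n^{\frac12+\frac{\delta_*}2+\frac1p+\frac2r+\delta}+n^{1+\frac1p+\frac2r+\frac{\delta_*(1-b)}2}\Big),$$ where $\delta_*>0$ satisfies $$\delta_*+\frac2p+\frac4r+\delta+1<2\qquad\text{and}\qquad2+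\frac2p+\frac4r+\delta+\delta_*(1-b)<2.$$
   Context: Setting: $(\Omega,\mathcal F,\mathbb P,\sigma)$ is an ergodic probability-preserving system. $M$ is a metric space and $M_\omega\subset M$, $\omega\in\Omega$, are closed subsets such that $\mathcal M:=\{(\omega,x):\omega\in\Omega,\ x\in M_\omega\}\in\mathcal F\otimes\mathcal B(M)$. The maps $T_\omega:M_\omega\to M_{\sigma\omega}$ are such that $(\omega,x)\mapsto T_\omega(x)$ is measurable; $T_\omega^n:=T_{\sigma^{n-1}\omega}\circ\cdots\circ T_{\sigma\omega}\circ T_\omega$, $T_\omega^0=\mathrm{Id}$. $\mu_\omega$ are Borel probability measures on $M_\omega$ with $(T_\omega)_*\mu_\omega=\mu_{\sigma\omega}$ for $\mathbb P$-a.e. $\omega$, such that $\omega\mapsto\mu_\omega(\mathcal C_\omega)$ is measurable for every measurable $\mathcal C\subset\mathcal M$, where $\mathcal C_\omega=\{x\in M_\omega:(\omega,x)\in\mathcal C\}$. $\mathbb E_\omega$ denotes expectation with respect to $\mu_\omega$. $L_\omega$ is the transfer operator of $T_\omega$ with respect to these measures: $\int_{M_\omega}g\cdot(f\circ T_\omega)\,d\mu_\omega=\int_{M_{\sigma\omega}}(L_\omega g)f\,d\mu_{\sigma\omega}$ for bounded measurable $g:M_\omega\to\mathbb R$, $f:M_{\sigma\omega}\to\mathbb R$; $L_\omega^n=L_{\sigma^{n-1}\omega}\circ\cdots\circ L_{\sigma\omega}\circ L_\omega$, $L_\omega^0=\mathrm{Id}$. $\|\cdot\|_{\mathrm{Lip}}$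 is the usual Lipschitz norm (supremum norm plus Lipschitz constant) and $[g]_\omega:=g-\mu_\omega(g)$. Decay condition (with finite set $\mathcal I\subset(0,\infty)$, exponent $p>0$ and, for each $s\in\mathcal I$, a decreasing sequence $(a_{s,n})_{n\ge0}$ of positive numbers converging to $0$): there is a random variable $K\in L^p(\Omega,\mathcal F,\mathbb P)$ such that for $\mathbb P$-a.e. $\omega$, every $s\in\mathcal I$, all integers $0\le r'\le i\le j$ and all Lipschitz $g_1:M_{\sigma^{r'}\omega}\to\mathbb R$, $g_2:M_{\sigma^i\omega}\to\mathbb R$, $$\big\|\big[L_{\sigma^i\omega}^{j-i}\big(g_2\,L_{\sigma^{r'}\omega}^{i-r'}(g_1)\big)\big]_{\sigma^j\omega}\big\|_{L^s(\mu_{\sigma^j\omega})}\le K(\sigma^i\omega)\,a_{s,j-i}\,(1+\|g_1\|_{\mathrm{Lip}})(1+\|g_2\|_{\mathrm{Lip}}).$$ Martingale part: for $n\ge0$, $G_{\omega,n}:=\sum_{j=0}^{n-1}L_{\sigma^j\omega}^{n-j}(\varphi_{\sigma^j\omega})$ (so $G_{\omega,0}=0$) and $H_{\omega,n}:=\varphi_{\sigma^n\omega}+G_{\omega,n}-G_{\omega,n+1}\circ T_{\sigma^n\omega}$. Convention: $1/\infty=0$. The $O(\cdot)$ is as $n\to\infty$ with a constant that may depend on $\omega,\delta,\delta_*$. *)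

theory Defs
  imports "HOL-Analysis.Analysis" "HOL-Probability.Probability_Measure" "HOL-Library.Landau_Symbols"
begin

definition ergodic_pps :: "'w measure \<Rightarrow> ('w \<Rightarrow> 'w) \<Rightarrow> bool" where
  "ergodic_pps P \<sigma> \<longleftrightarrow>
     prob_space P \<and> \<sigma> \<in> measurable P P \<and> distr P P \<sigma> = P \<and>
     (\<forall>A\<in>sets P. \<sigma> -` A \<inter> space P = A \<longrightarrow> measure P A = 0 \<or> measure P A = 1)"

text \<open>Fibres, fibre maps and fibre measures over a base system. The total space is
  \<open>Sigma (space P) Mf\<close>; each fibre measure has the fibre itself as its underlying space.\<close>

definition random_system ::
  "'w measure \<Rightarrow> ('w \<Rightarrow> 'w) \<Rightarrow> ('w \<Rightarrow> 'm::metric_space set) \<Rightarrow> ('w \<Rightarrow> 'm \<Rightarrow> 'm)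
     \<Rightarrow> ('w \<Rightarrow> 'm measure) \<Rightarrow> bool" where
  "random_system P \<sigma> Mf T \<mu> \<longleftrightarrow>
     ergodic_pps P \<sigma> \<and>
     (\<forall>\<omega>\<in>space P. closed (Mf \<omega>)) \<and>
     Sigma (space P) Mf \<in> sets (P \<Otimes>\<^sub>M borel) \<and>
     (\<forall>\<omega>\<in>space P. T \<omega> ` Mf \<omega> \<subseteq> Mf (\<sigma> \<omega>)) \<and>
     (\<lambda>(\<omega>, x). T \<omega> x) \<in> borel_measurable (restrict_space (P \<Otimes>\<^sub>M borel) (Sigma (space P) Mf)) \<and>
     (\<forall>\<omega>\<in>space P. prob_space (\<mu> \<omega>) \<and> sets (\<mu> \<omega>) = sets (restrict_space borel (Mf \<omega>))) \<and>
     (AE \<omega> in P. distr (\<mu> \<omega>) (\<mu> (\<sigma> \<omega>)) (T \<omega>) = \<mu> (\<sigma> \<omega>)) \<and>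
     (\<forall>C\<in>sets (P \<Otimes>\<^sub>M borel). C \<subseteq> Sigma (space P) Mf \<longrightarrow>
        (\<lambda>\<omega>. measure (\<mu> \<omega>) {x \<in> Mf \<omega>. (\<omega>, x) \<in> C}) \<in> borel_measurable P)"

definition bdd_measurable :: "'a measure \<Rightarrow> ('a \<Rightarrow> real) \<Rightarrow> bool" where
  "bdd_measurable N f \<longleftrightarrow> f \<in> borel_measurable N \<and> bounded (f ` space N)"

text \<open>The defining duality determines \<open>L g\<close> only up to \<open>N'\<close>-null sets, and its class is
  essentially bounded. So \<open>L\<close> is an arbitrary choice of bounded versions, which makes iterates
  and products with bounded functions again admissible arguments.\<close>

definition is_transfer_operator ::
  "'a measure \<Rightarrow> 'b measure \<Rightarrow> ('a \<Rightarrow> 'b) \<Rightarrow> (('a \<Rightarrow> real) \<Rightarrow> ('b \<Rightarrow> real)) \<Rightarrow> bool" where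
  "is_transfer_operator N N' T L \<longleftrightarrow>
     (\<forall>g. bdd_measurable N g \<longrightarrow> bdd_measurable N' (L g) \<and>
        (\<forall>f. bdd_measurable N' f \<longrightarrow>
           (\<integral>x. g x * f (T x) \<partial>N) = (\<integral>y. L g y * f y \<partial>N')))"

text \<open>\<open>cocycle \<sigma> F n \<omega> = F (\<sigma>\<^sup>n\<^sup>-\<^sup>1 \<omega>) \<circ> \<dots> \<circ> F (\<sigma> \<omega>) \<circ> F \<omega>\<close>, used both for the fibre maps and
  for the transfer operators.\<close>

primrec cocycle :: "('w \<Rightarrow> 'w) \<Rightarrow> ('w \<Rightarrow> 'x \<Rightarrow> 'x) \<Rightarrow> nat \<Rightarrow> 'w \<Rightarrow> 'x \<Rightarrow> 'x" where
  "cocycle \<sigma> F 0 \<omega> = id"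
| "cocycle \<sigma> F (Suc n) \<omega> = F ((\<sigma> ^^ n) \<omega>) \<circ> cocycle \<sigma> F n \<omega>"

text \<open>The Lipschitz norm is real-valued and meaningful only for functions satisfying
  \<open>lipschitz_fun\<close>, i.e. those for which supremum norm and Lipschitz constant are finite. The
  infimum form of the Lipschitz constant gives 0 on a one-point set.\<close>

definition lipschitz_fun :: "'m::metric_space set \<Rightarrow> ('m \<Rightarrow> real) \<Rightarrow> bool" where
  "lipschitz_fun A g \<longleftrightarrow> bounded (g ` A) \<and> (\<exists>C. C-lipschitz_on A g)"

definition lip_norm :: "'m::metric_space set \<Rightarrow> ('m \<Rightarrow> real) \<Rightarrow> real" where
  "lip_norm A g = (SUP x\<in>A. \<bar>g x\<bar>) + Inf {C. C-lipschitz_on A g}"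

text \<open>Membership in \<open>L\<^sup>q\<close> for \<open>0 < q \<le> \<infinity>\<close>. Elements are classes modulo null sets, so \<open>f\<close> need only
  agree almost everywhere with a measurable function.\<close>

definition in_Lp :: "'a measure \<Rightarrow> ennreal \<Rightarrow> ('a \<Rightarrow> real) \<Rightarrow> bool" where
  "in_Lp N q f \<longleftrightarrow>
     (\<exists>g\<in>borel_measurable N. (AE x in N. f x = g x) \<and>
        (if q = \<infinity> then \<exists>C. AE x in N. \<bar>g x\<bar> \<le> C
         else integrable N (\<lambda>x. \<bar>g x\<bar> powr enn2real q)))"

definition Lp_norm :: "'a measure \<Rightarrow> real \<Rightarrow> ('a \<Rightarrow> real) \<Rightarrow> real" where
  "Lp_norm N s f = (\<integral>x. \<bar>f x\<bar> powr s \<partial>N) powr (1 / s)"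

definition centered :: "'a measure \<Rightarrow> ('a \<Rightarrow> real) \<Rightarrow> 'a \<Rightarrow> real" where
  "centered N g = (\<lambda>x. g x - (\<integral>y. g y \<partial>N))"

definition decay_condition ::
  "'w measure \<Rightarrow> ('w \<Rightarrow> 'w) \<Rightarrow> ('w \<Rightarrow> 'm::metric_space set) \<Rightarrow> ('w \<Rightarrow> 'm measure)
     \<Rightarrow> ('w \<Rightarrow> ('m \<Rightarrow> real) \<Rightarrow> 'm \<Rightarrow> real) \<Rightarrow> real \<Rightarrow> real set \<Rightarrow> (real \<Rightarrow> nat \<Rightarrow> real) \<Rightarrow> bool" where
  "decay_condition P \<sigma> Mf \<mu> L p I a \<longleftrightarrow>
     finite I \<and> I \<subseteq> {0<..} \<and> 0 < p \<and>
     (\<forall>s\<in>I. decseq (a s) \<and> (\<forall>n. 0 < a s n) \<and> a s \<longlonglongrightarrow> 0) \<and>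
     (\<exists>K. K \<in> borel_measurable P \<and> in_Lp P (ennreal p) K \<and>
        (AE \<omega> in P. \<forall>s\<in>I. \<forall>r' i j. r' \<le> i \<and> i \<le> j \<longrightarrow>
           (\<forall>g1 g2. lipschitz_fun (Mf ((\<sigma> ^^ r') \<omega>)) g1 \<and> lipschitz_fun (Mf ((\<sigma> ^^ i) \<omega>)) g2 \<longrightarrow>
              Lp_norm (\<mu> ((\<sigma> ^^ j) \<omega>)) s
                (centered (\<mu> ((\<sigma> ^^ j) \<omega>))
                   (cocycle \<sigma> L (j - i) ((\<sigma> ^^ i) \<omega>)
                      (\<lambda>x. g2 x * cocycle \<sigma> L (i - r') ((\<sigma> ^^ r') \<omega>) g1 x)))
              \<le> K ((\<sigma> ^^ i) \<omega>) * a s (j - i)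
                 * (1 + lip_norm (Mf ((\<sigma> ^^ r') \<omega>)) g1)
                 * (1 + lip_norm (Mf ((\<sigma> ^^ i) \<omega>)) g2))))"

definition G_part ::
  "('w \<Rightarrow> 'w) \<Rightarrow> ('w \<Rightarrow> ('m \<Rightarrow> real) \<Rightarrow> 'm \<Rightarrow> real) \<Rightarrow> ('w \<Rightarrow> 'm \<Rightarrow> real) \<Rightarrow> 'w \<Rightarrow> nat \<Rightarrow> 'm \<Rightarrow> real" where
  "G_part \<sigma> L \<phi> \<omega> n =
     (\<lambda>x. \<Sum>j<n. cocycle \<sigma> L (n - j) ((\<sigma> ^^ j) \<omega>) (\<phi> ((\<sigma> ^^ j) \<omega>)) x)"

definition H_part ::
  "('w \<Rightarrow> 'w) \<Rightarrow> ('w \<Rightarrow> 'm \<Rightarrow> 'm) \<Rightarrow> ('w \<Rightarrow> ('m \<Rightarrow> real) \<Rightarrow> 'm \<Rightarrow> real) \<Rightarrow> ('w \<Rightarrow> 'm \<Rightarrow> real)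
     \<Rightarrow> 'w \<Rightarrow> nat \<Rightarrow> 'm \<Rightarrow> real" where
  "H_part \<sigma> T L \<phi> \<omega> n =
     (\<lambda>x. \<phi> ((\<sigma> ^^ n) \<omega>) x + G_part \<sigma> L \<phi> \<omega> n x
          - G_part \<sigma> L \<phi> \<omega> (n + 1) (T ((\<sigma> ^^ n) \<omega>) x))"

definition quadratic_deviation ::
  "('w \<Rightarrow> 'w) \<Rightarrow> ('w \<Rightarrow> 'm \<Rightarrow> 'm) \<Rightarrow> ('w \<Rightarrow> 'm measure) \<Rightarrow> ('w \<Rightarrow> ('m \<Rightarrow> real) \<Rightarrow> 'm \<Rightarrow> real)
     \<Rightarrow> ('w \<Rightarrow> 'm \<Rightarrow> real) \<Rightarrow> 'w \<Rightarrow> nat \<Rightarrow> 'm \<Rightarrow> real" where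
  "quadratic_deviation \<sigma> T \<mu> L \<phi> \<omega> n =
     (\<lambda>x. (\<Sum>j<n. (H_part \<sigma> T L \<phi> \<omega> j (cocycle \<sigma> T j \<omega> x))\<^sup>2)
        - (\<Sum>j<n. \<integral>y. (H_part \<sigma> T L \<phi> \<omega> j y)\<^sup>2 \<partial>\<mu> ((\<sigma> ^^ j) \<omega>)))"

text \<open>The convention \<open>1 / \<infinity> = 0\<close>.\<close>

definition recip :: "ennreal \<Rightarrow> real" where
  "recip r = enn2real (1 / r)"

lemma recip_top: "recip \<infinity> = 0"
  by (simp add: recip_def)

lemma recip_ennreal: "0 < t \<Longrightarrow> recip (ennreal t) = 1 / t"
  by (simp add: recip_def divide_ennreal flip: ennreal_1)

end

theory Submission
  imports Defs
begin

text \<open>Fix a generic \<open>\<omega>\<close> and regard the system along its orbit as a nonstationary one on probability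
spaces \<open>\<mu>\<^sub>k\<close>. Abbreviate \<open>\<alpha> = 1/p\<close>, \<open>\<rho> = 1/r\<close>. By Borel--Cantelli, a random variable in \<open>L\<^sup>q\<close> grows
at most like \<open>n powr (1/q)\<close> along almost every orbit (lemma \<open>AE_growth_along_orbit\<close>). So up to time
\<open>n\<close> the decay factor \<open>K\<close> is at most \<open>\<kappa> = C n powr \<alpha>\<close> and the Lipschitz norms are at most
\<open>v = C n powr \<rho>\<close>. All estimates below are for one such \<open>n\<close>, with explicit constants.

The squares of the martingale differences are rewritten with the identity (\<open>H_square\<close>)

\<open>H\<^sub>j\<^sup>2 = Y\<^sub>j + G\<^sub>j\<^sup>2 - (G\<^sub>j\<^sub>+\<^sub>1 \<circ> T\<^sub>j)\<^sup>2 - 2 D\<^sub>j\<close>, where \<open>Y\<^sub>j = \<phi>\<^sub>j\<^sup>2 + 2 \<phi>\<^sub>j G\<^sub>j\<close> and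
\<open>D\<^sub>j = H\<^sub>j (G\<^sub>j\<^sub>+\<^sub>1 \<circ> T\<^sub>j)\<close>.

Summed along the orbit, the three pieces behave as follows (\<open>quad_norm_le\<close>).

\<^item> The squares of \<open>G\<close> telescope. What remains is of size \<open>\<parallel>G\<^sub>n\<parallel>\<^sup>2\<close> in \<open>L\<^sup>2\<^sup>s\<close>, hence of order
\<open>(\<kappa> v)\<^sup>2\<close>, because \<open>a (2 * s)\<close> is summable.

\<^item> \<open>Y\<^sub>j\<close> is a sum over \<open>i \<le> j\<close> of products \<open>\<phi>\<^sub>j L\<^sup>j\<^sup>-\<^sup>i \<phi>\<^sub>i\<close>, to which the decay condition applies.
Its contribution is estimated in \<open>L\<^sup>2\<close> through covariances. In the covariance of times \<open>j \<le> k\<close>,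
the summands with \<open>j - i \<le> m\<close> are controlled by decay over \<open>k - j\<close>, at the price of a factor \<open>m\<close>,
and the others by decay over \<open>j - i\<close>. The choice \<open>m = n powr \<delta>\<^sub>s\<close> produces the exponents
\<open>1/2 + \<delta>\<^sub>s/2 + \<alpha> + 2\<rho>\<close> and \<open>1 + \<alpha> + 2\<rho> + \<delta>\<^sub>s (1 - b)/2\<close>.

\<^item> \<open>D\<^sub>j\<close> is again a reverse martingale difference, so the von Bahr--Esseen inequality bounds its sum
in \<open>L\<^sup>q\<close>, \<open>s \<le> q \<le> 2\<close>, by \<open>n powr (1/q)\<close> times \<open>L\<^sup>2\<^sup>q\<close> norms of \<open>H\<^sub>j\<close> and \<open>G\<^sub>j\<^sub>+\<^sub>1\<close>. Taking \<open>q = s\<close>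
can be too weak when \<open>s < b\<close>. In that case \<open>q\<close> is taken as large as needed below \<open>b\<close>, and the decay in
\<open>L\<^sup>2\<^sup>q\<close> is obtained by interpolation between \<open>L\<^sup>2\<close> and \<open>L\<^sup>\<infinity>\<close> (\<open>G_norm_power_bound\<close>). The result is
the exponent \<open>1/2 + 1/(2b) + \<alpha> + 2\<rho>\<close>. It is at most the larger of the two exponents of the correlation part
whatever \<open>\<delta>\<^sub>s\<close> is, since of those two one increases and one decreases in \<open>\<delta>\<^sub>s\<close>, and at \<open>\<delta>\<^sub>s = 1/b\<close> both
have exactly this value.\<close>

section \<open>Bounded measurable functions\<close>

lemma bdd_measurableI:
  assumes "f \<in> borel_measurable N" "\<And>x. x \<in> space N \<Longrightarrow> \<bar>f x\<bar> \<le> C"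
  shows "bdd_measurable N f"
  using assms unfolding bdd_measurable_def bounded_iff by (auto intro!: exI[of _ C])

lemma bdd_measurableE:
  assumes "bdd_measurable N f"
  obtains C where "0 \<le> C" "\<And>x. x \<in> space N \<Longrightarrow> \<bar>f x\<bar> \<le> C"
proof -
  obtain C where C: "\<forall>y\<in>f ` space N. norm y \<le> C"
    using assms unfolding bdd_measurable_def bounded_iff by blast
  show thesis
    by (rule that[of "max 0 C"]) (use C in \<open>auto simp: le_max_iff_disj\<close>)
qed

lemma bdd_measurable_borel [dest]: "bdd_measurable N f \<Longrightarrow> f \<in> borel_measurable N"
  by (simp add: bdd_measurable_def)

named_theorems bdd_measurable_intros

lemma bdd_measurable_const [bdd_measurable_intros]: "bdd_measurable N (\<lambda>x. c)"
  by (rule bdd_measurableI[of _ _ "\<bar>c\<bar>"]) auto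

lemma bdd_measurable_add [bdd_measurable_intros]:
  assumes "bdd_measurable N f" "bdd_measurable N g"
  shows "bdd_measurable N (\<lambda>x. f x + g x)"
proof -
  obtain C where "\<And>x. x \<in> space N \<Longrightarrow> \<bar>f x\<bar> \<le> C" using bdd_measurableE[OF assms(1)] by blast
  moreover obtain D where "\<And>x. x \<in> space N \<Longrightarrow> \<bar>g x\<bar> \<le> D" using bdd_measurableE[OF assms(2)] by blast
  ultimately have "\<bar>f x + g x\<bar> \<le> C + D" if "x \<in> space N" for x
    using that by (smt (verit))
  then show ?thesis using assms by (intro bdd_measurableI) (auto intro!: borel_measurable_add)
qed

lemma bdd_measurable_mult [bdd_measurable_intros]:
  assumes "bdd_measurable N f" "bdd_measurable N g"
  shows "bdd_measurable N (\<lambda>x. f x * g x)"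
proof -
  obtain C where C: "\<And>x. x \<in> space N \<Longrightarrow> \<bar>f x\<bar> \<le> C" "0 \<le> C" using bdd_measurableE[OF assms(1)] by blast
  moreover obtain D where "\<And>x. x \<in> space N \<Longrightarrow> \<bar>g x\<bar> \<le> D" using bdd_measurableE[OF assms(2)] by blast
  ultimately have "\<bar>f x * g x\<bar> \<le> C * D" if "x \<in> space N" for x
    using that by (auto simp: abs_mult intro!: mult_mono)
  then show ?thesis using assms by (intro bdd_measurableI) (auto intro!: borel_measurable_times)
qed

lemma bdd_measurable_uminus [bdd_measurable_intros]:
  "bdd_measurable N f \<Longrightarrow> bdd_measurable N (\<lambda>x. - f x)"
  using bdd_measurable_mult[OF bdd_measurable_const[of N "-1"], of f] by simp

lemma bdd_measurable_diff [bdd_measurable_intros]: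
  "bdd_measurable N f \<Longrightarrow> bdd_measurable N g \<Longrightarrow> bdd_measurable N (\<lambda>x. f x - g x)"
  using bdd_measurable_add[OF _ bdd_measurable_uminus, of N f g] by simp

lemma bdd_measurable_power2 [bdd_measurable_intros]:
  "bdd_measurable N f \<Longrightarrow> bdd_measurable N (\<lambda>x. (f x)\<^sup>2)"
  using bdd_measurable_mult[of N f f] by (simp add: power2_eq_square)

lemma bdd_measurable_sum [bdd_measurable_intros]:
  "(\<And>i. i \<in> S \<Longrightarrow> bdd_measurable N (f i)) \<Longrightarrow> bdd_measurable N (\<lambda>x. \<Sum>i\<in>S. f i x)"
  by (induction S rule: infinite_finite_induct) (auto intro: bdd_measurable_intros)

lemma bdd_measurable_abs_powr [bdd_measurable_intros]:
  assumes "bdd_measurable N f" "0 \<le> q"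
  shows "bdd_measurable N (\<lambda>x. \<bar>f x\<bar> powr q)"
proof -
  obtain C where "\<And>x. x \<in> space N \<Longrightarrow> \<bar>f x\<bar> \<le> C" using bdd_measurableE[OF assms(1)] by blast
  then have "\<bar>\<bar>f x\<bar> powr q\<bar> \<le> C powr q" if "x \<in> space N" for x
    using that assms(2) by (auto intro!: powr_mono2)
  moreover note [measurable] = bdd_measurable_borel[OF assms(1)]
  ultimately show ?thesis by (intro bdd_measurableI) auto
qed

lemma bdd_measurable_compose:
  assumes "T \<in> measurable N N'" "bdd_measurable N' f"
  shows "bdd_measurable N (\<lambda>x. f (T x))"
proof -
  obtain C where "\<And>x. x \<in> space N' \<Longrightarrow> \<bar>f x\<bar> \<le> C" using bdd_measurableE[OF assms(2)] by blast
  then show ?thesis using assms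
    by (intro bdd_measurableI[of _ _ C]) (auto dest: measurable_space intro: measurable_compose)
qed

lemma (in prob_space) integrable_bdd_measurable:
  assumes "bdd_measurable M f" shows "integrable M f"
proof -
  obtain C where "\<And>x. x \<in> space M \<Longrightarrow> \<bar>f x\<bar> \<le> C" using bdd_measurableE[OF assms(1)] by blast
  then show ?thesis using assms by (intro integrable_const_bound[of _ C]) auto
qed

section \<open>\<open>L\<^sup>p\<close> norms of bounded functions\<close>

lemma Lp_norm_nonneg [simp]: "0 \<le> Lp_norm M q f"
  by (simp add: Lp_norm_def)

lemma Lp_norm_powr:
  assumes "0 < q" shows "Lp_norm M q f powr q = (\<integral>x. \<bar>f x\<bar> powr q \<partial>M)"
  using assms by (simp add: Lp_norm_def powr_powr integral_nonneg)

lemma Lp_norm_le_iff: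
  assumes "0 < q" "0 \<le> c"
  shows "Lp_norm M q f \<le> c \<longleftrightarrow> (\<integral>x. \<bar>f x\<bar> powr q \<partial>M) \<le> c powr q"
  unfolding Lp_norm_powr[OF assms(1), symmetric]
  using assms by (meson Lp_norm_nonneg not_le powr_less_mono2 powr_mono2 less_imp_le)

lemma Lp_norm_2: "(Lp_norm M 2 f)\<^sup>2 = (\<integral>x. (f x)\<^sup>2 \<partial>M)"
  using Lp_norm_powr[of 2 M f] by simp

lemma Lp_norm_cong:
  assumes "\<And>x. x \<in> space M \<Longrightarrow> \<bar>f x\<bar> = \<bar>g x\<bar>"
  shows "Lp_norm M q f = Lp_norm M q g"
  unfolding Lp_norm_def using assms by (auto intro!: arg_cong[where f = "\<lambda>t. t powr (1 / q)"] Bochner_Integration.integral_cong)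

lemma Lp_norm_uminus [simp]: "Lp_norm M q (\<lambda>x. - f x) = Lp_norm M q f"
  by (rule Lp_norm_cong) simp

lemma Lp_norm_cmult:
  assumes "0 < q"
  shows "Lp_norm M q (\<lambda>x. c * f x) = \<bar>c\<bar> * Lp_norm M q f"
  using assms by (simp add: Lp_norm_def abs_mult powr_mult integral_nonneg powr_powr)

lemma Lp_norm_power2: "0 < q \<Longrightarrow> Lp_norm M q (\<lambda>x. (f x)\<^sup>2) = (Lp_norm M (2 * q) f)\<^sup>2"
proof -
  assume q: "0 < q"
  have "\<bar>(f x)\<^sup>2\<bar> powr q = \<bar>f x\<bar> powr (2 * q)" for x
    by (metis abs_ge_zero abs_power2 power2_abs powr_numeral powr_powr)
  then have "Lp_norm M q (\<lambda>x. (f x)\<^sup>2) = (\<integral>x. \<bar>f x\<bar> powr (2 * q) \<partial>M) powr (1 / q)"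
    by (simp add: Lp_norm_def)
  also have "\<dots> = (Lp_norm M (2 * q) f) powr 2"
    using q by (simp add: Lp_norm_def powr_powr)
  finally show ?thesis by simp
qed

lemma (in prob_space) Lp_norm_mono:
  assumes "0 < q" "bdd_measurable M f" "bdd_measurable M g" "AE x in M. \<bar>f x\<bar> \<le> \<bar>g x\<bar>"
  shows "Lp_norm M q f \<le> Lp_norm M q g"
  unfolding Lp_norm_def using assms
  by (intro powr_mono2 integral_mono_AE integral_nonneg integrable_bdd_measurable bdd_measurable_abs_powr)
    (auto elim!: eventually_mono intro!: powr_mono2)

lemma (in prob_space) Lp_norm_const: "0 < q \<Longrightarrow> Lp_norm M q (\<lambda>x. c) = \<bar>c\<bar>"
  by (simp add: Lp_norm_def powr_powr prob_space)

text \<open>Minkowski's inequality. If \<open>\<parallel>f\<parallel> < c\<close> and \<open>\<parallel>g\<parallel> < d\<close>, then \<open>(|f| + |g|) / (c + d)\<close> is the convex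
combination of \<open>|f| / c\<close> and \<open>|g| / d\<close> with weights \<open>c / (c + d)\<close> and \<open>d / (c + d)\<close>, so that convexity
of \<open>\<lambda>t. t powr q\<close> gives the bound \<open>c + d\<close>. The strict inequalities keep \<open>c\<close> and \<open>d\<close> positive.\<close>

lemma (in prob_space) Lp_norm_triangle:
  assumes q: "1 \<le> q" and f: "bdd_measurable M f" and g: "bdd_measurable M g"
  shows "Lp_norm M q (\<lambda>x. f x + g x) \<le> Lp_norm M q f + Lp_norm M q g"
proof -
  have q0: "0 < q" using q by simp
  have *: "Lp_norm M q (\<lambda>x. f x + g x) \<le> c + d"
    if c: "Lp_norm M q f < c" and d: "Lp_norm M q g < d" for c d
  proof -
    have c0: "0 < c" and d0: "0 < d"
      using c d Lp_norm_nonneg[of M q f] Lp_norm_nonneg[of M q g] by linarith+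
    have conv: "\<bar>u + v\<bar> powr q \<le> (c + d) powr q *
        (c / (c + d) * (\<bar>u\<bar> powr q / c powr q) + d / (c + d) * (\<bar>v\<bar> powr q / d powr q))" for u v :: real
    proof -
      have pc: "((c / (c + d)) * s + (d / (c + d)) * t) powr q
          \<le> (c / (c + d)) * s powr q + (d / (c + d)) * t powr q" if st: "0 \<le> s" "0 \<le> t" for s t
      proof -
        have th: "\<theta> powr q \<le> \<theta>" if "0 \<le> \<theta>" "\<theta> \<le> 1" for \<theta> :: real
          using that q powr_mono'[of 1 q \<theta>] by (cases "\<theta> = 0") auto
        consider "s = 0" | "t = 0" | "0 < s" "0 < t" using st by linarith
        then show ?thesis
        proof cases
          case 1
          have "(d / (c + d)) powr q * t powr q \<le> d / (c + d) * t powr q"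
            using c0 d0 th[of "d / (c + d)"] by (intro mult_right_mono) auto
          then show ?thesis using 1 c0 d0 st q0
            powr_mult[of "d / (c + d)" t q] by simp
        next
          case 2
          have "(c / (c + d)) powr q * s powr q \<le> c / (c + d) * s powr q"
            using c0 d0 th[of "c / (c + d)"] by (intro mult_right_mono) auto
          then show ?thesis using 2 c0 d0 st q0
            powr_mult[of "c / (c + d)" s q] by simp
        next
          case 3
          have "c / (c + d) = 1 - d / (c + d)" using c0 d0 by (simp add: field_simps)
          then show ?thesis
            using convex_onD[OF powr_convex[OF q], of "d / (c + d)" s t] 3 c0 d0 by simp
        qed
      qed
      have "\<bar>u + v\<bar> powr q \<le> (\<bar>u\<bar> + \<bar>v\<bar>) powr q" using q0 by (intro powr_mono2) auto
      also have "\<bar>u\<bar> + \<bar>v\<bar> = (c + d) * ((c / (c + d)) * (\<bar>u\<bar> / c) + (d / (c + d)) * (\<bar>v\<bar> / d))"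
        using c0 d0 by (simp flip: add_divide_distrib)
      also have "\<dots> powr q = (c + d) powr q * ((c / (c + d)) * (\<bar>u\<bar> / c) + (d / (c + d)) * (\<bar>v\<bar> / d)) powr q"
        using c0 d0 by (intro powr_mult; simp)
      also have "\<dots> \<le> (c + d) powr q * ((c / (c + d)) * (\<bar>u\<bar> / c) powr q + (d / (c + d)) * (\<bar>v\<bar> / d) powr q)"
        using c0 d0 by (intro mult_left_mono pc) auto
      finally show ?thesis using c0 d0 by (simp add: powr_divide)
    qed
    have I: "integrable M (\<lambda>x. \<bar>h x\<bar> powr q)" if "bdd_measurable M h" for h
      using that q0 by (intro integrable_bdd_measurable bdd_measurable_abs_powr) auto
    have If: "(\<integral>x. \<bar>f x\<bar> powr q \<partial>M) / c powr q \<le> 1"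
      using Lp_norm_le_iff[OF q0 less_imp_le[OF c0], of M f] c c0 by simp
    have Ig: "(\<integral>x. \<bar>g x\<bar> powr q \<partial>M) / d powr q \<le> 1"
      using Lp_norm_le_iff[OF q0 less_imp_le[OF d0], of M g] d d0 by simp
    have "(\<integral>x. \<bar>f x + g x\<bar> powr q \<partial>M) \<le> (\<integral>x. (c + d) powr q *
        (c / (c + d) * (\<bar>f x\<bar> powr q / c powr q) + d / (c + d) * (\<bar>g x\<bar> powr q / d powr q)) \<partial>M)"
      using q0 by (intro integral_mono conv integrable_bdd_measurable)
        (auto simp: divide_inverse intro!: bdd_measurable_intros f g)
    also have "\<dots> = (c + d) powr q * (c / (c + d) * ((\<integral>x. \<bar>f x\<bar> powr q \<partial>M) / c powr q)
        + d / (c + d) * ((\<integral>x. \<bar>g x\<bar> powr q \<partial>M) / d powr q))"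
      using I[OF f] I[OF g] by simp
    also have "\<dots> \<le> (c + d) powr q * (c / (c + d) * 1 + d / (c + d) * 1)"
      using c0 d0 by (intro mult_left_mono add_mono If Ig) auto
    also have "\<dots> = (c + d) powr q" using c0 d0 by (simp flip: add_divide_distrib)
    finally show ?thesis using c0 d0 by (simp add: Lp_norm_le_iff q0)
  qed
  show ?thesis
  proof (rule field_le_epsilon)
    fix e :: real assume "0 < e"
    then show "Lp_norm M q (\<lambda>x. f x + g x) \<le> Lp_norm M q f + Lp_norm M q g + e"
      using *[of "Lp_norm M q f + e / 2" "Lp_norm M q g + e / 2"] by simp
  qed
qed

lemma (in prob_space) Lp_norm_diff:
  assumes "1 \<le> q" "bdd_measurable M f" "bdd_measurable M g"
  shows "Lp_norm M q (\<lambda>x. f x - g x) \<le> Lp_norm M q f + Lp_norm M q g"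
  using Lp_norm_triangle[OF assms(1,2) bdd_measurable_uminus[OF assms(3)]] by simp

lemma (in prob_space) Lp_norm_sum:
  assumes "1 \<le> q" "\<And>i. i \<in> S \<Longrightarrow> bdd_measurable M (f i)"
  shows "Lp_norm M q (\<lambda>x. \<Sum>i\<in>S. f i x) \<le> (\<Sum>i\<in>S. Lp_norm M q (f i))"
  using assms(2)
proof (induction S rule: infinite_finite_induct)
  case (insert i S)
  then have "Lp_norm M q (\<lambda>x. f i x + (\<Sum>i\<in>S. f i x)) \<le> Lp_norm M q (f i) + Lp_norm M q (\<lambda>x. \<Sum>i\<in>S. f i x)"
    by (intro Lp_norm_triangle assms(1) bdd_measurable_sum) auto
  then show ?case using insert by fastforce
qed (use assms in \<open>auto simp: Lp_norm_const\<close>)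

text \<open>Young's inequality between \<open>(|f| / c) powr q\<close> and \<open>1\<close>, with weights \<open>s / q\<close> and \<open>1 - s / q\<close>, integrates
to the claim, because the total mass is one.\<close>

lemma (in prob_space) Lp_norm_le_exponent:
  assumes "0 < s" "s \<le> q" and f: "bdd_measurable M f"
  shows "Lp_norm M s f \<le> Lp_norm M q f"
proof (rule field_le_epsilon)
  fix e :: real assume e: "0 < e"
  define c where "c = Lp_norm M q f + e"
  have c0: "0 < c" using e Lp_norm_nonneg[of M q f] unfolding c_def by linarith
  have q0: "0 < q" using assms by simp
  have I: "integrable M (\<lambda>x. \<bar>f x\<bar> powr t)" if "0 < t" for t
    using that f by (intro integrable_bdd_measurable bdd_measurable_abs_powr) auto
  have Y: "\<bar>u\<bar> powr s \<le> c powr s * (s / q * (\<bar>u\<bar> powr q / c powr q) + (1 - s / q))" for u :: real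
  proof (cases "u = 0")
    case True then show ?thesis using assms c0 by simp
  next
    case False
    have "(\<bar>u\<bar> / c) powr s = ((\<bar>u\<bar> / c) powr q) powr (s / q) * 1 powr (1 - s / q)"
      using q0 by (simp add: powr_powr)
    also have "\<dots> \<le> s / q * (\<bar>u\<bar> / c) powr q + (1 - s / q) * 1"
      by (rule Youngs_inequality_0) (use assms q0 c0 False in auto)
    finally show ?thesis using c0 by (simp add: powr_divide field_simps)
  qed
  have If: "(\<integral>x. \<bar>f x\<bar> powr q \<partial>M) / c powr q \<le> 1"
    using Lp_norm_le_iff[OF q0 less_imp_le[OF c0], of M f] e c0 by (simp add: c_def)
  have "(\<integral>x. \<bar>f x\<bar> powr s \<partial>M) \<le> (\<integral>x. c powr s * (s / q * (\<bar>f x\<bar> powr q / c powr q) + (1 - s / q)) \<partial>M)"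
    using Y I[OF assms(1)] I[OF q0] by (intro integral_mono) auto
  also have "\<dots> = c powr s * (s / q * ((\<integral>x. \<bar>f x\<bar> powr q \<partial>M) / c powr q) + (1 - s / q))"
    using I[OF q0] by (simp add: prob_space)
  also have "\<dots> \<le> c powr s * (s / q * 1 + (1 - s / q))"
    using assms q0 by (intro mult_left_mono add_right_mono If) auto
  finally have "Lp_norm M s f \<le> c" using assms c0 by (simp add: Lp_norm_le_iff)
  then show "Lp_norm M s f \<le> Lp_norm M q f + e" by (simp add: c_def)
qed

text \<open>The quadratic form \<open>(u, v) \<mapsto> \<integral>(u f - v g)\<^sup>2\<close> is nonnegative, so its discriminant is not positive.\<close>

lemma (in prob_space) Cauchy_Schwarz_Lp_norm:
  assumes f: "bdd_measurable M f" and g: "bdd_measurable M g"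
  shows "\<bar>\<integral>x. f x * g x \<partial>M\<bar> \<le> Lp_norm M 2 f * Lp_norm M 2 g"
proof -
  define A where "A = (\<integral>x. (f x)\<^sup>2 \<partial>M)"
  define B where "B = (\<integral>x. (g x)\<^sup>2 \<partial>M)"
  define D where "D = (\<integral>x. f x * g x \<partial>M)"
  have quad: "0 \<le> u\<^sup>2 * A - 2 * u * v * D + v\<^sup>2 * B" for u v :: real
  proof -
    have I: "integrable M (\<lambda>x. (f x)\<^sup>2)" "integrable M (\<lambda>x. (g x)\<^sup>2)" "integrable M (\<lambda>x. f x * g x)"
      using f g by (auto intro!: integrable_bdd_measurable bdd_measurable_intros)
    have "0 \<le> (\<integral>x. (u * f x - v * g x)\<^sup>2 \<partial>M)" by simp
    also have "\<dots> = (\<integral>x. u\<^sup>2 * (f x)\<^sup>2 - 2 * u * v * (f x * g x) + v\<^sup>2 * (g x)\<^sup>2 \<partial>M)"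
      by (rule Bochner_Integration.integral_cong) (auto simp: power2_eq_square algebra_simps)
    also have "\<dots> = u\<^sup>2 * A - 2 * u * v * D + v\<^sup>2 * B"
      using I by (simp add: A_def B_def D_def)
    finally show ?thesis .
  qed
  have "D\<^sup>2 \<le> A * B"
  proof (cases "B = 0")
    case True
    have "D = 0"
    proof (rule ccontr)
      assume "D \<noteq> 0"
      then show False using quad[of 1 "(A + 1) / (2 * D)"] True by (simp add: field_simps)
    qed
    then show ?thesis using True by simp
  next
    case False
    then have B: "0 < B" unfolding B_def by (simp add: less_le)
    have "0 \<le> B * (A * B - D\<^sup>2)" using quad[of B D] by (simp add: power2_eq_square algebra_simps)
    then show ?thesis using B by (simp add: zero_le_mult_iff)
  qed
  also have "A * B = (Lp_norm M 2 f * Lp_norm M 2 g)\<^sup>2"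
    by (simp add: A_def B_def Lp_norm_2 power_mult_distrib)
  finally show ?thesis
    unfolding D_def by (metis Lp_norm_nonneg abs_le_square_iff abs_of_nonneg mult_nonneg_nonneg)
qed

lemma (in prob_space) Lp_norm_mult:
  assumes q: "0 < q" and f: "bdd_measurable M f" and g: "bdd_measurable M g"
  shows "Lp_norm M q (\<lambda>x. f x * g x) \<le> Lp_norm M (2 * q) f * Lp_norm M (2 * q) g"
proof -
  have e: "Lp_norm M 2 (\<lambda>x. \<bar>h x\<bar> powr q) = Lp_norm M (2 * q) h powr q" for h
    using q by (simp add: Lp_norm_def powr_powr mult.commute flip: powr_numeral)
  have "(\<integral>x. \<bar>f x * g x\<bar> powr q \<partial>M) = (\<integral>x. \<bar>f x\<bar> powr q * \<bar>g x\<bar> powr q \<partial>M)"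
    by (simp add: abs_mult powr_mult)
  also have "\<dots> \<le> Lp_norm M 2 (\<lambda>x. \<bar>f x\<bar> powr q) * Lp_norm M 2 (\<lambda>x. \<bar>g x\<bar> powr q)"
    using Cauchy_Schwarz_Lp_norm[OF bdd_measurable_abs_powr[OF f] bdd_measurable_abs_powr[OF g], of q q] q
    by simp
  also have "\<dots> = (Lp_norm M (2 * q) f * Lp_norm M (2 * q) g) powr q"
    by (simp add: e powr_mult)
  finally show ?thesis using q by (simp add: Lp_norm_le_iff)
qed

lemma (in prob_space) Lp_norm_le_sup:
  assumes q: "0 < q" and f: "bdd_measurable M f" and v: "AE x in M. \<bar>f x\<bar> \<le> v"
  shows "Lp_norm M q f \<le> v"
proof -
  have "0 \<le> v"
  proof (rule ccontr)
    assume "\<not> 0 \<le> v"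
    with v have "AE x in M. False" by (elim eventually_mono) auto
    then show False by simp
  qed
  then show ?thesis
    using Lp_norm_mono[OF q f bdd_measurable_const, of v] v q by (simp add: Lp_norm_const)
qed

lemma (in prob_space) Lp_norm_mult_sup:
  assumes q: "0 < q" and f: "bdd_measurable M f" and g: "bdd_measurable M g"
    and v: "AE x in M. \<bar>f x\<bar> \<le> v" and v0: "0 \<le> v"
  shows "Lp_norm M q (\<lambda>x. f x * g x) \<le> v * Lp_norm M q g"
proof -
  have "Lp_norm M q (\<lambda>x. f x * g x) \<le> Lp_norm M q (\<lambda>x. v * g x)"
    by (rule Lp_norm_mono) (use assms in \<open>auto intro!: bdd_measurable_intros mult_right_mono elim!: eventually_mono simp: abs_mult\<close>)
  then show ?thesis using v0 q by (simp add: Lp_norm_cmult)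
qed

text \<open>Decay in \<open>L\<^sup>2\<close> and boundedness give decay in higher \<open>L\<^sup>p\<close>, at a slower rate.\<close>

lemma (in prob_space) Lp_norm_interpolation:
  assumes q: "1 \<le> q" and f: "bdd_measurable M f" and v: "AE x in M. \<bar>f x\<bar> \<le> v" and v0: "0 \<le> v"
  shows "Lp_norm M (2 * q) f \<le> Lp_norm M 2 f powr (1 / q) * v powr (1 - 1 / q)"
proof -
  have "(\<integral>x. \<bar>f x\<bar> powr (2 * q) \<partial>M) \<le> (\<integral>x. \<bar>f x\<bar> powr 2 * v powr (2 * q - 2) \<partial>M)"
  proof (intro integral_mono_AE integrable_bdd_measurable bdd_measurable_intros f)
    show "AE x in M. \<bar>f x\<bar> powr (2 * q) \<le> \<bar>f x\<bar> powr 2 * v powr (2 * q - 2)"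
      using v
    proof (rule eventually_mono)
      fix x assume x: "\<bar>f x\<bar> \<le> v"
      have "\<bar>f x\<bar> powr (2 * q) = \<bar>f x\<bar> powr 2 * \<bar>f x\<bar> powr (2 * q - 2)"
        by (simp only: powr_add[symmetric]) simp
      also have "\<dots> \<le> \<bar>f x\<bar> powr 2 * v powr (2 * q - 2)"
        using q x by (intro mult_left_mono powr_mono2) auto
      finally show "\<bar>f x\<bar> powr (2 * q) \<le> \<bar>f x\<bar> powr 2 * v powr (2 * q - 2)" .
    qed
  qed (use q in auto)
  also have "\<dots> = Lp_norm M 2 f powr 2 * v powr (2 * q - 2)"
    by (subst Lp_norm_powr) auto
  also have "\<dots> = (Lp_norm M 2 f powr (1 / q) * v powr (1 - 1 / q)) powr (2 * q)"
  proof -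
    have e: "1 / q * (2 * q) = 2" "(1 - 1 / q) * (2 * q) = 2 * q - 2"
      using q by (auto simp: field_simps)
    show ?thesis by (simp only: powr_mult powr_powr e)
  qed
  finally show ?thesis using q by (simp add: Lp_norm_le_iff)
qed

lemma Lp_norm_measure_preserving:
  assumes T: "T \<in> measurable N N'" and pres: "distr N N' T = N'" and f: "f \<in> borel_measurable N'"
  shows "Lp_norm N q (\<lambda>x. f (T x)) = Lp_norm N' q f"
proof -
  have "(\<integral>x. \<bar>f x\<bar> powr q \<partial>N') = (\<integral>x. \<bar>f x\<bar> powr q \<partial>distr N N' T)" by (simp add: pres)
  also have "\<dots> = (\<integral>x. \<bar>f (T x)\<bar> powr q \<partial>N)" using f by (intro integral_distr T) auto
  finally show ?thesis by (simp add: Lp_norm_def)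
qed

section \<open>The von Bahr--Esseen inequality, pointwise\<close>

lemma powr_subadditive:
  fixes a b \<alpha> :: real
  assumes "0 \<le> a" "0 \<le> b" "0 < \<alpha>" "\<alpha> \<le> 1"
  shows "(a + b) powr \<alpha> \<le> a powr \<alpha> + b powr \<alpha>"
proof (cases "a + b = 0")
  case False
  then have ab: "0 < a + b" using assms by simp
  have *: "t \<le> t powr \<alpha>" if "0 \<le> t" "t \<le> 1" for t :: real
    using that assms powr_mono'[of \<alpha> 1 t] by (cases "t = 0") auto
  have "1 = a / (a + b) + b / (a + b)" using ab by (simp flip: add_divide_distrib)
  also have "\<dots> \<le> (a / (a + b)) powr \<alpha> + (b / (a + b)) powr \<alpha>"
    using assms ab by (intro add_mono *) auto
  also have "\<dots> = (a powr \<alpha> + b powr \<alpha>) / (a + b) powr \<alpha>"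
    using assms by (simp add: powr_divide add_divide_distrib)
  finally show ?thesis using ab by (simp add: field_simps)
qed (use assms in auto)

text \<open>Up to the factor \<open>\<alpha> + 1\<close> this function is the derivative of \<open>\<lambda>t. |t| powr (\<alpha> + 1)\<close>. For
arguments of equal sign the estimate is subadditivity of \<open>\<lambda>t. t powr \<alpha>\<close>; for opposite signs,
\<open>|u|\<close> and \<open>|v|\<close> are both at most \<open>|u - v|\<close>.\<close>

lemma signed_powr_Holder:
  fixes u v \<alpha> :: real
  assumes \<alpha>: "0 < \<alpha>" "\<alpha> \<le> 1"
  shows "\<bar>sgn u * \<bar>u\<bar> powr \<alpha> - sgn v * \<bar>v\<bar> powr \<alpha>\<bar> \<le> 2 * \<bar>u - v\<bar> powr \<alpha>"
proof -
  have same: "\<bar>a powr \<alpha> - b powr \<alpha>\<bar> \<le> \<bar>a - b\<bar> powr \<alpha>" if "0 \<le> a" "0 \<le> b" for a b :: real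
  proof -
    have *: "\<bar>a powr \<alpha> - b powr \<alpha>\<bar> \<le> \<bar>a - b\<bar> powr \<alpha>" if "0 \<le> b" "b \<le> a" for a b :: real
      using powr_subadditive[of b "a - b" \<alpha>] powr_mono2[of \<alpha> b a] \<alpha> that by simp
    show ?thesis
      using *[of b a] *[of a b] that by (cases "b \<le> a") (auto simp: abs_minus_commute)
  qed
  have opp: "a powr \<alpha> + b powr \<alpha> \<le> 2 * (a + b) powr \<alpha>" if "0 \<le> a" "0 \<le> b" for a b :: real
    using powr_mono2[of \<alpha> a "a + b"] powr_mono2[of \<alpha> b "a + b"] that \<alpha> by simp
  have n: "0 \<le> \<bar>u - v\<bar> powr \<alpha>" by simp
  consider "0 \<le> u" "0 \<le> v" | "u \<le> 0" "v \<le> 0" | "0 < u" "v < 0" | "u < 0" "0 < v" by linarith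
  then show ?thesis
  proof cases
    case 1 then show ?thesis using same[of u v] n \<alpha> by (cases "u = 0"; cases "v = 0") (auto simp: sgn_if)
  next
    case 2 then show ?thesis using same[of "-u" "-v"] n \<alpha>
      by (cases "u = 0"; cases "v = 0") (auto simp: sgn_if abs_minus_commute)
  next
    case 3 then show ?thesis using opp[of u "-v"] by (simp add: sgn_if)
  next
    case 4
    have "\<bar>- ((- u) powr \<alpha>) - v powr \<alpha>\<bar> = (- u) powr \<alpha> + v powr \<alpha>"
      by (smt (verit) powr_ge_zero)
    then show ?thesis using opp[of "-u" v] 4 by (simp add: sgn_if)
  qed
qed

lemma has_real_derivative_abs_powr:
  fixes q t :: real
  assumes q: "1 < q"
  shows "((\<lambda>t. \<bar>t\<bar> powr q) has_real_derivative q * (sgn t * \<bar>t\<bar> powr (q - 1))) (at t)"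
proof -
  consider "0 < t" | "t < 0" | "t = 0" by linarith
  then show ?thesis
  proof cases
    case 1
    have "((\<lambda>t. t powr q) has_real_derivative q * t powr (q - 1)) (at t)"
      using 1 by (rule has_real_derivative_powr)
    then have "((\<lambda>t. \<bar>t\<bar> powr q) has_real_derivative q * t powr (q - 1)) (at t)"
      by (rule has_field_derivative_transform_within_open[of _ _ _ "{0<..}"]) (use 1 in auto)
    then show ?thesis using 1 by simp
  next
    case 2
    have "((\<lambda>t. (- t) powr q) has_real_derivative - (q * (- t) powr (q - 1))) (at t)"
      using 2 by (auto intro!: derivative_eq_intros)
    then have "((\<lambda>t. \<bar>t\<bar> powr q) has_real_derivative - (q * (- t) powr (q - 1))) (at t)"
      by (rule has_field_derivative_transform_within_open[of _ _ _ "{..<0}"]) (use 2 in auto)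
    then show ?thesis using 2 by simp
  next
    case 3
    have "((\<lambda>h. \<bar>h\<bar> powr (q - 1)) \<longlongrightarrow> 0) (at (0::real))"
      using q by (auto intro!: tendsto_eq_intros)
    then have "((\<lambda>h. \<bar>h\<bar> powr q / h) \<longlongrightarrow> 0) (at (0::real))"
    proof (rule Lim_null_comparison[rotated])
      show "\<forall>\<^sub>F h in at (0::real). norm (\<bar>h\<bar> powr q / h) \<le> \<bar>h\<bar> powr (q - 1)"
        by (intro always_eventually) (auto simp: powr_diff)
    qed
    then show ?thesis using 3 q by (simp add: has_field_derivative_iff)
  qed
qed

text \<open>By the mean value theorem the first order Taylor remainder of \<open>\<lambda>t. |t| powr q\<close> is \<open>y\<close> times an
increment of the derivative, and the derivative is Hoelder continuous with exponent \<open>q - 1\<close>.\<close>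

lemma von_Bahr_Esseen_pointwise:
  fixes x y q :: real
  assumes q: "1 < q" "q \<le> 2"
  shows "\<bar>x + y\<bar> powr q \<le> \<bar>x\<bar> powr q + q * (sgn x * \<bar>x\<bar> powr (q - 1)) * y + 4 * \<bar>y\<bar> powr q"
proof -
  define h where "h = (\<lambda>t::real. q * (sgn t * \<bar>t\<bar> powr (q - 1)))"
  have "\<exists>\<xi>>0. \<xi> < 1 \<and> \<bar>x + 1 * y\<bar> powr q - \<bar>x + 0 * y\<bar> powr q = (1 - 0) * (h (x + \<xi> * y) * y)"
  proof (rule MVT2)
    fix t :: real
    show "((\<lambda>t. \<bar>x + t * y\<bar> powr q) has_real_derivative h (x + t * y) * y) (at t)"
      unfolding h_def
      by (rule DERIV_chain2[OF has_real_derivative_abs_powr[OF q(1)]]) (auto intro!: derivative_eq_intros)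
  qed simp
  then obtain \<xi> where \<xi>: "0 < \<xi>" "\<xi> < 1" "\<bar>x + y\<bar> powr q - \<bar>x\<bar> powr q = h (x + \<xi> * y) * y" by auto
  have "\<bar>h (x + \<xi> * y) - h x\<bar> \<le> q * (2 * \<bar>\<xi> * y\<bar> powr (q - 1))"
    using signed_powr_Holder[of "q - 1" "x + \<xi> * y" x] q
    by (simp add: h_def abs_mult flip: right_diff_distrib)
  also have "\<dots> \<le> 2 * (2 * \<bar>y\<bar> powr (q - 1))"
  proof (intro mult_mono powr_mono2)
    show "\<bar>\<xi> * y\<bar> \<le> \<bar>y\<bar>" using \<xi> by (simp add: abs_mult mult_left_le_one_le)
  qed (use q in auto)
  finally have *: "\<bar>h (x + \<xi> * y) - h x\<bar> \<le> 4 * \<bar>y\<bar> powr (q - 1)" by simp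
  have "(h (x + \<xi> * y) - h x) * y \<le> \<bar>h (x + \<xi> * y) - h x\<bar> * \<bar>y\<bar>"
    by (metis abs_ge_self abs_mult)
  also have "\<dots> \<le> 4 * \<bar>y\<bar> powr (q - 1) * \<bar>y\<bar>"
    by (rule mult_right_mono[OF *]) simp
  also have "\<dots> = 4 * \<bar>y\<bar> powr q" by (simp add: powr_diff)
  finally show ?thesis using \<xi>(3) by (simp add: h_def algebra_simps)
qed

lemma sum_square_integral_le:
  fixes f :: "nat \<Rightarrow> 'a \<Rightarrow> real"
  assumes "prob_space M" "\<And>j. j < n \<Longrightarrow> bdd_measurable M (f j)"
  shows "(\<integral>x. (\<Sum>j<n. f j x)\<^sup>2 \<partial>M) \<le> 2 * (\<Sum>k<n. \<Sum>j\<le>k. \<bar>\<integral>x. f j x * f k x \<partial>M\<bar>)"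
  using assms(2)
proof (induction n)
  case (Suc n)
  interpret prob_space M by fact
  define S where "S = (\<lambda>x. \<Sum>j<n. f j x)"
  have b: "bdd_measurable M (f j)" if "j \<le> n" for j using Suc.prems that by simp
  have bS: "bdd_measurable M S" unfolding S_def using b by (intro bdd_measurable_sum) auto
  note I = integrable_bdd_measurable
  have "(\<integral>x. (\<Sum>j<Suc n. f j x)\<^sup>2 \<partial>M) = (\<integral>x. (S x)\<^sup>2 + 2 * (S x * f n x) + f n x * f n x \<partial>M)"
    by (rule Bochner_Integration.integral_cong) (auto simp: S_def power2_eq_square algebra_simps)
  also have "\<dots> = (\<integral>x. (S x)\<^sup>2 \<partial>M) + 2 * (\<integral>x. S x * f n x \<partial>M) + (\<integral>x. f n x * f n x \<partial>M)"
    using I[OF bdd_measurable_power2[OF bS]] I[OF bdd_measurable_mult[OF bS b]] I[OF bdd_measurable_mult[OF b b]]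
    by simp
  also have "(\<integral>x. S x * f n x \<partial>M) = (\<Sum>j<n. \<integral>x. f j x * f n x \<partial>M)"
    unfolding S_def sum_distrib_right
    by (rule Bochner_Integration.integral_sum) (use b in \<open>auto intro!: I bdd_measurable_mult\<close>)
  also have "(\<integral>x. (S x)\<^sup>2 \<partial>M) \<le> 2 * (\<Sum>k<n. \<Sum>j\<le>k. \<bar>\<integral>x. f j x * f k x \<partial>M\<bar>)"
    unfolding S_def using Suc.prems by (intro Suc.IH) auto
  also have "(\<Sum>j<n. \<integral>x. f j x * f n x \<partial>M) \<le> (\<Sum>j<n. \<bar>\<integral>x. f j x * f n x \<partial>M\<bar>)"
    by (intro sum_mono) auto
  finally have le: "(\<integral>x. (\<Sum>j<Suc n. f j x)\<^sup>2 \<partial>M)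
      \<le> 2 * (\<Sum>k<n. \<Sum>j\<le>k. \<bar>\<integral>x. f j x * f k x \<partial>M\<bar>)
        + 2 * (\<Sum>j<n. \<bar>\<integral>x. f j x * f n x \<partial>M\<bar>) + (\<integral>x. f n x * f n x \<partial>M)" by simp
  have "(\<Sum>j\<le>n. \<bar>\<integral>x. f j x * f n x \<partial>M\<bar>)
      = (\<Sum>j<n. \<bar>\<integral>x. f j x * f n x \<partial>M\<bar>) + \<bar>\<integral>x. f n x * f n x \<partial>M\<bar>"
    by (simp only: lessThan_Suc_atMost[symmetric] sum.lessThan_Suc)
  moreover have "x \<le> 2 * (a + (b + \<bar>e\<bar>))" if "x \<le> 2 * a + 2 * b + e" for x a b e :: real
    using that abs_ge_self[of e] by (simp add: distrib_left)
  ultimately show ?case using le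
    unfolding sum.lessThan_Suc[of "\<lambda>k. \<Sum>j\<le>k. \<bar>\<integral>x. f j x * f k x \<partial>M\<bar>"] by (simp only:)
qed simp

section \<open>Transfer operators and the reverse martingale decomposition\<close>

lemma is_transfer_operatorD:
  assumes "is_transfer_operator N N' T L" "bdd_measurable N g"
  shows "bdd_measurable N' (L g)"
    and "bdd_measurable N' f \<Longrightarrow> (\<integral>x. g x * f (T x) \<partial>N) = (\<integral>y. L g y * f y \<partial>N')"
  using assms unfolding is_transfer_operator_def by auto

lemma is_transfer_operator_id: "is_transfer_operator N N id id"
  unfolding is_transfer_operator_def by simp

text \<open>Iterates of transfer operators are transfer operators of the iterated maps. Hence everything below
can be done by duality with the composed maps. This avoids the linearity of the operators, which
holds only almost everywhere, each of them being a choice of versions.\<close>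

lemma is_transfer_operator_comp:
  assumes "is_transfer_operator N N' T L" "is_transfer_operator N' N'' T' L'"
    and T': "T' \<in> measurable N' N''"
  shows "is_transfer_operator N N'' (T' \<circ> T) (L' \<circ> L)"
  unfolding is_transfer_operator_def
proof (intro allI impI conjI)
  fix g f assume g: "bdd_measurable N g"
  show "bdd_measurable N'' ((L' \<circ> L) g)"
    using is_transfer_operatorD(1)[OF assms(2) is_transfer_operatorD(1)[OF assms(1) g]] by simp
  assume f: "bdd_measurable N'' f"
  have "(\<integral>x. g x * f (T' (T x)) \<partial>N) = (\<integral>y. L g y * f (T' y) \<partial>N')"
    by (rule is_transfer_operatorD(2)[OF assms(1) g bdd_measurable_compose[OF T' f]])
  also have "\<dots> = (\<integral>z. L' (L g) z * f z \<partial>N'')"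
    by (rule is_transfer_operatorD(2)[OF assms(2) is_transfer_operatorD(1)[OF assms(1) g] f])
  finally show "(\<integral>x. g x * f ((T' \<circ> T) x) \<partial>N) = (\<integral>z. (L' \<circ> L) g z * f z \<partial>N'')" by simp
qed

text \<open>Test the duality against the indicator of the set where \<open>\<epsilon> * L g\<close> exceeds \<open>v\<close>, for \<open>\<epsilon> = 1\<close> and \<open>\<epsilon> = -1\<close>.\<close>

lemma transfer_operator_sup_bound:
  assumes "prob_space N" "prob_space N'" and T: "T \<in> measurable N N'" and pres: "distr N N' T = N'"
    and L: "is_transfer_operator N N' T L" and g: "bdd_measurable N g"
    and v: "\<And>x. x \<in> space N \<Longrightarrow> \<bar>g x\<bar> \<le> v"
  shows "AE y in N'. \<bar>L g y\<bar> \<le> v"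
proof -
  interpret N: prob_space N by fact
  interpret N': prob_space N' by fact
  have Lg: "bdd_measurable N' (L g)" using is_transfer_operatorD(1)[OF L g] .
  note [measurable] = bdd_measurable_borel[OF Lg] T
  have *: "AE y in N'. \<epsilon> * L g y \<le> v" if \<epsilon>: "\<bar>\<epsilon>\<bar> = 1" for \<epsilon> :: real
  proof -
    define A where "A = {y \<in> space N'. v < \<epsilon> * L g y}"
    have [measurable]: "A \<in> sets N'" unfolding A_def by measurable
    define f where "f = (indicator A :: 'b \<Rightarrow> real)"
    have f: "bdd_measurable N' f"
      unfolding f_def by (intro bdd_measurableI[of _ _ 1]) (auto simp: indicator_def)
    note I = N'.integrable_bdd_measurable and J = N.integrable_bdd_measurable
    have fT: "bdd_measurable N (\<lambda>x. f (T x))" by (rule bdd_measurable_compose[OF T f])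
    have "(\<integral>y. \<epsilon> * (L g y * f y) \<partial>N') = \<epsilon> * (\<integral>x. g x * f (T x) \<partial>N)"
      using is_transfer_operatorD(2)[OF L g f] by simp
    also have "\<dots> = (\<integral>x. \<epsilon> * (g x * f (T x)) \<partial>N)" by simp
    also have "\<dots> \<le> (\<integral>x. v * f (T x) \<partial>N)"
    proof (intro integral_mono J bdd_measurable_intros g fT)
      fix x assume "x \<in> space N"
      then have "\<epsilon> * g x \<le> v" using v[of x] \<epsilon> by (metis abs_le_D1 abs_mult mult_1)
      then have "\<epsilon> * g x * f (T x) \<le> v * f (T x)" by (intro mult_right_mono) (auto simp: f_def)
      then show "\<epsilon> * (g x * f (T x)) \<le> v * f (T x)" by (simp add: mult.assoc)
    qed
    also have "\<dots> = (\<integral>y. v * f y \<partial>distr N N' T)"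
      using f by (intro integral_distr[symmetric] T) auto
    also have "\<dots> = (\<integral>y. v * f y \<partial>N')" by (simp add: pres)
    finally have le: "(\<integral>y. (\<epsilon> * L g y - v) * f y \<partial>N') \<le> 0"
      using I[OF bdd_measurable_mult[OF Lg f]] I[OF f] by (simp add: algebra_simps)
    have nn: "0 \<le> (\<epsilon> * L g y - v) * f y" if "y \<in> space N'" for y
      by (auto simp: f_def A_def indicator_def)
    have int: "integrable N' (\<lambda>y. (\<epsilon> * L g y - v) * f y)"
      by (intro I bdd_measurable_intros Lg f)
    have "(\<integral>y. (\<epsilon> * L g y - v) * f y \<partial>N') = 0"
      using le Bochner_Integration.integral_nonneg[of N' "\<lambda>y. (\<epsilon> * L g y - v) * f y"] nn by fastforce
    then have "AE y in N'. (\<epsilon> * L g y - v) * f y = 0"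
      using integral_nonneg_eq_0_iff_AE[OF int] nn by auto
    then show ?thesis
      by (rule AE_mp) (auto simp: f_def A_def indicator_def intro!: AE_I2)
  qed
  show ?thesis using *[of 1, simplified] *[of "-1", simplified] by eventually_elim auto
qed

lemma cocycle_Suc_left: "cocycle \<sigma> F (Suc n) \<omega> x = cocycle \<sigma> F n (\<sigma> \<omega>) (F \<omega> x)"
  by (induction n) (auto simp: funpow_swap1)

text \<open>The cocycle along the orbit of \<open>\<omega>\<close> is a cocycle over the successor map, so that the notions of the
random setting specialise to those of a nonstationary sequence, started at time \<open>0\<close>.\<close>

lemma cocycle_shift:
  "cocycle Suc (\<lambda>k. F ((\<sigma> ^^ k) \<omega>)) n i = cocycle \<sigma> F n ((\<sigma> ^^ i) \<omega>)"
  by (induction n) (auto simp: funpow_add)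

text \<open>The orbit of a single point of the base: a sequence of fibre systems, with centred bounded
observables. Cocycles, \<open>G\<close>, \<open>H\<close> and the quadratic deviation are those over the successor map.\<close>

locale nonstationary_system =
  fixes \<mu> :: "nat \<Rightarrow> 'm measure" and T :: "nat \<Rightarrow> 'm \<Rightarrow> 'm"
    and L :: "nat \<Rightarrow> ('m \<Rightarrow> real) \<Rightarrow> 'm \<Rightarrow> real" and \<phi> :: "nat \<Rightarrow> 'm \<Rightarrow> real"
  assumes prob: "prob_space (\<mu> k)"
    and T_measurable: "T k \<in> measurable (\<mu> k) (\<mu> (Suc k))"
    and T_preserves: "distr (\<mu> k) (\<mu> (Suc k)) (T k) = \<mu> (Suc k)"
    and transfer: "is_transfer_operator (\<mu> k) (\<mu> (Suc k)) (T k) (L k)"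
    and \<phi>_bdd: "bdd_measurable (\<mu> k) (\<phi> k)"
    and \<phi>_mean: "(\<integral>x. \<phi> k x \<partial>\<mu> k) = 0"
begin

lemma cocycle_T_measurable: "cocycle Suc T n i \<in> measurable (\<mu> i) (\<mu> (n + i))"
proof (induction n)
  case (Suc n)
  show ?case using measurable_comp[OF Suc T_measurable] by (simp only: cocycle.simps Suc_funpow add_Suc)
qed (simp add: id_def)

lemma cocycle_T_preserves: "distr (\<mu> i) (\<mu> (n + i)) (cocycle Suc T n i) = \<mu> (n + i)"
proof (induction n)
  case (Suc n)
  have "distr (\<mu> i) (\<mu> (Suc n + i)) (T (n + i) \<circ> cocycle Suc T n i)
      = distr (distr (\<mu> i) (\<mu> (n + i)) (cocycle Suc T n i)) (\<mu> (Suc n + i)) (T (n + i))"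
    using T_measurable[of "n + i"] by (intro distr_distr[symmetric] cocycle_T_measurable) auto
  then show ?case using Suc.IH T_preserves by (simp only: cocycle.simps Suc_funpow add_Suc)
qed (simp add: distr_id id_def)

lemma cocycle_transfer:
  "is_transfer_operator (\<mu> i) (\<mu> (n + i)) (cocycle Suc T n i) (cocycle Suc L n i)"
proof (induction n)
  case (Suc n)
  show ?case
    using is_transfer_operator_comp[OF Suc transfer T_measurable] by (simp only: cocycle.simps Suc_funpow add_Suc)
qed (simp add: is_transfer_operator_id[unfolded id_def] id_def)

lemma integral_compose_T:
  fixes f :: "'m \<Rightarrow> real"
  assumes "f \<in> borel_measurable (\<mu> (n + i))"
  shows "(\<integral>x. f (cocycle Suc T n i x) \<partial>\<mu> i) = (\<integral>y. f y \<partial>\<mu> (n + i))"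
  using integral_distr[OF cocycle_T_measurable[of n i] assms] cocycle_T_preserves[of i n] by simp

lemma integral_compose_T1:
  fixes f :: "'m \<Rightarrow> real"
  assumes "f \<in> borel_measurable (\<mu> (Suc k))"
  shows "(\<integral>x. f (T k x) \<partial>\<mu> k) = (\<integral>y. f y \<partial>\<mu> (Suc k))"
  using integral_compose_T[of f 1 k] assms by simp

text \<open>Reverse martingale differences are added from the last one to the first. The new term \<open>D i\<close> is
orthogonal to every function of \<open>T i\<close>, in particular to the derivative term in the
pointwise inequality, which is a function of the remaining sum.\<close>

lemma von_Bahr_Esseen:
  assumes q: "1 < q" "q \<le> 2"
    and D: "\<And>k. bdd_measurable (\<mu> k) (D k)"
    and orth: "\<And>k f. bdd_measurable (\<mu> (Suc k)) f \<Longrightarrow> (\<integral>x. D k x * f (T k x) \<partial>\<mu> k) = 0"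
  shows "(\<integral>x. \<bar>\<Sum>k<n. D (k + i) (cocycle Suc T k i x)\<bar> powr q \<partial>\<mu> i)
    \<le> 4 * (\<Sum>k<n. \<integral>x. \<bar>D (k + i) x\<bar> powr q \<partial>\<mu> (k + i))"
proof (induction n arbitrary: i)
  case (Suc n)
  interpret M: prob_space "\<mu> i" by (rule prob)
  define R where "R = (\<lambda>y. \<Sum>k<n. D (k + Suc i) (cocycle Suc T k (Suc i) y))"
  define h where "h = (\<lambda>y. q * (sgn (R y) * \<bar>R y\<bar> powr (q - 1)))"
  have R: "bdd_measurable (\<mu> (Suc i)) R"
    unfolding R_def by (intro bdd_measurable_sum bdd_measurable_compose[OF cocycle_T_measurable D])
  have sg: "bdd_measurable (\<mu> (Suc i)) (\<lambda>y. sgn (R y))"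
    using R by (intro bdd_measurableI[of _ _ 1]) (auto simp: sgn_if)
  have h: "bdd_measurable (\<mu> (Suc i)) h"
    unfolding h_def using q by (intro bdd_measurable_intros R sg) auto
  note C = bdd_measurable_compose[OF T_measurable]
  have "(\<Sum>k<Suc n. D (k + i) (cocycle Suc T k i x)) = R (T i x) + D i x" for x
  proof -
    have "(\<Sum>k<Suc n. D (k + i) (cocycle Suc T k i x))
        = D (0 + i) (cocycle Suc T 0 i x) + (\<Sum>k<n. D (Suc k + i) (cocycle Suc T (Suc k) i x))"
      by (rule sum.lessThan_Suc_shift)
    also have "(\<Sum>k<n. D (Suc k + i) (cocycle Suc T (Suc k) i x)) = R (T i x)"
      unfolding R_def by (intro sum.cong refl) (simp only: cocycle_Suc_left add_Suc add_Suc_right)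
    finally show ?thesis by (simp only: cocycle.simps(1) id_apply add_0 add.commute)
  qed
  then have "(\<integral>x. \<bar>\<Sum>k<Suc n. D (k + i) (cocycle Suc T k i x)\<bar> powr q \<partial>\<mu> i)
      = (\<integral>x. \<bar>R (T i x) + D i x\<bar> powr q \<partial>\<mu> i)" by (simp only:)
  also have "\<dots> \<le> (\<integral>x. \<bar>R (T i x)\<bar> powr q + (D i x * h (T i x) + 4 * \<bar>D i x\<bar> powr q) \<partial>\<mu> i)"
  proof (intro integral_mono M.integrable_bdd_measurable bdd_measurable_intros C[OF R] C[OF h] D)
    fix x
    show "\<bar>R (T i x) + D i x\<bar> powr q \<le> \<bar>R (T i x)\<bar> powr q + (D i x * h (T i x) + 4 * \<bar>D i x\<bar> powr q)"
      using von_Bahr_Esseen_pointwise[OF q, of "R (T i x)" "D i x"] by (simp add: h_def mult_ac)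
  qed (use q in auto)
  also have "\<dots> = (\<integral>x. \<bar>R (T i x)\<bar> powr q \<partial>\<mu> i)
      + ((\<integral>x. D i x * h (T i x) \<partial>\<mu> i) + 4 * (\<integral>x. \<bar>D i x\<bar> powr q \<partial>\<mu> i))"
    using q M.integrable_bdd_measurable[OF bdd_measurable_abs_powr[OF C[OF R], of q]]
      M.integrable_bdd_measurable[OF bdd_measurable_mult[OF D C[OF h]]]
      M.integrable_bdd_measurable[OF bdd_measurable_abs_powr[OF D, of q]] by simp
  also have "(\<integral>x. \<bar>R (T i x)\<bar> powr q \<partial>\<mu> i) = (\<integral>y. \<bar>R y\<bar> powr q \<partial>\<mu> (Suc i))"
    using R by (intro integral_compose_T1) (auto dest!: bdd_measurable_borel)
  also have "\<dots> \<le> 4 * (\<Sum>k<n. \<integral>x. \<bar>D (k + Suc i) x\<bar> powr q \<partial>\<mu> (k + Suc i))"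
    unfolding R_def by (rule Suc.IH)
  also have "(\<integral>x. D i x * h (T i x) \<partial>\<mu> i) = 0" by (rule orth[OF h])
  finally have "(\<integral>x. \<bar>\<Sum>k<Suc n. D (k + i) (cocycle Suc T k i x)\<bar> powr q \<partial>\<mu> i)
      \<le> 4 * ((\<integral>x. \<bar>D i x\<bar> powr q \<partial>\<mu> i) + (\<Sum>k<n. \<integral>x. \<bar>D (k + Suc i) x\<bar> powr q \<partial>\<mu> (k + Suc i)))"
    by (simp add: distrib_left)
  also have "\<dots> = 4 * (\<Sum>k<Suc n. \<integral>x. \<bar>D (k + i) x\<bar> powr q \<partial>\<mu> (k + i))"
    by (simp only: sum.lessThan_Suc_shift add_Suc add_Suc_right add_0)
  finally show ?case .
qed simp

definition pushed :: "nat \<Rightarrow> nat \<Rightarrow> 'm \<Rightarrow> real" where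
  "pushed j n = cocycle Suc L (n - j) j (\<phi> j)"

abbreviation G :: "nat \<Rightarrow> 'm \<Rightarrow> real" where "G \<equiv> G_part Suc L \<phi> 0"
abbreviation H :: "nat \<Rightarrow> 'm \<Rightarrow> real" where "H \<equiv> H_part Suc T L \<phi> 0"

lemma pushed_self [simp]: "pushed j j = \<phi> j"
  by (simp add: pushed_def)

lemma pushed_bdd: "j \<le> n \<Longrightarrow> bdd_measurable (\<mu> n) (pushed j n)"
  unfolding pushed_def using is_transfer_operatorD(1)[OF cocycle_transfer[of j "n - j"] \<phi>_bdd] by simp

lemma pushed_Suc: "j \<le> n \<Longrightarrow> pushed j (Suc n) = L n (pushed j n)"
  by (simp add: pushed_def Suc_diff_le)

lemma pushed_mean: "j \<le> n \<Longrightarrow> (\<integral>x. pushed j n x \<partial>\<mu> n) = 0"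
  unfolding pushed_def
  using is_transfer_operatorD(2)[OF cocycle_transfer[of j "n - j"] \<phi>_bdd bdd_measurable_const[of _ 1]]
  by (simp add: \<phi>_mean)

lemma pushed_le:
  assumes "j \<le> n" "\<And>x. x \<in> space (\<mu> j) \<Longrightarrow> \<bar>\<phi> j x\<bar> \<le> v"
  shows "AE x in \<mu> n. \<bar>pushed j n x\<bar> \<le> v"
proof -
  have "n - j + j = n" using assms(1) by simp
  then show ?thesis
    using transfer_operator_sup_bound[OF prob prob cocycle_T_measurable cocycle_T_preserves
        cocycle_transfer \<phi>_bdd assms(2), of "n - j"] by (simp only: pushed_def)
qed

lemma G_eq: "G n x = (\<Sum>j<n. pushed j n x)"
  by (simp add: G_part_def pushed_def)

lemma G_bdd: "bdd_measurable (\<mu> n) (G n)"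
  unfolding G_eq[abs_def] by (intro bdd_measurable_sum pushed_bdd) auto

lemma H_eq: "H n x = \<phi> n x + G n x - G (Suc n) (T n x)"
  by (simp add: H_part_def)

lemma H_bdd: "bdd_measurable (\<mu> n) (H n)"
  unfolding H_eq[abs_def]
  by (intro bdd_measurable_intros \<phi>_bdd G_bdd bdd_measurable_compose[OF T_measurable G_bdd])

text \<open>The martingale property \<open>L\<^sub>n H\<^sub>n = 0\<close> in weak form. Pairing \<open>\<phi>\<^sub>n + G\<^sub>n = \<Sum>\<^sub>j L\<^sup>n\<^sup>-\<^sup>j \<phi>\<^sub>j\<close> with \<open>f \<circ> T\<^sub>n\<close>
pushes every summand one step forward, which gives \<open>G\<^sub>n\<^sub>+\<^sub>1\<close> paired with \<open>f\<close>. By invariance this is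
also the pairing of \<open>G\<^sub>n\<^sub>+\<^sub>1 \<circ> T\<^sub>n\<close> with \<open>f \<circ> T\<^sub>n\<close>.\<close>

lemma H_orthogonal:
  assumes f: "bdd_measurable (\<mu> (Suc n)) f"
  shows "(\<integral>x. H n x * f (T n x) \<partial>\<mu> n) = 0"
proof -
  interpret M: prob_space "\<mu> n" by (rule prob)
  interpret M': prob_space "\<mu> (Suc n)" by (rule prob)
  note C = bdd_measurable_compose[OF T_measurable]
  have p: "bdd_measurable (\<mu> n) (pushed j n)" "bdd_measurable (\<mu> (Suc n)) (pushed j (Suc n))" if "j \<in> {..n}" for j
    using that by (auto intro!: pushed_bdd)
  have "H n x * f (T n x) = (\<Sum>j\<le>n. pushed j n x * f (T n x)) - G (Suc n) (T n x) * f (T n x)" for x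
    unfolding H_eq G_eq[of n] sum_distrib_right[symmetric]
    by (simp add: algebra_simps flip: lessThan_Suc_atMost)
  then have "(\<integral>x. H n x * f (T n x) \<partial>\<mu> n)
      = (\<integral>x. (\<Sum>j\<le>n. pushed j n x * f (T n x)) - G (Suc n) (T n x) * f (T n x) \<partial>\<mu> n)" by simp
  also have "\<dots> = (\<integral>x. (\<Sum>j\<le>n. pushed j n x * f (T n x)) \<partial>\<mu> n) - (\<integral>x. G (Suc n) (T n x) * f (T n x) \<partial>\<mu> n)"
    by (intro Bochner_Integration.integral_diff M.integrable_bdd_measurable bdd_measurable_intros p C[OF f] C[OF G_bdd])
  also have "(\<integral>x. (\<Sum>j\<le>n. pushed j n x * f (T n x)) \<partial>\<mu> n) = (\<Sum>j\<le>n. \<integral>x. pushed j n x * f (T n x) \<partial>\<mu> n)"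
    by (intro Bochner_Integration.integral_sum M.integrable_bdd_measurable bdd_measurable_intros p C[OF f])
  also have "\<dots> = (\<Sum>j\<le>n. \<integral>y. pushed j (Suc n) y * f y \<partial>\<mu> (Suc n))"
    by (intro sum.cong refl) (simp add: is_transfer_operatorD(2)[OF transfer p(1) f] pushed_Suc)
  also have "\<dots> = (\<integral>y. (\<Sum>j\<le>n. pushed j (Suc n) y * f y) \<partial>\<mu> (Suc n))"
    by (intro Bochner_Integration.integral_sum[symmetric] M'.integrable_bdd_measurable bdd_measurable_intros p f)
  also have "\<dots> = (\<integral>y. G (Suc n) y * f y \<partial>\<mu> (Suc n))"
    by (simp add: G_eq sum_distrib_right lessThan_Suc_atMost)
  also have "(\<integral>x. G (Suc n) (T n x) * f (T n x) \<partial>\<mu> n) = (\<integral>y. G (Suc n) y * f y \<partial>\<mu> (Suc n))"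
    by (rule integral_compose_T1[OF bdd_measurable_borel[OF bdd_measurable_mult[OF G_bdd f]]])
  finally show ?thesis by (simp only: diff_self)
qed

end

section \<open>Estimates up to a fixed time\<close>

lemma sum_atMost_flip:
  fixes f :: "nat \<Rightarrow> real"
  shows "(\<Sum>i\<le>n. f (n - i)) = (\<Sum>l\<le>n. f l)"
  by (rule sum.reindex_bij_witness[of _ "\<lambda>i. n - i" "\<lambda>i. n - i"]) auto

context nonstationary_system begin

lemma cocycle_T_add:
  "cocycle Suc T (n + m) i x = cocycle Suc T n (m + i) (cocycle Suc T m i x)"
proof (induction n)
  case (Suc n)
  show ?case by (simp only: cocycle.simps add_Suc Suc_funpow comp_apply Suc.IH add.assoc)
qed simp

lemma Lp_norm_compose_T:
  assumes "f \<in> borel_measurable (\<mu> (n + i))"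
  shows "Lp_norm (\<mu> i) q (\<lambda>x. f (cocycle Suc T n i x)) = Lp_norm (\<mu> (n + i)) q f"
  by (rule Lp_norm_measure_preserving[OF cocycle_T_measurable cocycle_T_preserves assms])

text \<open>The terms of the identity \<open>H_square\<close>: \<open>Y\<close> is the correlation part, and \<open>D\<close> the remainder that is
itself a reverse martingale difference.\<close>

definition Y :: "nat \<Rightarrow> 'm \<Rightarrow> real" where
  "Y j x = \<phi> j x * (\<phi> j x + 2 * G j x)"

definition D :: "nat \<Rightarrow> 'm \<Rightarrow> real" where
  "D j x = H j x * G (Suc j) (T j x)"

lemma GT_bdd: "bdd_measurable (\<mu> j) (\<lambda>x. G (Suc j) (T j x))"
  by (rule bdd_measurable_compose[OF T_measurable G_bdd])

lemma Y_bdd: "bdd_measurable (\<mu> j) (Y j)"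
  unfolding Y_def[abs_def] by (intro bdd_measurable_intros \<phi>_bdd G_bdd)

lemma D_bdd: "bdd_measurable (\<mu> j) (D j)"
  unfolding D_def[abs_def] by (intro bdd_measurable_intros H_bdd GT_bdd)

lemma D_orthogonal:
  assumes f: "bdd_measurable (\<mu> (Suc j)) f"
  shows "(\<integral>x. D j x * f (T j x) \<partial>\<mu> j) = 0"
  using H_orthogonal[OF bdd_measurable_mult[OF G_bdd f]] by (simp add: D_def mult.assoc)

text \<open>With \<open>u = \<phi>\<^sub>j + G\<^sub>j\<close> and \<open>w = G\<^sub>j\<^sub>+\<^sub>1 \<circ> T\<^sub>j\<close> this is \<open>(u - w)\<^sup>2 = u\<^sup>2 - w\<^sup>2 - 2 (u - w) w\<close>. The last term is
kept as a product with \<open>H\<^sub>j = u - w\<close>, because it is then a reverse martingale difference.\<close>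

lemma H_square:
  "(H j x)\<^sup>2 = Y j x + (G j x)\<^sup>2 - (G (Suc j) (T j x))\<^sup>2 - 2 * D j x"
  by (simp add: H_eq Y_def D_def power2_eq_square algebra_simps)

lemma integral_H_square:
  "(\<integral>x. (H j x)\<^sup>2 \<partial>\<mu> j)
     = (\<integral>x. Y j x \<partial>\<mu> j) + (\<integral>x. (G j x)\<^sup>2 \<partial>\<mu> j) - (\<integral>x. (G (Suc j) x)\<^sup>2 \<partial>\<mu> (Suc j))"
proof -
  interpret M: prob_space "\<mu> j" by (rule prob)
  note I = M.integrable_bdd_measurable
  have "(\<integral>x. (H j x)\<^sup>2 \<partial>\<mu> j) = (\<integral>x. Y j x \<partial>\<mu> j) + (\<integral>x. (G j x)\<^sup>2 \<partial>\<mu> j)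
      - (\<integral>x. (G (Suc j) (T j x))\<^sup>2 \<partial>\<mu> j) - 2 * (\<integral>x. D j x \<partial>\<mu> j)"
    unfolding H_square
    using I[OF Y_bdd] I[OF bdd_measurable_power2[OF G_bdd]] I[OF bdd_measurable_power2[OF GT_bdd]]
      I[OF D_bdd] by simp
  also have "(\<integral>x. (G (Suc j) (T j x))\<^sup>2 \<partial>\<mu> j) = (\<integral>x. (G (Suc j) x)\<^sup>2 \<partial>\<mu> (Suc j))"
    by (rule integral_compose_T1[OF bdd_measurable_borel[OF bdd_measurable_power2[OF G_bdd]]])
  also have "(\<integral>x. D j x \<partial>\<mu> j) = 0"
    using D_orthogonal[OF bdd_measurable_const[of _ 1]] by simp
  finally show ?thesis by simp
qed

abbreviation quad :: "nat \<Rightarrow> 'm \<Rightarrow> real" where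
  "quad \<equiv> quadratic_deviation Suc T \<mu> L \<phi> 0"

definition U :: "nat \<Rightarrow> 'm \<Rightarrow> real" where
  "U j = centered (\<mu> j) (Y j)"

lemma quad_decomposition:
  "quad n x = (\<Sum>j<n. U j (cocycle Suc T j 0 x))
     - ((G n (cocycle Suc T n 0 x))\<^sup>2 - (\<integral>y. (G n y)\<^sup>2 \<partial>\<mu> n))
     - 2 * (\<Sum>j<n. D j (cocycle Suc T j 0 x))"
proof (induction n)
  case 0
  show ?case by (simp add: quadratic_deviation_def G_part_def)
next
  case (Suc n)
  have "quad (Suc n) x = quad n x + (H n (cocycle Suc T n 0 x))\<^sup>2 - (\<integral>y. (H n y)\<^sup>2 \<partial>\<mu> n)"
    by (simp add: quadratic_deviation_def)
  then show ?case
    unfolding Suc.IH integral_H_square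
    unfolding H_square
    by (simp add: U_def centered_def algebra_simps)
qed

lemma U_bdd: "bdd_measurable (\<mu> j) (U j)"
  unfolding U_def centered_def by (intro bdd_measurable_intros Y_bdd)

lemma U_mean: "(\<integral>x. U j x \<partial>\<mu> j) = 0"
proof -
  interpret M: prob_space "\<mu> j" by (rule prob)
  show ?thesis
    using M.integrable_bdd_measurable[OF Y_bdd] by (simp add: U_def centered_def M.prob_space)
qed

lemma bdd_compose0: "bdd_measurable (\<mu> n) f \<Longrightarrow> bdd_measurable (\<mu> 0) (\<lambda>x. f (cocycle Suc T n 0 x))"
  using bdd_measurable_compose[OF cocycle_T_measurable[of n 0]] by simp

lemma quad_bdd: "bdd_measurable (\<mu> 0) (quad n)"
  unfolding quad_decomposition[abs_def]
  by (intro bdd_measurable_intros bdd_compose0[OF U_bdd] bdd_compose0[OF D_bdd] bdd_compose0[OF G_bdd])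

lemma covariance_le_norms:
  assumes jk: "j \<le> k" and g: "bdd_measurable (\<mu> j) g" and w: "bdd_measurable (\<mu> k) w"
  shows "\<bar>\<integral>x. g x * w (cocycle Suc T (k - j) j x) \<partial>\<mu> j\<bar> \<le> Lp_norm (\<mu> j) 2 g * Lp_norm (\<mu> k) 2 w"
proof -
  interpret M: prob_space "\<mu> j" by (rule prob)
  have e: "k - j + j = k" using jk by simp
  have w': "bdd_measurable (\<mu> j) (\<lambda>x. w (cocycle Suc T (k - j) j x))"
    using bdd_measurable_compose[OF cocycle_T_measurable, of "k - j" j w] w by (simp only: e)
  show ?thesis
    using M.Cauchy_Schwarz_Lp_norm[OF g w'] Lp_norm_compose_T[of w "k - j" j 2] w
    by (simp add: e bdd_measurable_borel)
qed

text \<open>Replacing the transferred function by its centred version changes nothing, since \<open>w\<close> has mean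
zero. This makes the decay condition applicable.\<close>

lemma covariance_le_decay:
  assumes jk: "j \<le> k" and g: "bdd_measurable (\<mu> j) g" and w: "bdd_measurable (\<mu> k) w"
    and w0: "(\<integral>x. w x \<partial>\<mu> k) = 0"
  shows "\<bar>\<integral>x. g x * w (cocycle Suc T (k - j) j x) \<partial>\<mu> j\<bar>
    \<le> Lp_norm (\<mu> k) 2 (centered (\<mu> k) (cocycle Suc L (k - j) j g)) * Lp_norm (\<mu> k) 2 w"
proof -
  interpret M: prob_space "\<mu> k" by (rule prob)
  have e: "k - j + j = k" using jk by simp
  note tr = cocycle_transfer[of j "k - j", unfolded e]
  have Lg: "bdd_measurable (\<mu> k) (cocycle Suc L (k - j) j g)" by (rule is_transfer_operatorD(1)[OF tr g])
  have c: "bdd_measurable (\<mu> k) (centered (\<mu> k) (cocycle Suc L (k - j) j g))"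
    unfolding centered_def by (intro bdd_measurable_intros Lg)
  have "(\<integral>x. g x * w (cocycle Suc T (k - j) j x) \<partial>\<mu> j) = (\<integral>y. cocycle Suc L (k - j) j g y * w y \<partial>\<mu> k)"
    by (rule is_transfer_operatorD(2)[OF tr g w])
  also have "\<dots> = (\<integral>y. centered (\<mu> k) (cocycle Suc L (k - j) j g) y * w y \<partial>\<mu> k)"
    using M.integrable_bdd_measurable[OF bdd_measurable_mult[OF Lg w]] M.integrable_bdd_measurable[OF w]
    by (simp add: centered_def left_diff_distrib w0)
  finally show ?thesis using M.Cauchy_Schwarz_Lp_norm[OF c w] by simp
qed

text \<open>The term \<open>\<phi>\<^sub>j\<^sup>2\<close> fits in as \<open>i = j\<close>, because \<open>pushed j j = \<phi> j\<close>.\<close>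

lemma Y_eq_sum: "Y j x = (\<Sum>i\<le>j. (if i = j then 1 else 2) * (\<phi> j x * pushed i j x))"
proof -
  have "(\<Sum>i\<le>j. (if i = j then 1 else 2) * (\<phi> j x * pushed i j x))
      = (\<Sum>i<j. (if i = j then 1 else 2) * (\<phi> j x * pushed i j x)) + \<phi> j x * \<phi> j x"
    by (simp add: lessThan_Suc_atMost[symmetric])
  also have "(\<Sum>i<j. (if i = j then 1 else 2) * (\<phi> j x * pushed i j x))
      = (\<Sum>i<j. 2 * (\<phi> j x * pushed i j x))"
    by (intro sum.cong) auto
  also have "\<dots> = 2 * \<phi> j x * G j x" by (simp add: G_eq sum_distrib_left mult.assoc)
  finally show ?thesis by (simp add: Y_def algebra_simps)
qed

lemma G_norm_le:
  assumes q: "1 \<le> q" and jN: "j \<le> N" and c0: "\<And>l. 0 \<le> c l"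
    and c: "\<And>i. i \<le> j \<Longrightarrow> Lp_norm (\<mu> j) q (pushed i j) \<le> c (j - i)"
  shows "Lp_norm (\<mu> j) q (G j) \<le> (\<Sum>l<N. c (Suc l))"
proof -
  interpret M: prob_space "\<mu> j" by (rule prob)
  have "Lp_norm (\<mu> j) q (G j) \<le> (\<Sum>i<j. Lp_norm (\<mu> j) q (pushed i j))"
    unfolding G_eq[abs_def] by (rule M.Lp_norm_sum[OF q]) (auto intro: pushed_bdd)
  also have "\<dots> \<le> (\<Sum>i<j. c (Suc (j - Suc i)))"
    using c by (intro sum_mono) (auto simp: Suc_diff_Suc)
  also have "\<dots> = (\<Sum>l<j. c (Suc l))"
    by (rule sum.nat_diff_reindex)
  also have "\<dots> \<le> (\<Sum>l<N. c (Suc l))"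
    using jN c0 by (intro sum_mono2) auto
  finally show ?thesis .
qed

text \<open>Hoelder's inequality bounds \<open>\<parallel>D\<^sub>j\<parallel>\<close> in \<open>L\<^sup>q\<close> by \<open>\<parallel>H\<^sub>j\<parallel> \<parallel>G\<^sub>j\<^sub>+\<^sub>1\<parallel>\<close> in \<open>L\<^sup>2\<^sup>q\<close>, where \<open>\<parallel>H\<^sub>j\<parallel> \<le> v + 2 g\<close>; the sum
is then controlled by \<open>von_Bahr_Esseen\<close>.\<close>

lemma martingale_part_le:
  assumes q: "1 < q" "q \<le> 2" and v: "0 \<le> v" and g: "0 \<le> g"
    and \<phi>_le: "\<And>j x. j \<le> N \<Longrightarrow> x \<in> space (\<mu> j) \<Longrightarrow> \<bar>\<phi> j x\<bar> \<le> v"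
    and G_le: "\<And>j. j \<le> N \<Longrightarrow> Lp_norm (\<mu> j) (2 * q) (G j) \<le> g"
  shows "Lp_norm (\<mu> 0) q (\<lambda>x. \<Sum>j<N. D j (cocycle Suc T j 0 x))
    \<le> 4 * real N powr (1 / q) * ((v + 2 * g) * g)"
proof -
  have Dj: "(\<integral>x. \<bar>D j x\<bar> powr q \<partial>\<mu> j) \<le> ((v + 2 * g) * g) powr q" if j: "j < N" for j
  proof -
    interpret M: prob_space "\<mu> j" by (rule prob)
    have GT: "Lp_norm (\<mu> j) (2 * q) (\<lambda>x. G (Suc j) (T j x)) \<le> g"
      using Lp_norm_measure_preserving[OF T_measurable T_preserves bdd_measurable_borel[OF G_bdd], of j "2 * q"]
        G_le[of "Suc j"] j by simp
    have "Lp_norm (\<mu> j) (2 * q) (H j)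
        \<le> Lp_norm (\<mu> j) (2 * q) (\<lambda>x. \<phi> j x + G j x) + Lp_norm (\<mu> j) (2 * q) (\<lambda>x. G (Suc j) (T j x))"
      unfolding H_eq[abs_def] using q
      by (intro M.Lp_norm_diff bdd_measurable_intros \<phi>_bdd G_bdd GT_bdd) auto
    also have "Lp_norm (\<mu> j) (2 * q) (\<lambda>x. \<phi> j x + G j x)
        \<le> Lp_norm (\<mu> j) (2 * q) (\<phi> j) + Lp_norm (\<mu> j) (2 * q) (G j)"
      using q by (intro M.Lp_norm_triangle \<phi>_bdd G_bdd) auto
    also have "Lp_norm (\<mu> j) (2 * q) (\<phi> j) \<le> v"
      using q \<phi>_le[of j] j by (intro M.Lp_norm_le_sup \<phi>_bdd) auto
    finally have H: "Lp_norm (\<mu> j) (2 * q) (H j) \<le> v + 2 * g"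
      using G_le[of j] j GT by simp
    have "Lp_norm (\<mu> j) q (D j) \<le> Lp_norm (\<mu> j) (2 * q) (H j) * Lp_norm (\<mu> j) (2 * q) (\<lambda>x. G (Suc j) (T j x))"
      unfolding D_def[abs_def] using q by (intro M.Lp_norm_mult H_bdd GT_bdd) auto
    also have "\<dots> \<le> (v + 2 * g) * g"
      using H GT v g by (intro mult_mono) auto
    finally show ?thesis using q v g by (simp add: Lp_norm_le_iff)
  qed
  have "(\<integral>x. \<bar>\<Sum>j<N. D j (cocycle Suc T j 0 x)\<bar> powr q \<partial>\<mu> 0)
      \<le> 4 * (\<Sum>j<N. \<integral>x. \<bar>D j x\<bar> powr q \<partial>\<mu> j)"
    using von_Bahr_Esseen[OF q D_bdd D_orthogonal, of 0 N] by simp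
  also have "\<dots> \<le> 4 * (\<Sum>j<N. ((v + 2 * g) * g) powr q)"
    using Dj by (intro mult_left_mono sum_mono) auto
  also have "\<dots> = 4 powr 1 * (real N * ((v + 2 * g) * g) powr q)" by simp
  also have "\<dots> \<le> 4 powr q * (real N * ((v + 2 * g) * g) powr q)"
    using q by (intro mult_right_mono powr_mono) auto
  also have "\<dots> = (4 * real N powr (1 / q) * ((v + 2 * g) * g)) powr q"
    using q v g by (simp add: powr_mult powr_powr)
  finally show ?thesis using q v g by (simp add: Lp_norm_le_iff)
qed

lemma square_part_le:
  assumes s: "1 \<le> s" and g: "Lp_norm (\<mu> n) (2 * s) (G n) \<le> g"
  shows "Lp_norm (\<mu> 0) s (\<lambda>x. (G n (cocycle Suc T n 0 x))\<^sup>2 - (\<integral>y. (G n y)\<^sup>2 \<partial>\<mu> n)) \<le> 2 * g\<^sup>2"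
proof -
  interpret M: prob_space "\<mu> n" by (rule prob)
  interpret M0: prob_space "\<mu> 0" by (rule prob)
  have "Lp_norm (\<mu> n) s (\<lambda>y. (G n y)\<^sup>2) = (Lp_norm (\<mu> n) (2 * s) (G n))\<^sup>2"
    using s by (intro Lp_norm_power2) auto
  also have "\<dots> \<le> g\<^sup>2" using g by (intro power_mono) auto
  finally have 1: "Lp_norm (\<mu> 0) s (\<lambda>x. (G n (cocycle Suc T n 0 x))\<^sup>2) \<le> g\<^sup>2"
    using Lp_norm_compose_T[of "\<lambda>y. (G n y)\<^sup>2" n 0 s] bdd_measurable_borel[OF bdd_measurable_power2[OF G_bdd]]
    by simp
  have "Lp_norm (\<mu> n) 2 (G n) \<le> g"
    using M.Lp_norm_le_exponent[OF _ _ G_bdd, of 2 "2 * s"] s g by simp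
  then have 2: "(\<integral>y. (G n y)\<^sup>2 \<partial>\<mu> n) \<le> g\<^sup>2"
    by (metis Lp_norm_2 Lp_norm_nonneg power_mono)
  have "Lp_norm (\<mu> 0) s (\<lambda>x. (G n (cocycle Suc T n 0 x))\<^sup>2 - (\<integral>y. (G n y)\<^sup>2 \<partial>\<mu> n))
      \<le> Lp_norm (\<mu> 0) s (\<lambda>x. (G n (cocycle Suc T n 0 x))\<^sup>2) + Lp_norm (\<mu> 0) s (\<lambda>x. \<integral>y. (G n y)\<^sup>2 \<partial>\<mu> n)"
    by (intro M0.Lp_norm_diff s bdd_measurable_intros bdd_compose0[OF G_bdd])
  also have "\<dots> \<le> g\<^sup>2 + g\<^sup>2" using s 1 2 by (intro add_mono) (auto simp: M0.Lp_norm_const)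
  finally show ?thesis by simp
qed

lemma Y_norm_le:
  assumes kN: "k \<le> N" and v: "0 \<le> v" and \<kappa>: "0 \<le> \<kappa>" and a0: "\<And>l. 0 \<le> a l"
    and \<phi>_le: "\<And>x. x \<in> space (\<mu> k) \<Longrightarrow> \<bar>\<phi> k x\<bar> \<le> v"
    and decay: "\<And>i. i \<le> k \<Longrightarrow> Lp_norm (\<mu> k) 2 (pushed i k) \<le> 2 * \<kappa> * v * a (k - i)"
    and A: "(\<Sum>l\<le>N. a l) \<le> A"
  shows "Lp_norm (\<mu> k) 2 (Y k) \<le> 4 * \<kappa> * v\<^sup>2 * A"
proof -
  interpret M: prob_space "\<mu> k" by (rule prob)
  have b: "bdd_measurable (\<mu> k) (\<lambda>x. \<phi> k x * pushed i k x)" if "i \<le> k" for i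
    using that by (intro bdd_measurable_intros \<phi>_bdd pushed_bdd)
  have "Lp_norm (\<mu> k) 2 (Y k) \<le> (\<Sum>i\<le>k. Lp_norm (\<mu> k) 2 (\<lambda>x. (if i = k then 1 else 2) * (\<phi> k x * pushed i k x)))"
    unfolding Y_eq_sum[abs_def] by (intro M.Lp_norm_sum bdd_measurable_mult bdd_measurable_const b) auto
  also have "\<dots> \<le> (\<Sum>i\<le>k. 2 * (v * (2 * \<kappa> * v * a (k - i))))"
  proof (intro sum_mono)
    fix i assume "i \<in> {..k}"
    then have i: "i \<le> k" by simp
    have "Lp_norm (\<mu> k) 2 (\<lambda>x. \<phi> k x * pushed i k x) \<le> v * Lp_norm (\<mu> k) 2 (pushed i k)"
      using i \<phi>_le v by (intro M.Lp_norm_mult_sup \<phi>_bdd pushed_bdd) auto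
    also have "\<dots> \<le> v * (2 * \<kappa> * v * a (k - i))" using decay[OF i] v by (intro mult_left_mono)
    finally have 1: "Lp_norm (\<mu> k) 2 (\<lambda>x. \<phi> k x * pushed i k x) \<le> v * (2 * \<kappa> * v * a (k - i))" .
    have "Lp_norm (\<mu> k) 2 (\<lambda>x. (if i = k then 1 else 2) * (\<phi> k x * pushed i k x))
        = (if i = k then 1 else 2) * Lp_norm (\<mu> k) 2 (\<lambda>x. \<phi> k x * pushed i k x)"
      by (subst Lp_norm_cmult) auto
    also have "\<dots> \<le> 2 * (v * (2 * \<kappa> * v * a (k - i)))"
      using 1 by (intro mult_mono) auto
    finally show "Lp_norm (\<mu> k) 2 (\<lambda>x. (if i = k then 1 else 2) * (\<phi> k x * pushed i k x))
        \<le> 2 * (v * (2 * \<kappa> * v * a (k - i)))" .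
  qed
  also have "\<dots> = 4 * \<kappa> * v\<^sup>2 * (\<Sum>i\<le>k. a (k - i))"
    by (simp add: sum_distrib_left power2_eq_square algebra_simps)
  also have "(\<Sum>i\<le>k. a (k - i)) = (\<Sum>l\<le>k. a l)"
    by (rule sum_atMost_flip)
  also have "4 * \<kappa> * v\<^sup>2 * (\<Sum>l\<le>k. a l) \<le> 4 * \<kappa> * v\<^sup>2 * A"
  proof (intro mult_left_mono)
    have "(\<Sum>l\<le>k. a l) \<le> (\<Sum>l\<le>N. a l)" using kN a0 by (intro sum_mono2) auto
    then show "(\<Sum>l\<le>k. a l) \<le> A" using A by simp
  qed (use v \<kappa> in auto)
  finally show ?thesis .
qed

text \<open>The truncation at lag \<open>m\<close>. For each \<open>i \<le> j\<close> the covariance of \<open>\<phi>\<^sub>j L\<^sup>j\<^sup>-\<^sup>i \<phi>\<^sub>i\<close> with \<open>U\<^sub>k\<close> has two bounds: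
\<open>\<kappa> v\<^sup>2 a (k - j)\<close>, which does not see the distance from \<open>i\<close> to \<open>j\<close>, and \<open>2 \<kappa> v\<^sup>2 a (j - i)\<close>, which
does not see the distance from \<open>j\<close> to \<open>k\<close>, both times \<open>\<parallel>U\<^sub>k\<parallel>\<close>. The first is used for the at most
\<open>m + 1\<close> near indices, and the second, whose sum is the tail \<open>R\<close>, for the remaining ones.\<close>

lemma covariance_le:
  assumes jk: "j \<le> k" and kN: "k \<le> N" and v: "0 \<le> v" and \<kappa>: "0 \<le> \<kappa>" and a0: "\<And>l. 0 \<le> a l"
    and \<phi>_le: "\<And>j x. j \<le> N \<Longrightarrow> x \<in> space (\<mu> j) \<Longrightarrow> \<bar>\<phi> j x\<bar> \<le> v"
    and decay: "\<And>i j. i \<le> j \<Longrightarrow> j \<le> N \<Longrightarrow> Lp_norm (\<mu> j) 2 (pushed i j) \<le> 2 * \<kappa> * v * a (j - i)"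
    and decay2: "\<And>i. i \<le> j \<Longrightarrow> Lp_norm (\<mu> k) 2 (centered (\<mu> k)
          (cocycle Suc L (k - j) j (\<lambda>x. \<phi> j x * pushed i j x))) \<le> \<kappa> * v\<^sup>2 * a (k - j)"
    and A: "(\<Sum>l\<le>N. a l) \<le> A" and R: "(\<Sum>l\<in>{m<..N}. a l) \<le> R"
  shows "\<bar>\<integral>x. U j (cocycle Suc T j 0 x) * U k (cocycle Suc T k 0 x) \<partial>\<mu> 0\<bar>
    \<le> (2 * (real m + 1) * \<kappa> * v\<^sup>2 * a (k - j) + 4 * \<kappa> * v\<^sup>2 * R) * (8 * \<kappa> * v\<^sup>2 * A)"
proof -
  interpret M: prob_space "\<mu> j" by (rule prob)
  interpret Mk: prob_space "\<mu> k" by (rule prob)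
  have e: "k - j + j = k" using jk by simp
  define W where "W = (\<lambda>x. U k (cocycle Suc T (k - j) j x))"
  have W: "bdd_measurable (\<mu> j) W"
    using bdd_measurable_compose[OF cocycle_T_measurable, of "k - j" j "U k"] U_bdd[of k] e by (simp add: W_def)
  have W0: "(\<integral>x. W x \<partial>\<mu> j) = 0"
    using integral_compose_T[of "U k" "k - j" j] bdd_measurable_borel[OF U_bdd[of k]] U_mean[of k] e
    by (simp add: W_def)
  have b: "bdd_measurable (\<mu> j) (\<lambda>x. \<phi> j x * pushed i j x)" if "i \<le> j" for i
    using that by (intro bdd_measurable_intros \<phi>_bdd pushed_bdd)
  have "(\<integral>x. U j (cocycle Suc T j 0 x) * U k (cocycle Suc T k 0 x) \<partial>\<mu> 0)
      = (\<integral>x. U j (cocycle Suc T j 0 x) * W (cocycle Suc T j 0 x) \<partial>\<mu> 0)"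
    using cocycle_T_add[of "k - j" j 0] e by (simp add: W_def)
  also have "\<dots> = (\<integral>x. U j x * W x \<partial>\<mu> j)"
    using integral_compose_T[of "\<lambda>x. U j x * W x" j 0] bdd_measurable_borel[OF bdd_measurable_mult[OF U_bdd W]]
    by simp
  also have "\<dots> = (\<integral>x. Y j x * W x \<partial>\<mu> j)"
    using M.integrable_bdd_measurable[OF bdd_measurable_mult[OF Y_bdd W]] M.integrable_bdd_measurable[OF W]
    by (simp add: U_def centered_def left_diff_distrib W0)
  also have "\<dots> = (\<integral>x. (\<Sum>i\<le>j. (if i = j then 1 else 2) * (\<phi> j x * pushed i j x * W x)) \<partial>\<mu> j)"
    by (simp only: Y_eq_sum sum_distrib_right mult.assoc)
  also have "\<dots> = (\<Sum>i\<le>j. \<integral>x. (if i = j then 1 else 2) * (\<phi> j x * pushed i j x * W x) \<partial>\<mu> j)"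
    by (intro Bochner_Integration.integral_sum M.integrable_bdd_measurable bdd_measurable_mult[OF bdd_measurable_const]
        bdd_measurable_mult[OF _ W] b) auto
  also have "\<dots> = (\<Sum>i\<le>j. (if i = j then 1 else 2) * (\<integral>x. \<phi> j x * pushed i j x * W x \<partial>\<mu> j))"
    by simp
  finally have eq: "(\<integral>x. U j (cocycle Suc T j 0 x) * U k (cocycle Suc T k 0 x) \<partial>\<mu> 0) = \<dots>" .
  have UY: "Lp_norm (\<mu> k) 2 (U k) \<le> 8 * \<kappa> * v\<^sup>2 * A"
  proof -
    have "Lp_norm (\<mu> k) 2 (U k) \<le> Lp_norm (\<mu> k) 2 (Y k) + \<bar>\<integral>x. Y k x * 1 \<partial>\<mu> k\<bar>"
      unfolding U_def centered_def
      using Mk.Lp_norm_diff[OF _ Y_bdd bdd_measurable_const, of 2] by (simp add: Mk.Lp_norm_const)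
    also have "\<bar>\<integral>x. Y k x * 1 \<partial>\<mu> k\<bar> \<le> Lp_norm (\<mu> k) 2 (Y k)"
      using Mk.Cauchy_Schwarz_Lp_norm[OF Y_bdd bdd_measurable_const[of _ 1]] by (simp add: Mk.Lp_norm_const)
    finally show ?thesis
      using Y_norm_le[OF kN v \<kappa> a0 \<phi>_le[OF kN] decay[OF _ kN] A] by simp
  qed
  define B where "B = 8 * \<kappa> * v\<^sup>2 * A"
  have B0: "0 \<le> B" unfolding B_def using UY Lp_norm_nonneg order_trans by blast
  define r where "r i = (if j - i \<le> m then \<kappa> * v\<^sup>2 * a (k - j) else 2 * \<kappa> * v\<^sup>2 * a (j - i))" for i
  have r0: "0 \<le> r i" for i using v \<kappa> a0 by (simp add: r_def)
  have each: "\<bar>\<integral>x. \<phi> j x * pushed i j x * W x \<partial>\<mu> j\<bar> \<le> r i * B" if i: "i \<le> j" for i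
  proof (cases "j - i \<le> m")
    case True
    have "\<bar>\<integral>x. \<phi> j x * pushed i j x * W x \<partial>\<mu> j\<bar> \<le> Lp_norm (\<mu> k) 2 (centered (\<mu> k)
        (cocycle Suc L (k - j) j (\<lambda>x. \<phi> j x * pushed i j x))) * Lp_norm (\<mu> k) 2 (U k)"
      unfolding W_def by (rule covariance_le_decay[OF jk b[OF i] U_bdd U_mean])
    also have "\<dots> \<le> r i * B"
      using decay2[OF i] UY True r0[of i] by (intro mult_mono) (auto simp: r_def B_def)
    finally show ?thesis .
  next
    case False
    have "\<bar>\<integral>x. \<phi> j x * pushed i j x * W x \<partial>\<mu> j\<bar> \<le> Lp_norm (\<mu> j) 2 (\<lambda>x. \<phi> j x * pushed i j x) * Lp_norm (\<mu> k) 2 (U k)"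
      unfolding W_def by (rule covariance_le_norms[OF jk b[OF i] U_bdd])
    also have "\<dots> \<le> r i * B"
    proof (intro mult_mono r0)
      have "Lp_norm (\<mu> j) 2 (\<lambda>x. \<phi> j x * pushed i j x) \<le> v * Lp_norm (\<mu> j) 2 (pushed i j)"
        using i \<phi>_le[of j] jk kN v by (intro M.Lp_norm_mult_sup \<phi>_bdd pushed_bdd) auto
      also have "\<dots> \<le> v * (2 * \<kappa> * v * a (j - i))"
        using decay[OF i] jk kN v by (intro mult_left_mono) auto
      finally show "Lp_norm (\<mu> j) 2 (\<lambda>x. \<phi> j x * pushed i j x) \<le> r i"
        using False by (simp add: r_def power2_eq_square mult_ac)
    qed (use UY in \<open>auto simp: B_def\<close>)
    finally show ?thesis .
  qed
  have "\<bar>\<integral>x. U j (cocycle Suc T j 0 x) * U k (cocycle Suc T k 0 x) \<partial>\<mu> 0\<bar>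
      \<le> (\<Sum>i\<le>j. \<bar>(if i = j then 1 else 2) * (\<integral>x. \<phi> j x * pushed i j x * W x \<partial>\<mu> j)\<bar>)"
    unfolding eq by (rule sum_abs)
  also have "\<dots> \<le> (\<Sum>i\<le>j. 2 * (r i * B))"
    unfolding abs_mult using each by (intro sum_mono mult_mono) auto
  also have "\<dots> = 2 * (\<Sum>i\<le>j. r i) * B" by (simp add: sum_distrib_left sum_distrib_right mult.assoc)
  also have "\<dots> \<le> 2 * ((real m + 1) * (\<kappa> * v\<^sup>2 * a (k - j)) + 2 * \<kappa> * v\<^sup>2 * R) * B"
  proof (intro mult_right_mono mult_left_mono B0)
    have "(\<Sum>i\<le>j. r i) = (\<Sum>l\<le>j. if l \<le> m then \<kappa> * v\<^sup>2 * a (k - j) else 2 * \<kappa> * v\<^sup>2 * a l)"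
      unfolding r_def by (rule sum_atMost_flip)
    also have "\<dots> \<le> (\<Sum>l\<in>{..m} \<union> {m<..N}. if l \<le> m then \<kappa> * v\<^sup>2 * a (k - j) else 2 * \<kappa> * v\<^sup>2 * a l)"
      by (rule sum_mono2) (use jk kN v \<kappa> a0 in auto)
    also have "\<dots> = (\<Sum>l\<le>m. \<kappa> * v\<^sup>2 * a (k - j)) + (\<Sum>l\<in>{m<..N}. 2 * \<kappa> * v\<^sup>2 * a l)"
      by (subst sum.union_disjoint) auto
    also have "\<dots> \<le> (real m + 1) * (\<kappa> * v\<^sup>2 * a (k - j)) + 2 * \<kappa> * v\<^sup>2 * R"
    proof (rule add_mono)
      show "(\<Sum>l\<le>m. \<kappa> * v\<^sup>2 * a (k - j)) \<le> (real m + 1) * (\<kappa> * v\<^sup>2 * a (k - j))"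
        by (simp add: add.commute)
      have "2 * \<kappa> * v\<^sup>2 * (\<Sum>l\<in>{m<..N}. a l) \<le> 2 * \<kappa> * v\<^sup>2 * R"
        by (rule mult_left_mono[OF R]) (simp add: \<kappa>)
      then show "(\<Sum>l\<in>{m<..N}. 2 * \<kappa> * v\<^sup>2 * a l) \<le> 2 * \<kappa> * v\<^sup>2 * R" by (simp only: sum_distrib_left)
    qed
    finally show "(\<Sum>i\<le>j. r i) \<le> (real m + 1) * (\<kappa> * v\<^sup>2 * a (k - j)) + 2 * \<kappa> * v\<^sup>2 * R" .
  qed simp
  also have "\<dots> = (2 * (real m + 1) * \<kappa> * v\<^sup>2 * a (k - j) + 4 * \<kappa> * v\<^sup>2 * R) * B"
    by (simp add: algebra_simps)
  finally show ?thesis by (simp add: B_def)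
qed

lemma correlation_part_le:
  assumes v: "0 \<le> v" and \<kappa>: "0 \<le> \<kappa>" and a0: "\<And>l. 0 \<le> a l"
    and \<phi>_le: "\<And>j x. j \<le> N \<Longrightarrow> x \<in> space (\<mu> j) \<Longrightarrow> \<bar>\<phi> j x\<bar> \<le> v"
    and decay: "\<And>i j. i \<le> j \<Longrightarrow> j \<le> N \<Longrightarrow> Lp_norm (\<mu> j) 2 (pushed i j) \<le> 2 * \<kappa> * v * a (j - i)"
    and decay2: "\<And>i j k. i \<le> j \<Longrightarrow> j \<le> k \<Longrightarrow> k \<le> N \<Longrightarrow> Lp_norm (\<mu> k) 2 (centered (\<mu> k)
          (cocycle Suc L (k - j) j (\<lambda>x. \<phi> j x * pushed i j x))) \<le> \<kappa> * v\<^sup>2 * a (k - j)"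
    and A: "(\<Sum>l\<le>N. a l) \<le> A" and R: "(\<Sum>l\<in>{m<..N}. a l) \<le> R"
  shows "(Lp_norm (\<mu> 0) 2 (\<lambda>x. \<Sum>j<N. U j (cocycle Suc T j 0 x)))\<^sup>2
    \<le> 32 * \<kappa>\<^sup>2 * v ^ 4 * A * real N * ((real m + 1) * A + 2 * real N * R)"
proof -
  have A0: "0 \<le> A" using A sum_nonneg[of "{..N}" a] a0 by (meson order_trans)
  have R0: "0 \<le> R" using R sum_nonneg[of "{m<..N}" a] a0 by (meson order_trans)
  define B where "B = 8 * \<kappa> * v\<^sup>2 * A"
  have B0: "0 \<le> B" using v \<kappa> A0 by (simp add: B_def)
  have "(Lp_norm (\<mu> 0) 2 (\<lambda>x. \<Sum>j<N. U j (cocycle Suc T j 0 x)))\<^sup>2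
      = (\<integral>x. (\<Sum>j<N. U j (cocycle Suc T j 0 x))\<^sup>2 \<partial>\<mu> 0)" by (rule Lp_norm_2)
  also have "\<dots> \<le> 2 * (\<Sum>k<N. \<Sum>j\<le>k. \<bar>\<integral>x. U j (cocycle Suc T j 0 x) * U k (cocycle Suc T k 0 x) \<partial>\<mu> 0\<bar>)"
    by (rule sum_square_integral_le[OF prob]) (rule bdd_compose0[OF U_bdd])
  also have "\<dots> \<le> 2 * (\<Sum>k<N. \<Sum>j\<le>k. (2 * (real m + 1) * \<kappa> * v\<^sup>2 * a (k - j) + 4 * \<kappa> * v\<^sup>2 * R) * B)"
    unfolding B_def
    by (intro mult_left_mono sum_mono covariance_le[OF _ _ v \<kappa> a0 \<phi>_le decay decay2 A R]) auto
  also have "\<dots> \<le> 2 * (\<Sum>k<N. (2 * (real m + 1) * \<kappa> * v\<^sup>2 * A + real N * (4 * \<kappa> * v\<^sup>2 * R)) * B)"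
  proof (intro mult_left_mono sum_mono)
    fix k assume k: "k \<in> {..<N}"
    have "(\<Sum>j\<le>k. a (k - j)) = (\<Sum>l\<le>k. a l)"
      by (rule sum_atMost_flip)
    also have "\<dots> \<le> (\<Sum>l\<le>N. a l)" using k a0 by (intro sum_mono2) auto
    finally have sA: "(\<Sum>j\<le>k. a (k - j)) \<le> A" using A by simp
    have "(\<Sum>j\<le>k. (2 * (real m + 1) * \<kappa> * v\<^sup>2 * a (k - j) + 4 * \<kappa> * v\<^sup>2 * R) * B)
        = (2 * (real m + 1) * \<kappa> * v\<^sup>2 * (\<Sum>j\<le>k. a (k - j)) + real (Suc k) * (4 * \<kappa> * v\<^sup>2 * R)) * B"
      by (simp add: sum.distrib flip: sum_distrib_left sum_distrib_right)
    also have "\<dots> \<le> (2 * (real m + 1) * \<kappa> * v\<^sup>2 * A + real N * (4 * \<kappa> * v\<^sup>2 * R)) * B"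
      using k \<kappa> v R0 B0 sA by (intro mult_right_mono add_mono mult_left_mono) auto
    finally show "(\<Sum>j\<le>k. (2 * (real m + 1) * \<kappa> * v\<^sup>2 * a (k - j) + 4 * \<kappa> * v\<^sup>2 * R) * B)
        \<le> (2 * (real m + 1) * \<kappa> * v\<^sup>2 * A + real N * (4 * \<kappa> * v\<^sup>2 * R)) * B" .
  qed simp
  also have "\<dots> = 32 * \<kappa>\<^sup>2 * v ^ 4 * A * real N * ((real m + 1) * A + 2 * real N * R)"
    by (simp add: B_def power2_eq_square power4_eq_xxxx algebra_simps)
  finally show ?thesis .
qed

text \<open>The exponent \<open>q\<close> for the martingale part is left free. The correlation part is estimated in \<open>L\<^sup>2\<close>
and the telescoping part in \<open>L\<^sup>s\<close>.\<close>

lemma quad_norm_le: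
  assumes s: "1 \<le> s" "s \<le> q" and q: "1 < q" "q \<le> 2"
    and v: "0 \<le> v" and \<kappa>: "0 \<le> \<kappa>" and g: "0 \<le> g" and a0: "\<And>l. 0 \<le> a l"
    and \<phi>_le: "\<And>j x. j \<le> N \<Longrightarrow> x \<in> space (\<mu> j) \<Longrightarrow> \<bar>\<phi> j x\<bar> \<le> v"
    and decay: "\<And>i j. i \<le> j \<Longrightarrow> j \<le> N \<Longrightarrow> Lp_norm (\<mu> j) 2 (pushed i j) \<le> 2 * \<kappa> * v * a (j - i)"
    and decay2: "\<And>i j k. i \<le> j \<Longrightarrow> j \<le> k \<Longrightarrow> k \<le> N \<Longrightarrow> Lp_norm (\<mu> k) 2 (centered (\<mu> k)
          (cocycle Suc L (k - j) j (\<lambda>x. \<phi> j x * pushed i j x))) \<le> \<kappa> * v\<^sup>2 * a (k - j)"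
    and A: "(\<Sum>l\<le>N. a l) \<le> A" and R: "(\<Sum>l\<in>{m<..N}. a l) \<le> R"
    and Gs: "Lp_norm (\<mu> N) (2 * s) (G N) \<le> g'"
    and Gq: "\<And>j. j \<le> N \<Longrightarrow> Lp_norm (\<mu> j) (2 * q) (G j) \<le> g"
  shows "Lp_norm (\<mu> 0) s (quad N)
    \<le> sqrt (32 * \<kappa>\<^sup>2 * v ^ 4 * A * real N * ((real m + 1) * A + 2 * real N * R))
      + 2 * g'\<^sup>2 + 8 * real N powr (1 / q) * ((v + 2 * g) * g)"
proof -
  interpret M: prob_space "\<mu> 0" by (rule prob)
  let ?X = "\<lambda>x. \<Sum>j<N. U j (cocycle Suc T j 0 x)"
  let ?Z = "\<lambda>x. (G N (cocycle Suc T N 0 x))\<^sup>2 - (\<integral>y. (G N y)\<^sup>2 \<partial>\<mu> N)"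
  let ?S = "\<lambda>x. \<Sum>j<N. D j (cocycle Suc T j 0 x)"
  have X: "bdd_measurable (\<mu> 0) ?X" by (intro bdd_measurable_intros bdd_compose0[OF U_bdd])
  have Z: "bdd_measurable (\<mu> 0) ?Z" by (intro bdd_measurable_intros bdd_compose0[OF G_bdd])
  have S: "bdd_measurable (\<mu> 0) ?S" by (intro bdd_measurable_intros bdd_compose0[OF D_bdd])
  have "quad N = (\<lambda>x. ?X x - ?Z x - 2 * ?S x)" using quad_decomposition by blast
  then have "Lp_norm (\<mu> 0) s (quad N) = Lp_norm (\<mu> 0) s (\<lambda>x. ?X x - ?Z x - 2 * ?S x)" by simp
  also have "\<dots> \<le> Lp_norm (\<mu> 0) s (\<lambda>x. ?X x - ?Z x) + Lp_norm (\<mu> 0) s (\<lambda>x. 2 * ?S x)"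
    by (intro M.Lp_norm_diff s bdd_measurable_diff[OF X Z] bdd_measurable_mult[OF bdd_measurable_const S])
  also have "\<dots> \<le> (Lp_norm (\<mu> 0) s ?X + Lp_norm (\<mu> 0) s ?Z) + 2 * Lp_norm (\<mu> 0) s ?S"
    using M.Lp_norm_diff[OF s(1) X Z] s by (simp add: Lp_norm_cmult)
  also have "Lp_norm (\<mu> 0) s ?X \<le> sqrt (32 * \<kappa>\<^sup>2 * v ^ 4 * A * real N * ((real m + 1) * A + 2 * real N * R))"
    using M.Lp_norm_le_exponent[OF _ _ X, of s 2] s q
      real_le_rsqrt[OF correlation_part_le[OF v \<kappa> a0 \<phi>_le decay decay2 A R]] by simp
  also have "Lp_norm (\<mu> 0) s ?Z \<le> 2 * g'\<^sup>2"
    by (rule square_part_le[OF s(1) Gs])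
  also have "Lp_norm (\<mu> 0) s ?S \<le> 4 * real N powr (1 / q) * ((v + 2 * g) * g)"
    using M.Lp_norm_le_exponent[OF _ _ S, of s q] s martingale_part_le[OF q v g, of N, OF \<phi>_le Gq] by simp
  finally show ?thesis by simp
qed

end

section \<open>Power sums and growth along orbits\<close>

text \<open>Telescoping: by the mean value theorem \<open>(b - 1) (x + 1) powr (- b)\<close> is at most the decrease of
\<open>\<lambda>x. x powr (1 - b)\<close> from \<open>x\<close> to \<open>x + 1\<close>.\<close>

lemma sum_powr_tail_le:
  fixes b :: real
  assumes b: "1 < b"
  shows "(\<Sum>l\<in>{m<..N}. (real l + 1) powr (- b)) \<le> (real m + 1) powr (1 - b) / (b - 1)"
proof -
  have step: "(x + 1) powr (- b) \<le> (x powr (1 - b) - (x + 1) powr (1 - b)) / (b - 1)" if x: "1 \<le> x" for x :: real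
  proof -
    have "\<exists>\<xi>>x. \<xi> < x + 1 \<and> (x + 1) powr (1 - b) - x powr (1 - b) = (x + 1 - x) * ((1 - b) * \<xi> powr (1 - b - 1))"
    proof (rule MVT2)
      fix t assume "x \<le> t"
      then show "((\<lambda>t. t powr (1 - b)) has_real_derivative (1 - b) * t powr (1 - b - 1)) (at t)"
        using x by (intro has_real_derivative_powr) auto
    qed simp
    then obtain \<xi> where \<xi>: "x < \<xi>" "\<xi> < x + 1" "x powr (1 - b) - (x + 1) powr (1 - b) = (b - 1) * \<xi> powr (- b)"
      by (auto simp: algebra_simps)
    have "(x + 1) powr (- b) \<le> \<xi> powr (- b)"
      using \<xi> x b by (intro powr_mono2') auto
    then show ?thesis using \<xi>(3) b by simp
  qed
  have "(\<Sum>l\<in>{m<..m + d}. (real l + 1) powr (- b))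
      \<le> ((real m + 1) powr (1 - b) - (real (m + d) + 1) powr (1 - b)) / (b - 1)" for d
  proof (induction d)
    case (Suc d)
    have "{m<..m + Suc d} = insert (Suc (m + d)) {m<..m + d}" by auto
    then have "(\<Sum>l\<in>{m<..m + Suc d}. (real l + 1) powr (- b))
        = (real (Suc (m + d)) + 1) powr (- b) + (\<Sum>l\<in>{m<..m + d}. (real l + 1) powr (- b))"
      by simp
    also have "\<dots> \<le> (real (Suc (m + d)) powr (1 - b) - (real (Suc (m + d)) + 1) powr (1 - b)) / (b - 1)
        + ((real m + 1) powr (1 - b) - (real (m + d) + 1) powr (1 - b)) / (b - 1)"
      by (intro add_mono step Suc.IH) simp
    also have "\<dots> = ((real m + 1) powr (1 - b) - (real (m + Suc d) + 1) powr (1 - b)) / (b - 1)"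
      by (simp add: add_divide_distrib[symmetric] add.commute)
    finally show ?case .
  qed simp
  from this[of "N - m"] have "(\<Sum>l\<in>{m<..m + (N - m)}. (real l + 1) powr (- b)) \<le> (real m + 1) powr (1 - b) / (b - 1)"
    by (rule order_trans) (use b in \<open>auto intro!: divide_right_mono\<close>)
  moreover have "{m<..N} = {m<..m + (N - m)}" by auto
  ultimately show ?thesis by metis
qed

lemma sum_powr_le:
  fixes b :: real
  assumes b: "1 < b"
  shows "(\<Sum>l\<le>N. (real l + 1) powr (- b)) \<le> b / (b - 1)"
proof -
  have "{..N} = insert 0 {0<..N}" by auto
  then have "(\<Sum>l\<le>N. (real l + 1) powr (- b)) = 1 + (\<Sum>l\<in>{0<..N}. (real l + 1) powr (- b))" by simp
  also have "\<dots> \<le> 1 + 1 / (b - 1)" using sum_powr_tail_le[OF b, of 0 N] by simp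
  also have "\<dots> = b / (b - 1)" using b by (simp add: field_simps)
  finally show ?thesis .
qed

lemma bound_from_eventual_bound:
  fixes x y :: "nat \<Rightarrow> real"
  assumes ev: "\<forall>\<^sub>F n in sequentially. \<bar>x n\<bar> \<le> c * y n" and y: "\<And>n. 0 < y n"
  shows "\<exists>C\<ge>1. \<forall>n. \<bar>x n\<bar> \<le> C * y n"
proof -
  obtain N where N: "\<And>n. N \<le> n \<Longrightarrow> \<bar>x n\<bar> \<le> c * y n"
    using ev unfolding eventually_sequentially by blast
  define C where "C = 1 + \<bar>c\<bar> + (\<Sum>n<N. \<bar>x n\<bar> / y n)"
  have S: "0 \<le> (\<Sum>n<N. \<bar>x n\<bar> / y n)"
    by (intro sum_nonneg divide_nonneg_pos y) auto
  have "\<bar>x n\<bar> \<le> C * y n" for n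
  proof (cases "N \<le> n")
    case True
    have "c * y n \<le> C * y n" using S y[of n] by (intro mult_right_mono) (auto simp: C_def)
    then show ?thesis using N[OF True] by simp
  next
    case False
    have "\<bar>x n\<bar> / y n \<le> (\<Sum>n<N. \<bar>x n\<bar> / y n)"
      by (rule member_le_sum) (use False in \<open>auto intro!: divide_nonneg_pos y\<close>)
    then have "\<bar>x n\<bar> / y n \<le> C" by (simp add: C_def)
    then show ?thesis using y[of n] by (simp add: field_simps)
  qed
  moreover have "1 \<le> C" using S by (simp add: C_def)
  ultimately show ?thesis by blast
qed

lemma funpow_measure_preserving:
  assumes "\<sigma> \<in> measurable P P" "distr P P \<sigma> = P"
  shows "\<sigma> ^^ n \<in> measurable P P" "distr P P (\<sigma> ^^ n) = P"
proof (induction n)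
  case (Suc n)
  { case 1 then show ?case using measurable_comp[OF Suc(1) assms(1)] by (simp only: funpow.simps) }
  { case 2
    have "distr P P (\<sigma> \<circ> \<sigma> ^^ n) = distr (distr P P (\<sigma> ^^ n)) P \<sigma>"
      by (rule distr_distr[symmetric, OF assms(1) Suc(1)])
    then show ?case using Suc(2) assms(2) by (simp only: funpow.simps) }
qed (simp_all add: id_def distr_id)

lemma AE_all_iterates:
  assumes "\<sigma> \<in> measurable P P" "distr P P \<sigma> = P" and Q: "AE \<omega> in P. Q \<omega>"
  shows "AE \<omega> in P. \<forall>n::nat. Q ((\<sigma> ^^ n) \<omega>)"
  unfolding AE_all_countable
proof
  fix n
  note mp = funpow_measure_preserving[OF assms(1,2), of n]
  show "AE \<omega> in P. Q ((\<sigma> ^^ n) \<omega>)"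
    by (rule AE_distrD[OF mp(1)], subst mp(2), rule Q)
qed

lemma sum_of_bool_less_le:
  fixes x :: real
  assumes "0 \<le> x"
  shows "(\<Sum>n<N. of_bool (real n + 1 < x)) \<le> x"
proof (induction N)
  case (Suc N)
  have "(\<Sum>n<N. of_bool (real n + 1 < x)) \<le> (\<Sum>n<N. 1 :: real)" by (intro sum_mono) auto
  then show ?case using Suc by (cases "real N + 1 < x") auto
qed (use assms in simp)

text \<open>For finite \<open>q\<close> put \<open>X = |g| powr q\<close>. By invariance the probabilities of \<open>{X \<circ> \<sigma>\<^sup>n > n + 1}\<close> are those
of \<open>{X > n + 1}\<close>, and their sum is at most the integral of \<open>X\<close>. So Borel--Cantelli applies. For
\<open>q = \<infinity>\<close> the exponent is \<open>0\<close> and the bound is an essential bound of \<open>g\<close>.\<close>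

lemma AE_growth_along_orbit:
  assumes P: "prob_space P" and \<sigma>: "\<sigma> \<in> measurable P P" "distr P P \<sigma> = P"
    and q: "0 < q" and f: "in_Lp P q f"
  shows "AE \<omega> in P. \<exists>C\<ge>1. \<forall>n. \<bar>f ((\<sigma> ^^ n) \<omega>)\<bar> \<le> C * (real n + 1) powr recip q"
proof -
  interpret prob_space P by fact
  note mp = funpow_measure_preserving[OF \<sigma>]
  obtain g where g [measurable]: "g \<in> borel_measurable P" and fg: "AE x in P. f x = g x"
    and gq: "if q = \<infinity> then \<exists>C. AE x in P. \<bar>g x\<bar> \<le> C
      else integrable P (\<lambda>x. \<bar>g x\<bar> powr enn2real q)"
    using f unfolding in_Lp_def by blast
  have fg': "AE \<omega> in P. \<forall>n. f ((\<sigma> ^^ n) \<omega>) = g ((\<sigma> ^^ n) \<omega>)"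
    by (rule AE_all_iterates[OF \<sigma> fg])
  have "AE \<omega> in P. \<exists>C\<ge>1. \<forall>n. \<bar>g ((\<sigma> ^^ n) \<omega>)\<bar> \<le> C * (real n + 1) powr recip q"
  proof (cases "q = \<infinity>")
    case True
    then obtain C where "AE x in P. \<bar>g x\<bar> \<le> C" using gq by auto
    from AE_all_iterates[OF \<sigma> this] show ?thesis
      by eventually_elim (auto simp: True recip_top[unfolded infinity_ennreal_def] recip_top
          intro!: exI[of _ "max 1 C"] simp: le_max_iff_disj)
  next
    case False
    define t where "t = enn2real q"
    have qt: "q = ennreal t" using False by (simp add: t_def less_top)
    have t: "0 < t" using q qt by (simp add: ennreal_less_zero_iff)
    have rq: "recip q = 1 / t" using recip_ennreal[OF t] qt by simp
    define X where "X = (\<lambda>x. \<bar>g x\<bar> powr t)"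
    have X [measurable]: "X \<in> borel_measurable P" unfolding X_def by measurable
    have Xint: "integrable P X" using gq False by (simp add: X_def t_def)
    have X0: "0 \<le> X x" for x by (simp add: X_def)
    define A where "A n = {x \<in> space P. real n + 1 < X ((\<sigma> ^^ n) x)}" for n
    note [measurable] = mp(1)
    have A [measurable]: "A n \<in> sets P" for n unfolding A_def by measurable
    have mA: "measure P (A n) = (\<integral>x. of_bool (real n + 1 < X x) \<partial>P)" for n
    proof -
      have "measure P (A n) = (\<integral>x. indicator (A n) x \<partial>P)" by simp
      also have "\<dots> = (\<integral>x. of_bool (real n + 1 < X ((\<sigma> ^^ n) x)) \<partial>P)"
        by (intro Bochner_Integration.integral_cong) (auto simp: A_def)
      also have "\<dots> = (\<integral>x. of_bool (real n + 1 < X x) \<partial>distr P P (\<sigma> ^^ n))"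
        by (rule integral_distr[symmetric, OF mp(1)]) measurable
      finally show ?thesis by (simp add: mp(2))
    qed
    have "(\<Sum>n<N. measure P (A n)) \<le> (\<integral>x. X x \<partial>P)" for N
    proof -
      have I: "integrable P (\<lambda>x. of_bool (real n + 1 < X x) :: real)" for n
        by (rule integrable_const_bound[of _ 1]) auto
      have "(\<Sum>n<N. measure P (A n)) = (\<integral>x. (\<Sum>n<N. of_bool (real n + 1 < X x)) \<partial>P)"
        unfolding mA by (rule Bochner_Integration.integral_sum[symmetric]) (rule I)
      also have "\<dots> \<le> (\<integral>x. X x \<partial>P)"
        by (intro integral_mono Bochner_Integration.integrable_sum I Xint sum_of_bool_less_le X0)
      finally show ?thesis .
    qed
    then have "summable (\<lambda>n. measure P (A n))"
      by (intro summableI_nonneg_bounded) auto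
    then have "AE x in P. \<forall>\<^sub>F n in sequentially. x \<in> space P - A n"
      by (intro borel_cantelli_AE1 A) (auto simp: less_top[symmetric])
    then show ?thesis
    proof eventually_elim
      case (elim x)
      have "\<forall>\<^sub>F n in sequentially. \<bar>g ((\<sigma> ^^ n) x)\<bar> \<le> 1 * (real n + 1) powr (1 / t)"
        using elim
      proof eventually_elim
        case (elim n)
        then have "X ((\<sigma> ^^ n) x) \<le> real n + 1" by (auto simp: A_def)
        then have "X ((\<sigma> ^^ n) x) powr (1 / t) \<le> (real n + 1) powr (1 / t)"
          using t X0 by (intro powr_mono2) auto
        then show ?case using t by (simp add: X_def powr_powr)
      qed
      then show ?case unfolding rq by (rule bound_from_eventual_bound) simp
    qed
  qed
  with fg' show ?thesis by eventually_elim auto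
qed

section \<open>Polynomial growth of the quadratic deviation\<close>

context nonstationary_system begin

text \<open>The choice of the exponent \<open>q\<close>. Interpolation gives \<open>\<parallel>L\<^sup>l \<phi>\<^sub>i\<parallel> \<le> const * n powr (\<alpha> / q) * v * (l + 1) powr (- b / q)\<close>
in \<open>L\<^sup>2\<^sup>q\<close>, which is summable for \<open>q < b\<close> and leads to the power \<open>(1 + 2 \<alpha>) / q + 2 \<rho>\<close> of \<open>n\<close>. The
value \<open>q0\<close> is the one at which this power equals \<open>1/2 + 1/(2b) + \<alpha> + 2 \<rho>\<close>. The condition
\<open>2 \<alpha> b < b - 1\<close> ensures \<open>q0 < b\<close>. If \<open>s \<ge> b\<close>, then \<open>q = s\<close> with the summability of the
\<open>L\<^sup>2\<^sup>s\<close> decay is already sufficient.\<close>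

lemma G_norm_power_bound:
  assumes s: "1 < s" "s < 2" and b: "1 < b" and \<alpha>: "0 \<le> \<alpha>" "2 * \<alpha> * b < b - 1"
    and C: "1 \<le> C" and Ca: "0 \<le> Ca" and A': "0 \<le> A'"
    and \<phi>_le: "\<And>N j x. 1 \<le> N \<Longrightarrow> j \<le> N \<Longrightarrow> x \<in> space (\<mu> j) \<Longrightarrow> \<bar>\<phi> j x\<bar> \<le> C * real N powr \<rho>"
    and decay: "\<And>N i j. 1 \<le> N \<Longrightarrow> i \<le> j \<Longrightarrow> j \<le> N \<Longrightarrow>
      Lp_norm (\<mu> j) 2 (pushed i j) \<le> 2 * (C * real N powr \<alpha>) * (C * real N powr \<rho>) * a (j - i)"
    and a_le: "\<And>l. a l \<le> Ca * (real l + 1) powr (- b)"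
    and G2s: "\<And>N j. 1 \<le> N \<Longrightarrow> j \<le> N \<Longrightarrow>
      Lp_norm (\<mu> j) (2 * s) (G j) \<le> 2 * (C * real N powr \<alpha>) * (C * real N powr \<rho>) * A'"
  shows "\<exists>q c. s \<le> q \<and> q \<le> 2 \<and> 0 \<le> c \<and> (\<forall>N\<ge>1. \<exists>g\<ge>0.
    (\<forall>j\<le>N. Lp_norm (\<mu> j) (2 * q) (G j) \<le> g) \<and>
    real N powr (1 / q) * ((C * real N powr \<rho> + 2 * g) * g) \<le> c * real N powr (1 / 2 + 1 / (2 * b) + \<alpha> + 2 * \<rho>))"
proof (cases "s < b")
  case True
  define e where "e = 1 / 2 + 1 / (2 * b) + \<alpha>"
  have e0: "0 < e" unfolding e_def using b \<alpha> by (intro add_pos_nonneg add_pos_pos) auto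
  \<comment> \<open>\<open>q0\<close> solves \<open>(1 + 2 * \<alpha>) / q0 = e\<close>; the maximum with \<open>s\<close> is needed because the final norm is \<open>L\<^sup>s\<close>.\<close>
  define q0 where "q0 = (1 + 2 * \<alpha>) / e"
  define q where "q = max s q0"
  have "q0 < b"
  proof -
    have "b * e = b / 2 + 1 / 2 + \<alpha> * b" using b by (simp add: e_def field_simps)
    moreover have "2 * \<alpha> * 1 \<le> 2 * \<alpha> * b" using \<alpha> b by (intro mult_left_mono) auto
    ultimately have "1 + 2 * \<alpha> < b * e" using \<alpha> b by (simp add: mult.assoc)
    then show ?thesis using e0 by (simp add: q0_def pos_divide_less_eq)
  qed
  then have qb: "q < b" using True by (simp add: q_def)
  have "1 + 2 * \<alpha> < 2 * e" using b by (simp add: e_def)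
  then have "q0 < 2" using e0 by (simp add: q0_def pos_divide_less_eq)
  then have q2: "q \<le> 2" using s by (simp add: q_def)
  have sq: "s \<le> q" by (simp add: q_def)
  have q1: "1 < q" using sq s by simp
  have exponent: "1 / q + 2 * \<alpha> / q \<le> e"
  proof -
    have "(1 + 2 * \<alpha>) / e \<le> q" by (simp add: q_def q0_def)
    then have "1 + 2 * \<alpha> \<le> q * e" using e0 by (simp add: pos_divide_le_eq)
    then have "(1 + 2 * \<alpha>) / q \<le> e" using q1 by (simp add: pos_divide_le_eq mult.commute)
    then show ?thesis by (simp add: add_divide_distrib)
  qed
  have bq: "1 < b / q" using qb q1 by simp
  define B where "B = 1 / (b / q - 1)"
  define d where "d = (2 * C * Ca) powr (1 / q) * B"
  have B0: "0 \<le> B" using bq by (simp add: B_def)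
  have d0: "0 \<le> d" using B0 by (simp add: d_def)
  define c where "c = C\<^sup>2 * ((1 + 2 * d) * d)"
  have "\<exists>g\<ge>0. (\<forall>j\<le>N. Lp_norm (\<mu> j) (2 * q) (G j) \<le> g) \<and>
      real N powr (1 / q) * ((C * real N powr \<rho> + 2 * g) * g) \<le> c * real N powr (e + 2 * \<rho>)" if N: "1 \<le> N" for N
  proof -
    define v where "v = C * real N powr \<rho>"
    define n where "n = real N"
    have n1: "1 \<le> n" using N by (simp add: n_def)
    have v0: "0 \<le> v" using C by (simp add: v_def)
    define cc where "cc l = (2 * C * Ca) powr (1 / q) * n powr (\<alpha> / q) * v * (real l + 1) powr (- (b / q))" for l
    define g where "g = (n powr (\<alpha> / q) * v) * d"
    have pl: "Lp_norm (\<mu> j) (2 * q) (pushed i j) \<le> cc (j - i)" if ij: "i \<le> j" and jN: "j \<le> N" for i j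
    proof -
      interpret M: prob_space "\<mu> j" by (rule prob)
      have "Lp_norm (\<mu> j) (2 * q) (pushed i j) \<le> Lp_norm (\<mu> j) 2 (pushed i j) powr (1 / q) * v powr (1 - 1 / q)"
        using q1 v0 ij jN \<phi>_le[OF N, of i]
        by (intro M.Lp_norm_interpolation pushed_bdd pushed_le) (auto simp: v_def)
      also have "\<dots> \<le> (2 * (C * n powr \<alpha>) * v * (Ca * (real (j - i) + 1) powr (- b))) powr (1 / q) * v powr (1 - 1 / q)"
      proof (intro mult_right_mono powr_mono2)
        have "Lp_norm (\<mu> j) 2 (pushed i j) \<le> 2 * (C * n powr \<alpha>) * v * a (j - i)"
          using decay[OF N ij jN] by (simp add: n_def v_def)
        also have "\<dots> \<le> 2 * (C * n powr \<alpha>) * v * (Ca * (real (j - i) + 1) powr (- b))"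
          using C v0 by (intro mult_left_mono a_le) auto
        finally show "Lp_norm (\<mu> j) 2 (pushed i j) \<le> 2 * (C * n powr \<alpha>) * v * (Ca * (real (j - i) + 1) powr (- b))" .
      qed (use q1 in auto)
      also have "2 * (C * n powr \<alpha>) * v * (Ca * (real (j - i) + 1) powr (- b))
          = (2 * C * Ca) * n powr \<alpha> * v * (real (j - i) + 1) powr (- b)" by simp
      also have "\<dots> powr (1 / q) = (2 * C * Ca) powr (1 / q) * n powr (\<alpha> / q) * v powr (1 / q) * (real (j - i) + 1) powr (- (b / q))"
        by (simp only: powr_mult powr_powr) simp
      also have "\<dots> * v powr (1 - 1 / q) = (2 * C * Ca) powr (1 / q) * n powr (\<alpha> / q) * (v powr (1 / q) * v powr (1 - 1 / q)) * (real (j - i) + 1) powr (- (b / q))"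
        by (simp only: mult_ac)
      also have "v powr (1 / q) * v powr (1 - 1 / q) = v"
        using v0 by (simp flip: powr_add)
      finally show ?thesis by (simp add: cc_def)
    qed
    have cc0: "0 \<le> cc l" for l using v0 by (simp add: cc_def)
    have "Lp_norm (\<mu> j) (2 * q) (G j) \<le> g" if jN: "j \<le> N" for j
    proof -
      have "Lp_norm (\<mu> j) (2 * q) (G j) \<le> (\<Sum>l<N. cc (Suc l))"
        using q1 by (intro G_norm_le[OF _ jN cc0 pl[OF _ jN]]) auto
      also have "\<dots> = (\<Sum>l\<in>{0<..N}. cc l)"
        by (rule sum.reindex_bij_witness[of _ "\<lambda>l. l - 1" Suc]) auto
      also have "\<dots> = (2 * C * Ca) powr (1 / q) * n powr (\<alpha> / q) * v * (\<Sum>l\<in>{0<..N}. (real l + 1) powr (- (b / q)))"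
        by (simp add: cc_def sum_distrib_left)
      also have "\<dots> \<le> (2 * C * Ca) powr (1 / q) * n powr (\<alpha> / q) * v * B"
        using sum_powr_tail_le[OF bq, of 0 N] v0 by (intro mult_left_mono) (auto simp: B_def)
      also have "\<dots> = g" by (simp add: g_def d_def)
      finally show ?thesis .
    qed
    moreover have g0: "0 \<le> g" using v0 d0 by (simp add: g_def)
    moreover have "n powr (1 / q) * ((v + 2 * g) * g) \<le> c * n powr (e + 2 * \<rho>)"
    proof -
      have "1 \<le> n powr (\<alpha> / q)" using n1 \<alpha> q1 by (intro ge_one_powr_ge_zero) auto
      then have "1 * v \<le> n powr (\<alpha> / q) * v" using v0 by (intro mult_right_mono)
      then have "(v + 2 * g) * g \<le> (n powr (\<alpha> / q) * v + 2 * g) * g"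
        using g0 by (intro mult_right_mono) auto
      also have "\<dots> = (n powr (\<alpha> / q) * v) * (n powr (\<alpha> / q) * v) * ((1 + 2 * d) * d)"
        by (simp add: g_def algebra_simps)
      also have "(n powr (\<alpha> / q) * v) * (n powr (\<alpha> / q) * v) = C\<^sup>2 * n powr (2 * \<alpha> / q + 2 * \<rho>)"
      proof -
        have "n powr (2 * \<alpha> / q + 2 * \<rho>) = (n powr (\<alpha> / q) * n powr (\<alpha> / q)) * (n powr \<rho> * n powr \<rho>)"
          by (simp flip: powr_add)
        then show ?thesis by (simp add: v_def n_def[symmetric] power2_eq_square mult_ac)
      qed
      finally have "n powr (1 / q) * ((v + 2 * g) * g) \<le> n powr (1 / q) * (C\<^sup>2 * n powr (2 * \<alpha> / q + 2 * \<rho>) * ((1 + 2 * d) * d))"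
        by (intro mult_left_mono) auto
      also have "\<dots> = c * n powr (1 / q + 2 * \<alpha> / q + 2 * \<rho>)"
        by (simp add: c_def powr_add)
      also have "\<dots> \<le> c * n powr (e + 2 * \<rho>)"
        using exponent n1 d0 by (intro mult_left_mono powr_mono) (auto simp: c_def)
      finally show ?thesis .
    qed
    ultimately show ?thesis unfolding v_def n_def by blast
  qed
  moreover have "0 \<le> c" using d0 by (simp add: c_def)
  ultimately show ?thesis using sq q2 unfolding e_def by blast
next
  case False
  define c where "c = C\<^sup>2 * C\<^sup>2 * ((1 + 4 * A') * (2 * A'))"
  have c0: "0 \<le> c" using A' by (simp add: c_def)
  have exponent: "1 / s + 2 * \<alpha> \<le> 1 / 2 + 1 / (2 * b) + \<alpha>"
  proof -
    have "1 / s \<le> 1 / b" using False b by (intro divide_left_mono) auto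
    moreover have "\<alpha> \<le> 1 / 2 - 1 / (2 * b)" using \<alpha> b by (simp add: field_simps)
    moreover have "1 / b = 1 / (2 * b) + 1 / (2 * b)" by simp
    ultimately show ?thesis by linarith
  qed
  have "\<exists>g\<ge>0. (\<forall>j\<le>N. Lp_norm (\<mu> j) (2 * s) (G j) \<le> g) \<and>
      real N powr (1 / s) * ((C * real N powr \<rho> + 2 * g) * g)
        \<le> c * real N powr (1 / 2 + 1 / (2 * b) + \<alpha> + 2 * \<rho>)" if N: "1 \<le> N" for N
  proof -
    define n where "n = real N"
    have n1: "1 \<le> n" using N by (simp add: n_def)
    define w where "w = (C * n powr \<alpha>) * (C * n powr \<rho>)"
    have C1: "1 \<le> C * n powr \<alpha>"
      using mult_mono[OF C, of 1 "n powr \<alpha>"] C n1 \<alpha> by (simp add: ge_one_powr_ge_zero)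
    have vw: "C * n powr \<rho> \<le> w"
      using mult_right_mono[OF C1, of "C * n powr \<rho>"] C by (simp add: w_def)
    have w0: "0 \<le> w" using C by (simp add: w_def)
    define g where "g = 2 * w * A'"
    have g0: "0 \<le> g" using w0 A' by (simp add: g_def)
    have "(C * n powr \<rho> + 2 * g) * g \<le> (w + 2 * g) * g"
      using vw g0 by (intro mult_right_mono) auto
    also have "\<dots> = w * w * ((1 + 4 * A') * (2 * A'))" by (simp add: g_def algebra_simps)
    also have "w * w = C\<^sup>2 * C\<^sup>2 * n powr (2 * \<alpha> + 2 * \<rho>)"
    proof -
      have "n powr (2 * \<alpha> + 2 * \<rho>) = (n powr \<alpha> * n powr \<alpha>) * (n powr \<rho> * n powr \<rho>)"
        by (simp flip: powr_add)
      then show ?thesis by (simp add: w_def power2_eq_square mult_ac)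
    qed
    finally have "n powr (1 / s) * ((C * n powr \<rho> + 2 * g) * g)
        \<le> n powr (1 / s) * (C\<^sup>2 * C\<^sup>2 * n powr (2 * \<alpha> + 2 * \<rho>) * ((1 + 4 * A') * (2 * A')))"
      by (intro mult_left_mono) auto
    also have "\<dots> = c * n powr (1 / s + 2 * \<alpha> + 2 * \<rho>)" by (simp add: c_def powr_add)
    also have "\<dots> \<le> c * n powr (1 / 2 + 1 / (2 * b) + \<alpha> + 2 * \<rho>)"
      using exponent n1 c0 by (intro mult_left_mono powr_mono) auto
    finally have "n powr (1 / s) * ((C * n powr \<rho> + 2 * g) * g)
        \<le> c * n powr (1 / 2 + 1 / (2 * b) + \<alpha> + 2 * \<rho>)" .
    moreover have "Lp_norm (\<mu> j) (2 * s) (G j) \<le> g" if "j \<le> N" for j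
      using G2s[OF N that] by (simp add: g_def w_def n_def mult.assoc)
    ultimately show ?thesis using g0 unfolding n_def by blast
  qed
  then show ?thesis using s c0 by (intro exI[of _ s] exI[of _ c]) auto
qed

text \<open>The bounds of \<open>quad_norm_le\<close> for \<open>\<kappa> = C N powr \<alpha>\<close>, \<open>v = C N powr \<rho>\<close> and truncation lag \<open>m = \<lfloor>N powr d\<rfloor>\<close>.\<close>

lemma quad_growth:
  assumes s: "1 < s" "s < 2" and b: "1 < b" and \<alpha>: "0 \<le> \<alpha>" "2 * \<alpha> * b < b - 1"
    and C: "1 \<le> C" and Ca: "0 \<le> Ca" and a0: "\<And>l. 0 \<le> a l" and a'0: "\<And>l. 0 \<le> a' l"
    and \<phi>_le: "\<And>N j x. 1 \<le> N \<Longrightarrow> j \<le> N \<Longrightarrow> x \<in> space (\<mu> j) \<Longrightarrow> \<bar>\<phi> j x\<bar> \<le> C * real N powr \<rho>"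
    and decay: "\<And>N i j. 1 \<le> N \<Longrightarrow> i \<le> j \<Longrightarrow> j \<le> N \<Longrightarrow>
      Lp_norm (\<mu> j) 2 (pushed i j) \<le> 2 * (C * real N powr \<alpha>) * (C * real N powr \<rho>) * a (j - i)"
    and decay2: "\<And>N i j k. 1 \<le> N \<Longrightarrow> i \<le> j \<Longrightarrow> j \<le> k \<Longrightarrow> k \<le> N \<Longrightarrow> Lp_norm (\<mu> k) 2 (centered (\<mu> k)
          (cocycle Suc L (k - j) j (\<lambda>x. \<phi> j x * pushed i j x)))
          \<le> (C * real N powr \<alpha>) * (C * real N powr \<rho>)\<^sup>2 * a (k - j)"
    and decay3: "\<And>N i j. 1 \<le> N \<Longrightarrow> i \<le> j \<Longrightarrow> j \<le> N \<Longrightarrow>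
      Lp_norm (\<mu> j) (2 * s) (pushed i j) \<le> 2 * (C * real N powr \<alpha>) * (C * real N powr \<rho>) * a' (j - i)"
    and a_le: "\<And>l. a l \<le> Ca * (real l + 1) powr (- b)"
    and a'_sum: "\<And>N. (\<Sum>l<N. a' (Suc l)) \<le> A'"
    and d: "0 < d"
  shows "\<exists>c. \<forall>N\<ge>1. Lp_norm (\<mu> 0) s (quad N) \<le> c * (real N powr (1 / 2 + 2 * \<alpha> + 2 * \<rho>)
    + real N powr (1 / 2 + d / 2 + \<alpha> + 2 * \<rho>) + real N powr (1 + \<alpha> + 2 * \<rho> + d * (1 - b) / 2))"
proof -
  have A'0: "0 \<le> A'" using a'_sum[of 0] by simp
  have G2s: "Lp_norm (\<mu> j) (2 * s) (G j) \<le> 2 * (C * real N powr \<alpha>) * (C * real N powr \<rho>) * A'"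
    if N: "1 \<le> N" and jN: "j \<le> N" for N j
  proof -
    let ?w = "2 * (C * real N powr \<alpha>) * (C * real N powr \<rho>)"
    have w0: "0 \<le> ?w" using C by simp
    have "Lp_norm (\<mu> j) (2 * s) (G j) \<le> (\<Sum>l<N. ?w * a' (Suc l))"
      using s w0 a'0 by (intro G_norm_le[OF _ jN _ decay3[OF N _ jN]]) auto
    also have "\<dots> = ?w * (\<Sum>l<N. a' (Suc l))" by (simp only: sum_distrib_left)
    also have "\<dots> \<le> ?w * A'" by (rule mult_left_mono[OF a'_sum w0])
    finally show ?thesis .
  qed
  obtain q c where q: "s \<le> q" "q \<le> 2" and c0: "0 \<le> c"
    and qc: "\<And>N. 1 \<le> N \<Longrightarrow> \<exists>g\<ge>0. (\<forall>j\<le>N. Lp_norm (\<mu> j) (2 * q) (G j) \<le> g) \<and>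
      real N powr (1 / q) * ((C * real N powr \<rho> + 2 * g) * g) \<le> c * real N powr (1 / 2 + 1 / (2 * b) + \<alpha> + 2 * \<rho>)"
    using G_norm_power_bound[OF s b \<alpha> C Ca A'0 \<phi>_le decay a_le G2s] by blast
  define A where "A = Ca * (b / (b - 1))"
  have A0: "0 \<le> A" using Ca b by (simp add: A_def)
  have A: "(\<Sum>l\<le>N. a l) \<le> A" for N
  proof -
    have "(\<Sum>l\<le>N. a l) \<le> (\<Sum>l\<le>N. Ca * (real l + 1) powr (- b))" by (intro sum_mono a_le)
    also have "\<dots> = Ca * (\<Sum>l\<le>N. (real l + 1) powr (- b))" by (simp only: sum_distrib_left)
    also have "\<dots> \<le> A" unfolding A_def by (rule mult_left_mono[OF sum_powr_le[OF b] Ca])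
    finally show ?thesis .
  qed
  define B where "B = Ca / (b - 1)"
  have B0: "0 \<le> B" using Ca b by (simp add: B_def)
  have R: "(\<Sum>l\<in>{m<..N}. a l) \<le> B * (real m + 1) powr (1 - b)" for m N
  proof -
    have "(\<Sum>l\<in>{m<..N}. a l) \<le> (\<Sum>l\<in>{m<..N}. Ca * (real l + 1) powr (- b))" by (intro sum_mono a_le)
    also have "\<dots> = Ca * (\<Sum>l\<in>{m<..N}. (real l + 1) powr (- b))" by (simp only: sum_distrib_left)
    also have "\<dots> \<le> Ca * ((real m + 1) powr (1 - b) / (b - 1))"
      by (rule mult_left_mono[OF sum_powr_tail_le[OF b] Ca])
    finally show ?thesis by (simp add: B_def)
  qed
  define M where "M = 64 * A * (A + B)"
  have M0: "0 \<le> M" using A0 B0 by (simp add: M_def)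
  define c' where "c' = sqrt M * C ^ 3 + 8 * A'\<^sup>2 * C ^ 4 + 8 * c"
  have "Lp_norm (\<mu> 0) s (quad N) \<le> c' * (real N powr (1 / 2 + 2 * \<alpha> + 2 * \<rho>)
    + real N powr (1 / 2 + d / 2 + \<alpha> + 2 * \<rho>) + real N powr (1 + \<alpha> + 2 * \<rho> + d * (1 - b) / 2))"
    if N: "1 \<le> N" for N
  proof -
    define n where "n = real N"
    have n1: "1 \<le> n" using N by (simp add: n_def)
    define \<kappa> where "\<kappa> = C * n powr \<alpha>"
    define v where "v = C * n powr \<rho>"
    have \<kappa>0: "0 \<le> \<kappa>" and v0: "0 \<le> v" using C by (auto simp: \<kappa>_def v_def)
    define E1 where "E1 = n powr (1 / 2 + 2 * \<alpha> + 2 * \<rho>)"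
    define E3 where "E3 = n powr (1 / 2 + d / 2 + \<alpha> + 2 * \<rho>)"
    define E4 where "E4 = n powr (1 + \<alpha> + 2 * \<rho> + d * (1 - b) / 2)"
    have E0: "0 \<le> E1" "0 \<le> E3" "0 \<le> E4" by (auto simp: E1_def E3_def E4_def)
    define m where "m = nat \<lfloor>n powr d\<rfloor>"
    have nd1: "1 \<le> n powr d" using n1 d by (intro ge_one_powr_ge_zero) auto
    have m_le: "real m + 1 \<le> 2 * n powr d" using nd1 by (simp add: m_def) linarith
    have m_ge: "n powr d \<le> real m + 1" using nd1 by (simp add: m_def)
    obtain g where g0: "0 \<le> g" and g: "\<And>j. j \<le> N \<Longrightarrow> Lp_norm (\<mu> j) (2 * q) (G j) \<le> g"
      and gc: "n powr (1 / q) * ((v + 2 * g) * g) \<le> c * n powr (1 / 2 + 1 / (2 * b) + \<alpha> + 2 * \<rho>)"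
      using qc[OF N] by (auto simp: n_def v_def)
    have main: "Lp_norm (\<mu> 0) s (quad N)
        \<le> sqrt (32 * \<kappa>\<^sup>2 * v ^ 4 * A * real N * ((real m + 1) * A + 2 * real N * (B * (real m + 1) powr (1 - b))))
        + 2 * (2 * \<kappa> * v * A')\<^sup>2 + 8 * real N powr (1 / q) * ((v + 2 * g) * g)"
    proof (rule quad_norm_le[where a = a])
      show "\<bar>\<phi> j x\<bar> \<le> v" if "j \<le> N" "x \<in> space (\<mu> j)" for j x
        using \<phi>_le[OF N that] by (simp add: v_def n_def)
      show "Lp_norm (\<mu> j) 2 (pushed i j) \<le> 2 * \<kappa> * v * a (j - i)" if "i \<le> j" "j \<le> N" for i j
        using decay[OF N that] by (simp add: v_def \<kappa>_def n_def)
      show "Lp_norm (\<mu> k) 2 (centered (\<mu> k) (cocycle Suc L (k - j) j (\<lambda>x. \<phi> j x * pushed i j x)))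
          \<le> \<kappa> * v\<^sup>2 * a (k - j)" if "i \<le> j" "j \<le> k" "k \<le> N" for i j k
        using decay2[OF N that] by (simp add: v_def \<kappa>_def n_def)
      show "Lp_norm (\<mu> N) (2 * s) (G N) \<le> 2 * \<kappa> * v * A'"
        using G2s[OF N order_refl] by (simp add: v_def \<kappa>_def n_def)
    qed (use s q v0 \<kappa>0 g0 a0 A R g in auto)
    have sqrt_powr: "sqrt (n powr t) = n powr (t / 2)" for t
      using powr_half_sqrt[of "n powr t"] by (simp add: powr_powr)
    have T1: "sqrt (32 * \<kappa>\<^sup>2 * v ^ 4 * A * real N * ((real m + 1) * A + 2 * real N * (B * (real m + 1) powr (1 - b))))
        \<le> sqrt M * C ^ 3 * (E3 + E4)"
    proof -
      have "(real m + 1) powr (1 - b) \<le> (n powr d) powr (1 - b)"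
        using m_ge nd1 b by (intro powr_mono2') auto
      then have mb: "(real m + 1) powr (1 - b) \<le> n powr (d * (1 - b))" by (simp add: powr_powr)
      have "n * ((real m + 1) * A + 2 * n * (B * (real m + 1) powr (1 - b)))
          \<le> n * (2 * n powr d * A + 2 * n * (B * n powr (d * (1 - b))))"
        using m_le mb n1 A0 B0 by (intro mult_left_mono add_mono mult_right_mono) auto
      also have "\<dots> = 2 * A * n powr (1 + d) + 2 * B * n powr (2 + d * (1 - b))"
      proof -
        have "n powr (1 + d) = n * n powr d" "n powr (2 + d * (1 - b)) = n * n * n powr (d * (1 - b))"
          using n1 by (simp_all add: powr_add power2_eq_square)
        then show ?thesis by (simp only:) (simp add: distrib_left mult_ac)
      qed
      also have "\<dots> \<le> 2 * (A + B) * (n powr (1 + d) + n powr (2 + d * (1 - b)))"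
        using A0 B0 by (simp add: algebra_simps)
      finally have le: "n * ((real m + 1) * A + 2 * n * (B * (real m + 1) powr (1 - b)))
          \<le> 2 * (A + B) * (n powr (1 + d) + n powr (2 + d * (1 - b)))" .
      have "32 * \<kappa>\<^sup>2 * v ^ 4 * A * real N * ((real m + 1) * A + 2 * real N * (B * (real m + 1) powr (1 - b)))
          = 32 * \<kappa>\<^sup>2 * v ^ 4 * A * (n * ((real m + 1) * A + 2 * n * (B * (real m + 1) powr (1 - b))))"
        by (simp add: n_def)
      also have "\<dots> \<le> 32 * \<kappa>\<^sup>2 * v ^ 4 * A * (2 * (A + B) * (n powr (1 + d) + n powr (2 + d * (1 - b))))"
        using \<kappa>0 v0 A0 by (intro mult_left_mono[OF le]) auto
      also have "\<dots> = M * (\<kappa> * v\<^sup>2)\<^sup>2 * (n powr (1 + d) + n powr (2 + d * (1 - b)))"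
        by (simp add: M_def power_mult_distrib)
      finally have "sqrt (32 * \<kappa>\<^sup>2 * v ^ 4 * A * real N * ((real m + 1) * A + 2 * real N * (B * (real m + 1) powr (1 - b))))
          \<le> sqrt (M * (\<kappa> * v\<^sup>2)\<^sup>2 * (n powr (1 + d) + n powr (2 + d * (1 - b))))"
        by (rule real_sqrt_le_mono)
      also have "\<dots> = sqrt M * (\<kappa> * v\<^sup>2) * sqrt (n powr (1 + d) + n powr (2 + d * (1 - b)))"
        using \<kappa>0 by (simp add: real_sqrt_mult)
      also have "\<dots> \<le> sqrt M * (\<kappa> * v\<^sup>2) * (sqrt (n powr (1 + d)) + sqrt (n powr (2 + d * (1 - b))))"
        using \<kappa>0 M0 by (intro mult_left_mono sqrt_add_le_add_sqrt) auto
      also have "sqrt (n powr (1 + d)) = n powr (1 / 2 + d / 2)"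
        by (simp add: sqrt_powr add_divide_distrib)
      also have "sqrt (n powr (2 + d * (1 - b))) = n powr (1 + d * (1 - b) / 2)"
        by (simp add: sqrt_powr add_divide_distrib)
      also have "\<kappa> * v\<^sup>2 = C ^ 3 * (n powr \<alpha> * (n powr \<rho> * n powr \<rho>))"
        by (simp add: \<kappa>_def v_def power2_eq_square power3_eq_cube)
      also have "n powr \<alpha> * (n powr \<rho> * n powr \<rho>) = n powr (\<alpha> + 2 * \<rho>)"
        by (simp flip: powr_add)
      also have "sqrt M * (C ^ 3 * n powr (\<alpha> + 2 * \<rho>)) * (n powr (1 / 2 + d / 2) + n powr (1 + d * (1 - b) / 2))
          = sqrt M * C ^ 3 * (n powr (\<alpha> + 2 * \<rho>) * n powr (1 / 2 + d / 2)
            + n powr (\<alpha> + 2 * \<rho>) * n powr (1 + d * (1 - b) / 2))"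
        by (simp only: distrib_left mult.assoc)
      also have "\<dots> = sqrt M * C ^ 3 * (E3 + E4)"
        by (simp add: E3_def E4_def add_ac flip: powr_add)
      finally show ?thesis .
    qed
    have T2: "2 * (2 * \<kappa> * v * A')\<^sup>2 \<le> 8 * A'\<^sup>2 * C ^ 4 * E1"
    proof -
      have "2 * (2 * \<kappa> * v * A')\<^sup>2 = 8 * A'\<^sup>2 * C ^ 4 * ((n powr \<alpha> * n powr \<alpha>) * (n powr \<rho> * n powr \<rho>))"
        by (simp add: \<kappa>_def v_def power2_eq_square power4_eq_xxxx)
      also have "(n powr \<alpha> * n powr \<alpha>) * (n powr \<rho> * n powr \<rho>) = n powr (2 * \<alpha> + 2 * \<rho>)"
        by (simp flip: powr_add)
      also have "8 * A'\<^sup>2 * C ^ 4 * n powr (2 * \<alpha> + 2 * \<rho>) \<le> 8 * A'\<^sup>2 * C ^ 4 * E1"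
        unfolding E1_def using n1 C by (intro mult_left_mono powr_mono) auto
      finally show ?thesis .
    qed
    have T3: "8 * real N powr (1 / q) * ((v + 2 * g) * g) \<le> 8 * c * (E3 + E4)"
    proof -
      have "n powr (1 / 2 + 1 / (2 * b) + \<alpha> + 2 * \<rho>) \<le> E3 + E4"
      \<comment> \<open>The exponents of \<open>E3\<close> and \<open>E4\<close> agree at \<open>d = 1 / b\<close>; \<open>E3\<close> increases and \<open>E4\<close> decreases in \<open>d\<close>.\<close>
      proof (cases "1 / b \<le> d")
        case True
        have "n powr (1 / 2 + 1 / (2 * b) + \<alpha> + 2 * \<rho>) \<le> E3"
          unfolding E3_def using True n1 by (intro powr_mono) auto
        then show ?thesis using E0 by simp
      next
        case False
        then have "d * (b - 1) \<le> 1 / b * (b - 1)" using b by (intro mult_right_mono) auto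
        also have "\<dots> = 1 - 1 / b" using b by (simp add: field_simps)
        finally have "1 / 2 + 1 / (2 * b) + \<alpha> + 2 * \<rho> \<le> 1 + \<alpha> + 2 * \<rho> + d * (1 - b) / 2"
          by (simp add: right_diff_distrib diff_divide_distrib)
        then have "n powr (1 / 2 + 1 / (2 * b) + \<alpha> + 2 * \<rho>) \<le> E4"
          unfolding E4_def using n1 by (intro powr_mono) auto
        then show ?thesis using E0 by simp
      qed
      then have "c * n powr (1 / 2 + 1 / (2 * b) + \<alpha> + 2 * \<rho>) \<le> c * (E3 + E4)"
        using c0 by (intro mult_left_mono)
      then show ?thesis using gc by (simp add: n_def)
    qed
    have "Lp_norm (\<mu> 0) s (quad N) \<le> sqrt M * C ^ 3 * (E3 + E4) + 8 * A'\<^sup>2 * C ^ 4 * E1 + 8 * c * (E3 + E4)"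
      using main T1 T2 T3 by linarith
    also have "\<dots> \<le> sqrt M * C ^ 3 * (E1 + E3 + E4) + 8 * A'\<^sup>2 * C ^ 4 * (E1 + E3 + E4) + 8 * c * (E1 + E3 + E4)"
      using E0 M0 C c0 by (intro add_mono mult_left_mono) auto
    also have "\<dots> = c' * (E1 + E3 + E4)" by (simp add: c'_def distrib_right)
    finally show ?thesis by (simp add: E1_def E3_def E4_def n_def)
  qed
  then show ?thesis by blast
qed

end

section \<open>Random systems\<close>

lemma lip_norm_facts:
  assumes "lipschitz_fun A g" "A \<noteq> {}"
  shows "0 \<le> lip_norm A g" and "x \<in> A \<Longrightarrow> \<bar>g x\<bar> \<le> lip_norm A g"
proof -
  obtain C0 where C0: "C0-lipschitz_on A g" using assms by (auto simp: lipschitz_fun_def)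
  have inf: "0 \<le> Inf {C. C-lipschitz_on A g}"
    by (rule cInf_greatest) (use C0 in \<open>auto intro: lipschitz_on_nonneg\<close>)
  obtain B where "\<And>y. y \<in> g ` A \<Longrightarrow> norm y \<le> B"
    using assms(1) by (auto simp: lipschitz_fun_def bounded_iff)
  then have bdd: "bdd_above ((\<lambda>x. \<bar>g x\<bar>) ` A)" by (intro bdd_aboveI[of _ B]) auto
  have le: "\<bar>g x\<bar> \<le> lip_norm A g" if "x \<in> A" for x
    using cSUP_upper[OF that bdd] inf by (simp add: lip_norm_def)
  then show "x \<in> A \<Longrightarrow> \<bar>g x\<bar> \<le> lip_norm A g" by simp
  obtain y where "y \<in> A" using assms(2) by blast
  from le[OF this] show "0 \<le> lip_norm A g" by (rule order_trans[OF abs_ge_zero])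
qed

lemma lipschitz_fun_const: "lipschitz_fun A (\<lambda>x. c)"
  by (auto simp: lipschitz_fun_def image_constant_conv intro!: exI[of _ 0] lipschitz_onI)

lemma lip_norm_one:
  assumes "A \<noteq> {}" shows "lip_norm A (\<lambda>x. 1) = 1"
proof -
  have "Inf {C. C-lipschitz_on A (\<lambda>x. 1::real)} = 0"
    by (rule cInf_eq_minimum) (auto intro!: lipschitz_onI dest: lipschitz_on_nonneg)
  then show ?thesis using assms by (simp add: lip_norm_def)
qed

lemma measurable_section:
  assumes f: "(\<lambda>(\<omega>, x). f \<omega> x) \<in> measurable (restrict_space (P \<Otimes>\<^sub>M borel) (Sigma (space P) Mf)) N"
    and \<omega>: "\<omega> \<in> space P" and M: "sets M = sets (restrict_space borel (Mf \<omega>))"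
  shows "f \<omega> \<in> measurable M N"
proof -
  have "Pair \<omega> \<in> measurable (restrict_space borel (Mf \<omega>)) (restrict_space (P \<Otimes>\<^sub>M borel) (Sigma (space P) Mf))"
  proof (rule measurable_restrict_space2)
    show "Pair \<omega> \<in> space (restrict_space borel (Mf \<omega>)) \<rightarrow> Sigma (space P) Mf"
      using \<omega> by (auto simp: space_restrict_space)
    show "Pair \<omega> \<in> measurable (restrict_space borel (Mf \<omega>)) (P \<Otimes>\<^sub>M borel)"
      by (intro measurable_restrict_space1 measurable_Pair1' \<omega>)
  qed
  from measurable_compose[OF this f] have "f \<omega> \<in> measurable (restrict_space borel (Mf \<omega>)) N" by simp
  then show ?thesis using measurable_cong_sets[OF M refl] by blast
qed

theorem proposition19:
  fixes P :: "'w measure" and \<sigma> :: "'w \<Rightarrow> 'w"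
    and Mf :: "'w \<Rightarrow> 'm::metric_space set"
    and T :: "'w \<Rightarrow> 'm \<Rightarrow> 'm"
    and \<mu> :: "'w \<Rightarrow> 'm measure"
    and L :: "'w \<Rightarrow> ('m \<Rightarrow> real) \<Rightarrow> 'm \<Rightarrow> real"
    and \<phi> :: "'w \<Rightarrow> 'm \<Rightarrow> real"
    and r :: ennreal and p s b :: real
    and a :: "real \<Rightarrow> nat \<Rightarrow> real"
  assumes "random_system P \<sigma> Mf T \<mu>"
    and "AE \<omega> in P. is_transfer_operator (\<mu> \<omega>) (\<mu> (\<sigma> \<omega>)) (T \<omega>) (L \<omega>)"
    and "(\<lambda>(\<omega>, x). \<phi> \<omega> x) \<in> borel_measurable (restrict_space (P \<Otimes>\<^sub>M borel) (Sigma (space P) Mf))"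
    and "AE \<omega> in P. (\<integral>x. \<phi> \<omega> x \<partial>\<mu> \<omega>) = 0"
    and "AE \<omega> in P. lipschitz_fun (Mf \<omega>) (\<phi> \<omega>)"
    and "0 < r"
    and "in_Lp P r (\<lambda>\<omega>. lip_norm (Mf \<omega>) (\<phi> \<omega>))"
    and "0 < p"
    and "1 / p + recip r < 1 / 4"
    and "1 / (1 - 2 / p - 2 * recip r) < s" and "s < 2"
    and "decay_condition P \<sigma> Mf \<mu> L p {2, 2 * s} a"
    and "1 < b"
    and "(\<lambda>n. a 2 n) \<in> O(\<lambda>n. real n powr (- b))"
    and "(2 / p + 4 * recip r) / (b - 1) < 1 - 4 * recip r - 2 / p"
    and "summable (\<lambda>n. a (2 * s) (Suc n))"
  shows "AE \<omega> in P. \<forall>\<delta>>0. \<forall>\<delta>\<^sub>s>0.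
    \<delta>\<^sub>s + 2 / p + 4 * recip r + \<delta> + 1 < 2 \<longrightarrow>
    2 + 2 / p + 4 * recip r + \<delta> + \<delta>\<^sub>s * (1 - b) < 2 \<longrightarrow>
      (\<forall>n. in_Lp (\<mu> \<omega>) (ennreal s) (quadratic_deviation \<sigma> T \<mu> L \<phi> \<omega> n)) \<and>
      (\<lambda>n. Lp_norm (\<mu> \<omega>) s (quadratic_deviation \<sigma> T \<mu> L \<phi> \<omega> n)) \<in>
        O(\<lambda>n. real n powr (1 / 2 + 2 / p + 2 * recip r + \<delta>)
            + real n powr (- 1 + 2 / s + 2 / p + 2 * recip r + 2 * \<delta>)
            + real n powr (1 / 2 + \<delta>\<^sub>s / 2 + 1 / p + 2 * recip r + \<delta>)
            + real n powr (1 + 1 / p + 2 * recip r + \<delta>\<^sub>s * (1 - b) / 2))"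
proof -
  define \<alpha> where "\<alpha> = 1 / p"
  define \<rho> where "\<rho> = recip r"
  have \<alpha>0: "0 \<le> \<alpha>" using \<open>0 < p\<close> by (simp add: \<alpha>_def)
  have \<rho>0: "0 \<le> \<rho>" by (simp add: \<rho>_def recip_def)
  have \<alpha>p: "2 / p = 2 * \<alpha>" by (simp add: \<alpha>_def)
  have s1: "1 < s"
  proof -
    have "0 < 1 - 2 * \<alpha> - 2 * \<rho>" using assms(9) by (simp add: \<alpha>_def \<rho>_def)
    then have "1 \<le> 1 / (1 - 2 * \<alpha> - 2 * \<rho>)" using \<alpha>0 \<rho>0 by simp
    then show ?thesis using assms(10) by (simp add: \<alpha>p \<rho>_def)
  qed
  \<comment> \<open>This inequality keeps the von Bahr--Esseen exponent below \<open>b\<close>.\<close>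
  have \<alpha>b: "2 * \<alpha> * b < b - 1"
  proof -
    have "2 * \<alpha> + 4 * \<rho> < (1 - 4 * \<rho> - 2 * \<alpha>) * (b - 1)"
      using assms(15) \<open>1 < b\<close> by (simp add: pos_divide_less_eq \<alpha>p \<rho>_def)
    also have "\<dots> \<le> (1 - 2 * \<alpha>) * (b - 1)" using \<rho>0 \<open>1 < b\<close> by (intro mult_right_mono) auto
    finally show ?thesis using \<rho>0 by (simp add: algebra_simps)
  qed
  interpret P: prob_space P using assms(1) by (simp add: random_system_def ergodic_pps_def)
  have \<sigma>: "\<sigma> \<in> measurable P P" "distr P P \<sigma> = P"
    using assms(1) by (auto simp: random_system_def ergodic_pps_def)
  have fib: "prob_space (\<mu> \<omega>)" "sets (\<mu> \<omega>) = sets (restrict_space borel (Mf \<omega>))"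
    "T \<omega> ` Mf \<omega> \<subseteq> Mf (\<sigma> \<omega>)" if "\<omega> \<in> space P" for \<omega>
    using assms(1) that by (auto simp: random_system_def)
  have spc: "space (\<mu> \<omega>) = Mf \<omega>" if "\<omega> \<in> space P" for \<omega>
    using sets_eq_imp_space_eq[OF fib(2)[OF that]] by (simp add: space_restrict_space)
  have ne: "Mf \<omega> \<noteq> {}" if "\<omega> \<in> space P" for \<omega>
    using prob_space.not_empty[OF fib(1)[OF that]] spc[OF that] by simp
  have Tjoint: "(\<lambda>(\<omega>, x). T \<omega> x) \<in> borel_measurable (restrict_space (P \<Otimes>\<^sub>M borel) (Sigma (space P) Mf))"
    using assms(1) by (simp add: random_system_def)
  have \<sigma>sp: "\<sigma> \<omega> \<in> space P" if "\<omega> \<in> space P" for \<omega>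
    using measurable_space[OF \<sigma>(1) that] .
  have Tm: "T \<omega> \<in> measurable (\<mu> \<omega>) (\<mu> (\<sigma> \<omega>))" if \<omega>: "\<omega> \<in> space P" for \<omega>
  proof -
    have "T \<omega> \<in> measurable (\<mu> \<omega>) (restrict_space borel (Mf (\<sigma> \<omega>)))"
      using measurable_section[OF Tjoint \<omega> fib(2)[OF \<omega>]] fib(3)[OF \<omega>] spc[OF \<omega>]
      by (intro measurable_restrict_space2) auto
    then show ?thesis using measurable_cong_sets[OF refl fib(2)[OF \<sigma>sp[OF \<omega>]]] by blast
  qed
  have pres: "AE \<omega> in P. distr (\<mu> \<omega>) (\<mu> (\<sigma> \<omega>)) (T \<omega>) = \<mu> (\<sigma> \<omega>)"
    using assms(1) by (simp add: random_system_def)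
  obtain K where K: "in_Lp P (ennreal p) K"
    and decay: "AE \<omega> in P. \<forall>s'\<in>{2, 2 * s}. \<forall>r' i j. r' \<le> i \<and> i \<le> j \<longrightarrow>
           (\<forall>g1 g2. lipschitz_fun (Mf ((\<sigma> ^^ r') \<omega>)) g1 \<and> lipschitz_fun (Mf ((\<sigma> ^^ i) \<omega>)) g2 \<longrightarrow>
              Lp_norm (\<mu> ((\<sigma> ^^ j) \<omega>)) s'
                (centered (\<mu> ((\<sigma> ^^ j) \<omega>))
                   (cocycle \<sigma> L (j - i) ((\<sigma> ^^ i) \<omega>)
                      (\<lambda>x. g2 x * cocycle \<sigma> L (i - r') ((\<sigma> ^^ r') \<omega>) g1 x)))
              \<le> K ((\<sigma> ^^ i) \<omega>) * a s' (j - i)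
                 * (1 + lip_norm (Mf ((\<sigma> ^^ r') \<omega>)) g1)
                 * (1 + lip_norm (Mf ((\<sigma> ^^ i) \<omega>)) g2))"
    using assms(12) unfolding decay_condition_def by blast
  have a_pos: "0 < a s' l" if "s' \<in> {2, 2 * s}" for s' l
    using assms(12) that unfolding decay_condition_def by blast
  have "\<exists>Ca\<ge>1. \<forall>n. \<bar>a 2 n\<bar> \<le> Ca * (real n + 1) powr (- b)"
  proof -
    obtain c where c: "0 < c" "\<forall>\<^sub>F n in sequentially. norm (a 2 n) \<le> c * norm (real n powr (- b))"
      using landau_o.bigE[OF assms(14)] by blast
    have "\<forall>\<^sub>F n in sequentially. \<bar>a 2 n\<bar> \<le> (c * 2 powr b) * (real n + 1) powr (- b)"
      using c(2) eventually_ge_at_top[of "1::nat"]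
    proof eventually_elim
      case (elim n)
      have "(2 * real n) powr (- b) \<le> (real n + 1) powr (- b)"
        using elim(2) \<open>1 < b\<close> by (intro powr_mono2') auto
      then have "2 powr b * (2 powr (- b) * real n powr (- b)) \<le> 2 powr b * (real n + 1) powr (- b)"
        by (intro mult_left_mono) (auto simp: powr_mult)
      then have "real n powr (- b) \<le> 2 powr b * (real n + 1) powr (- b)"
        by (simp add: powr_minus field_simps)
      then have "c * real n powr (- b) \<le> c * (2 powr b * (real n + 1) powr (- b))"
        using c(1) by (intro mult_left_mono) auto
      then show ?case using elim(1) by (simp add: mult.assoc)
    qed
    then show ?thesis by (rule bound_from_eventual_bound) simp
  qed
  then obtain Ca where Ca: "1 \<le> Ca" "\<And>n. \<bar>a 2 n\<bar> \<le> Ca * (real n + 1) powr (- b)" by blast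
  define A' where "A' = (\<Sum>n. a (2 * s) (Suc n))"
  have A': "(\<Sum>l<N. a (2 * s) (Suc l)) \<le> A'" for N
    unfolding A'_def using a_pos by (intro sum_le_suminf assms(16)) (auto intro: less_imp_le)
  have Kgrow: "AE \<omega> in P. \<exists>C\<ge>1. \<forall>n. \<bar>K ((\<sigma> ^^ n) \<omega>)\<bar> \<le> C * (real n + 1) powr \<alpha>"
    using AE_growth_along_orbit[OF P.prob_space_axioms \<sigma> _ K] \<open>0 < p\<close> by (simp add: recip_ennreal \<alpha>_def)
  have \<phi>grow: "AE \<omega> in P. \<exists>C\<ge>1. \<forall>n. \<bar>lip_norm (Mf ((\<sigma> ^^ n) \<omega>)) (\<phi> ((\<sigma> ^^ n) \<omega>))\<bar> \<le> C * (real n + 1) powr \<rho>"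
    unfolding \<rho>_def by (rule AE_growth_along_orbit[OF P.prob_space_axioms \<sigma> assms(6,7)])
  show ?thesis
    using AE_space AE_all_iterates[OF \<sigma> assms(2)] AE_all_iterates[OF \<sigma> assms(4)]
      AE_all_iterates[OF \<sigma> assms(5)] AE_all_iterates[OF \<sigma> pres] decay Kgrow \<phi>grow
  proof eventually_elim
    case (elim \<omega>)
    note \<omega> = elim(1) and trans = elim(2) and mean = elim(3) and lips = elim(4) and presn = elim(5)
      and dec = elim(6)
    have sp: "(\<sigma> ^^ n) \<omega> \<in> space P" for n
      using \<omega> by (induction n) (auto intro: \<sigma>sp)
    obtain C1 where C1: "1 \<le> C1" "\<And>n. \<bar>K ((\<sigma> ^^ n) \<omega>)\<bar> \<le> C1 * (real n + 1) powr \<alpha>"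
      using elim(7) by blast
    obtain C2 where C2: "1 \<le> C2"
      "\<And>n. \<bar>lip_norm (Mf ((\<sigma> ^^ n) \<omega>)) (\<phi> ((\<sigma> ^^ n) \<omega>))\<bar> \<le> C2 * (real n + 1) powr \<rho>"
      using elim(8) by blast
    define \<mu>' where "\<mu>' = (\<lambda>n. \<mu> ((\<sigma> ^^ n) \<omega>))"
    define T' where "T' = (\<lambda>n. T ((\<sigma> ^^ n) \<omega>))"
    define L' where "L' = (\<lambda>n. L ((\<sigma> ^^ n) \<omega>))"
    define \<phi>' where "\<phi>' = (\<lambda>n. \<phi> ((\<sigma> ^^ n) \<omega>))"
    define \<Lambda> where "\<Lambda> n = lip_norm (Mf ((\<sigma> ^^ n) \<omega>)) (\<phi>' n)" for n
    have \<Lambda>0: "0 \<le> \<Lambda> n" and \<phi>\<Lambda>: "x \<in> space (\<mu>' n) \<Longrightarrow> \<bar>\<phi>' n x\<bar> \<le> \<Lambda> n" for n x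
      using lip_norm_facts[of "Mf ((\<sigma> ^^ n) \<omega>)" "\<phi>' n"] lips ne[OF sp[of n]] spc[OF sp[of n]]
      by (auto simp: \<Lambda>_def \<phi>'_def \<mu>'_def)
    interpret nonstationary_system \<mu>' T' L' \<phi>'
    proof (rule nonstationary_system.intro)
      fix k
      show "prob_space (\<mu>' k)" using fib(1)[OF sp] by (simp add: \<mu>'_def)
      show "T' k \<in> measurable (\<mu>' k) (\<mu>' (Suc k))" using Tm[OF sp] by (simp add: \<mu>'_def T'_def)
      show "distr (\<mu>' k) (\<mu>' (Suc k)) (T' k) = \<mu>' (Suc k)" using presn by (simp add: \<mu>'_def T'_def)
      show "is_transfer_operator (\<mu>' k) (\<mu>' (Suc k)) (T' k) (L' k)"
        using trans by (simp add: \<mu>'_def T'_def L'_def)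
      show "(\<integral>x. \<phi>' k x \<partial>\<mu>' k) = 0" using mean by (simp add: \<mu>'_def \<phi>'_def)
      show "bdd_measurable (\<mu>' k) (\<phi>' k)"
      proof (rule bdd_measurableI)
        show "\<phi>' k \<in> borel_measurable (\<mu>' k)"
          unfolding \<phi>'_def \<mu>'_def by (rule measurable_section[OF assms(3) sp fib(2)[OF sp]])
      qed (rule \<phi>\<Lambda>)
    qed
    have cT: "cocycle Suc T' n i = cocycle \<sigma> T n ((\<sigma> ^^ i) \<omega>)" for n i
      unfolding T'_def by (rule cocycle_shift)
    have cL: "cocycle Suc L' n i = cocycle \<sigma> L n ((\<sigma> ^^ i) \<omega>)" for n i
      unfolding L'_def by (rule cocycle_shift)
    have Geq: "G_part \<sigma> L \<phi> \<omega> n = G n" for n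
      by (simp add: G_part_def cL \<phi>'_def)
    have Heq: "H_part \<sigma> T L \<phi> \<omega> n = H n" for n
      by (simp add: H_part_def Geq T'_def \<phi>'_def)
    have Qeq: "quadratic_deviation \<sigma> T \<mu> L \<phi> \<omega> n = quad n" for n
      using cT[of _ 0] by (simp add: quadratic_deviation_def Heq \<mu>'_def)
    have \<mu>0: "\<mu> \<omega> = \<mu>' 0" by (simp add: \<mu>'_def)
    \<comment> \<open>The powers of \<open>2\<close> absorb \<open>j + 1 \<le> 2 * N\<close>, so that one bound in terms of \<open>N\<close> serves all \<open>j \<le> N\<close>.\<close>
    define C where "C = max (C1 * 2 powr \<alpha>) ((1 + C2) * 2 powr \<rho>)"
    have C: "1 \<le> C"
    proof -
      have "1 * 1 \<le> C1 * 2 powr \<alpha>" using C1 \<alpha>0 by (intro mult_mono ge_one_powr_ge_zero) auto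
      then show ?thesis by (simp add: C_def le_max_iff_disj)
    qed
    have double: "(real j + 1) powr t \<le> 2 powr t * real N powr t" if "1 \<le> N" "j \<le> N" "0 \<le> t" for j N t
    proof -
      have "(real j + 1) powr t \<le> (2 * real N) powr t" using that by (intro powr_mono2) auto
      then show ?thesis by (simp add: powr_mult)
    qed
    have KN: "K ((\<sigma> ^^ j) \<omega>) \<le> C * real N powr \<alpha>" if N: "1 \<le> N" "j \<le> N" for j N
    proof -
      have "K ((\<sigma> ^^ j) \<omega>) \<le> C1 * (real j + 1) powr \<alpha>" using C1(2)[of j] by simp
      also have "\<dots> \<le> C1 * (2 powr \<alpha> * real N powr \<alpha>)"
        using C1(1) by (intro mult_left_mono double N \<alpha>0) auto
      also have "\<dots> = (C1 * 2 powr \<alpha>) * real N powr \<alpha>" by simp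
      also have "\<dots> \<le> C * real N powr \<alpha>" by (intro mult_right_mono) (auto simp: C_def)
      finally show ?thesis .
    qed
    have \<Lambda>N: "1 + \<Lambda> j \<le> C * real N powr \<rho>" if N: "1 \<le> N" "j \<le> N" for j N
    proof -
      have "1 + \<Lambda> j \<le> 1 + C2 * (real j + 1) powr \<rho>" using C2(2)[of j] by (simp add: \<Lambda>_def \<phi>'_def)
      also have "\<dots> \<le> (real j + 1) powr \<rho> + C2 * (real j + 1) powr \<rho>"
        using \<rho>0 by (intro add_right_mono ge_one_powr_ge_zero) auto
      also have "\<dots> = (1 + C2) * (real j + 1) powr \<rho>" by (simp add: distrib_right)
      also have "\<dots> \<le> (1 + C2) * (2 powr \<rho> * real N powr \<rho>)"
        using C2(1) by (intro mult_left_mono double N \<rho>0) auto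
      also have "\<dots> = ((1 + C2) * 2 powr \<rho>) * real N powr \<rho>" by simp
      also have "\<dots> \<le> C * real N powr \<rho>" by (intro mult_right_mono) (auto simp: C_def)
      finally show ?thesis .
    qed
    have lipsn: "lipschitz_fun (Mf ((\<sigma> ^^ n) \<omega>)) (\<phi>' n)" for n using lips by (simp add: \<phi>'_def)
    have pushed_decay: "Lp_norm (\<mu>' j) s' (pushed i j)
        \<le> 2 * (C * real N powr \<alpha>) * (C * real N powr \<rho>) * a s' (j - i)"
      if N: "1 \<le> N" and ij: "i \<le> j" and jN: "j \<le> N" and s': "s' \<in> {2, 2 * s}" for N i j s'
    proof -
      \<comment> \<open>The decay condition is used at equal times \<open>r' = i\<close> with the constant function \<open>1\<close> as second factor,
        whose Lipschitz norm is \<open>1\<close>.\<close>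
      have "centered (\<mu>' j) (pushed i j) = pushed i j"
        using pushed_mean[OF ij] by (simp add: centered_def)
      then have "Lp_norm (\<mu>' j) s' (pushed i j) = Lp_norm (\<mu>' j) s' (centered (\<mu>' j) (pushed i j))" by simp
      also have "\<dots> \<le> K ((\<sigma> ^^ i) \<omega>) * a s' (j - i) * (1 + \<Lambda> i) * (1 + lip_norm (Mf ((\<sigma> ^^ i) \<omega>)) (\<lambda>x. 1))"
        using dec[rule_format, OF s', of i i j "\<phi>' i" "\<lambda>x. 1"] ij lipsn lipschitz_fun_const[of "Mf ((\<sigma> ^^ i) \<omega>)" 1]
        by (simp add: pushed_def cL \<mu>'_def \<Lambda>_def)
      also have "\<dots> = K ((\<sigma> ^^ i) \<omega>) * (a s' (j - i) * (1 + \<Lambda> i) * 2)"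
        by (simp add: lip_norm_one[OF ne[OF sp]])
      also have "\<dots> \<le> (C * real N powr \<alpha>) * (a s' (j - i) * (C * real N powr \<rho>) * 2)"
        using KN[OF N, of i] \<Lambda>N[OF N, of i] \<Lambda>0[of i] a_pos[OF s', of "j - i"] ij jN C
        by (intro mult_mono mult_nonneg_nonneg) auto
      finally show ?thesis by (simp add: mult_ac)
    qed
    have product_decay: "Lp_norm (\<mu>' k) 2 (centered (\<mu>' k) (cocycle Suc L' (k - j) j (\<lambda>x. \<phi>' j x * pushed i j x)))
        \<le> (C * real N powr \<alpha>) * (C * real N powr \<rho>)\<^sup>2 * a 2 (k - j)"
      if N: "1 \<le> N" and ij: "i \<le> j" and jk: "j \<le> k" and kN: "k \<le> N" for N i j k
    proof -
      have "Lp_norm (\<mu>' k) 2 (centered (\<mu>' k) (cocycle Suc L' (k - j) j (\<lambda>x. \<phi>' j x * pushed i j x)))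
          \<le> K ((\<sigma> ^^ j) \<omega>) * a 2 (k - j) * (1 + \<Lambda> i) * (1 + \<Lambda> j)"
        using dec[rule_format, of 2 i j k "\<phi>' i" "\<phi>' j"] ij jk lipsn
        by (simp add: pushed_def cL \<mu>'_def \<Lambda>_def)
      also have "\<dots> = K ((\<sigma> ^^ j) \<omega>) * (a 2 (k - j) * ((1 + \<Lambda> i) * (1 + \<Lambda> j)))" by simp
      also have "\<dots> \<le> (C * real N powr \<alpha>) * (a 2 (k - j) * ((C * real N powr \<rho>) * (C * real N powr \<rho>)))"
        using KN[OF N, of j] \<Lambda>N[OF N, of i] \<Lambda>N[OF N, of j] \<Lambda>0[of i] \<Lambda>0[of j] a_pos[of 2 "k - j"] ij jk kN C
        by (intro mult_mono mult_nonneg_nonneg) auto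
      finally show ?thesis by (simp add: power2_eq_square mult_ac)
    qed
    have growth: "\<exists>c. \<forall>N\<ge>1. Lp_norm (\<mu>' 0) s (quad N) \<le> c * (real N powr (1 / 2 + 2 * \<alpha> + 2 * \<rho>)
        + real N powr (1 / 2 + d / 2 + \<alpha> + 2 * \<rho>) + real N powr (1 + \<alpha> + 2 * \<rho> + d * (1 - b) / 2))"
      if d: "0 < d" for d
    proof (rule quad_growth[where a = "a 2" and a' = "a (2 * s)" and Ca = Ca and A' = A' and C = C])
      show "\<bar>\<phi>' j x\<bar> \<le> C * real N powr \<rho>" if "1 \<le> N" "j \<le> N" "x \<in> space (\<mu>' j)" for N j x
        using \<phi>\<Lambda>[OF that(3)] \<Lambda>N[OF that(1,2)] by simp
      show "0 \<le> a 2 l" for l using a_pos[of 2 l] by simp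
      show "0 \<le> a (2 * s) l" for l using a_pos[of "2 * s" l] by simp
      show "a 2 l \<le> Ca * (real l + 1) powr (- b)" for l using Ca(2)[of l] by simp
    qed (use s1 assms(11,13) \<alpha>0 \<alpha>b C Ca A' d pushed_decay product_decay in auto)
    show ?case
      unfolding Qeq \<mu>0
    proof (intro allI impI conjI)
      fix n
      have qb: "bdd_measurable (\<mu>' 0) (quad n)" by (rule quad_bdd)
      have "integrable (\<mu>' 0) (\<lambda>x. \<bar>quad n x\<bar> powr s)"
        using s1 by (intro prob_space.integrable_bdd_measurable[OF prob] bdd_measurable_abs_powr qb) auto
      then show "in_Lp (\<mu>' 0) (ennreal s) (quad n)"
        using bdd_measurable_borel[OF qb] s1 unfolding in_Lp_def by (intro bexI[of _ "quad n"]) auto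
    next
      fix \<delta> d :: real
      assume \<delta>: "0 < \<delta>" and d: "0 < d"
      obtain c where c: "\<And>N. 1 \<le> N \<Longrightarrow> Lp_norm (\<mu>' 0) s (quad N) \<le> c * (real N powr (1 / 2 + 2 * \<alpha> + 2 * \<rho>)
        + real N powr (1 / 2 + d / 2 + \<alpha> + 2 * \<rho>) + real N powr (1 + \<alpha> + 2 * \<rho> + d * (1 - b) / 2))"
        using growth[OF d] by blast
      show "(\<lambda>n. Lp_norm (\<mu>' 0) s (quad n)) \<in>
        O(\<lambda>n. real n powr (1 / 2 + 2 / p + 2 * recip r + \<delta>)
            + real n powr (- 1 + 2 / s + 2 / p + 2 * recip r + 2 * \<delta>)
            + real n powr (1 / 2 + d / 2 + 1 / p + 2 * recip r + \<delta>)
            + real n powr (1 + 1 / p + 2 * recip r + d * (1 - b) / 2))"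
        unfolding \<alpha>p \<alpha>_def[symmetric] \<rho>_def[symmetric]
      proof (rule landau_o.bigI[of "\<bar>c\<bar> + 1"])
        show "\<forall>\<^sub>F n in sequentially. norm (Lp_norm (\<mu>' 0) s (quad n)) \<le> (\<bar>c\<bar> + 1) *
          norm (real n powr (1 / 2 + 2 * \<alpha> + 2 * \<rho> + \<delta>)
            + real n powr (- 1 + 2 / s + 2 * \<alpha> + 2 * \<rho> + 2 * \<delta>)
            + real n powr (1 / 2 + d / 2 + \<alpha> + 2 * \<rho> + \<delta>)
            + real n powr (1 + \<alpha> + 2 * \<rho> + d * (1 - b) / 2))"
          using eventually_ge_at_top[of "1::nat"]
        proof eventually_elim
          case (elim n)
          let ?x = "real n powr (1 / 2 + 2 * \<alpha> + 2 * \<rho>)"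
          let ?y = "real n powr (1 / 2 + d / 2 + \<alpha> + 2 * \<rho>)"
          let ?z = "real n powr (1 + \<alpha> + 2 * \<rho> + d * (1 - b) / 2)"
          have xy: "?x \<le> real n powr (1 / 2 + 2 * \<alpha> + 2 * \<rho> + \<delta>)"
            "?y \<le> real n powr (1 / 2 + d / 2 + \<alpha> + 2 * \<rho> + \<delta>)"
            using elim \<delta> by (auto intro!: powr_mono)
          have "Lp_norm (\<mu>' 0) s (quad n) \<le> c * (?x + ?y + ?z)" by (rule c[OF elim])
          also have "\<dots> \<le> (\<bar>c\<bar> + 1) * (?x + ?y + ?z)" by (intro mult_right_mono) auto
          also have "\<dots> \<le> (\<bar>c\<bar> + 1) * (real n powr (1 / 2 + 2 * \<alpha> + 2 * \<rho> + \<delta>)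
            + real n powr (- 1 + 2 / s + 2 * \<alpha> + 2 * \<rho> + 2 * \<delta>)
            + real n powr (1 / 2 + d / 2 + \<alpha> + 2 * \<rho> + \<delta>) + ?z)"
          proof (rule mult_left_mono)
            have "x + y + z \<le> x' + w + y' + z" if "x \<le> x'" "y \<le> y'" "0 \<le> w" for x y z x' y' w :: real
              using that by linarith
            from this[OF xy powr_ge_zero] show "?x + ?y + ?z \<le> real n powr (1 / 2 + 2 * \<alpha> + 2 * \<rho> + \<delta>)
              + real n powr (- 1 + 2 / s + 2 * \<alpha> + 2 * \<rho> + 2 * \<delta>)
              + real n powr (1 / 2 + d / 2 + \<alpha> + 2 * \<rho> + \<delta>) + ?z" .
          qed simp
          finally show ?case by simp
        qed
      qed simp
    qed
  qed
qed

end
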